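(* Let $0<\theta\le1$ and let $(\mathcal{T}_\ell)_{\ell\in\mathbb{N}_0}$ be the sequence of meshes generated by the adaptive algorithm with bulk parameter $\theta$. Let $C_1>0$, $0<\rho_2<1$, $C_2>0$, $C_{\rm rel}>0$ be constants such that, for all $\mathcal{T}\in\mathbb{T}(\mathcal{T}_0)$ and all $\hat{\mathcal{T}}\in\mathbb{T}(\mathcal{T})$ (such constants exist): (A1) $\big|\big(\sum_{T\in\mathcal{S}}\eta_T(\hat{\mathcal{T}};\hat z)^2\big)^{1/2}-\big(\sum_{T\in\mathcal{S}}\eta_T(\mathcal{T};z)^2\big)^{1/2}\big|\le C_1\,\mathrm{d}[\hat z,z]$ for all $\mathcal{S}\subseteq\mathcal{T}\cap\hat{\mathcal{T}}$, $z\in X(\mathcal{T})$, $\hat z\in X(\hat{\mathcal{T}})$; (A2) $\sum_{\hat T\in\hat{\mathcal{T}}\setminus\mathcal{T}}\eta_{\hat T}(\hat{\mathcal{T}};U(\hat{\mathcal{T}}))^2\le\rho_2\sum_{T\in\mathcal{T}\setminus\hat{\mathcal{T}}}\eta_T(\mathcal{T};U(\mathcal{T}))^2+C_2\,\mathrm{d}[U(\hat{\mathcal{T}}),U(\mathcal{T})]^2$; (reliability) $\mathrm{d}[u,U(\mathcal{T})]\le C_{\rm rel}\,\eta(\mathcal{T};U(\mathcal{T}))$. Then there exist constants $$0\le\varepsilon_3<\varepsilon_3^*(\theta):=\sup_{\delta>0}\frac{1-(1+\delta)(1-(1-\rho_2)\,\theta)}{C_{\rm rel}^2\,(C_2+(1+\delta^{-1})\,C_1^2)}$$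 and $C_3(\varepsilon_3)\ge1$ such that $$\sum_{k=\ell}^N\Big(\mathrm{d}[U(\mathcal{T}_{k+1}),U(\mathcal{T}_k)]^2-\varepsilon_3\,\mathrm{d}[u,U(\mathcal{T}_k)]^2\Big)\le C_3(\varepsilon_3)\,\eta(\mathcal{T}_\ell;U(\mathcal{T}_\ell))^2$$ for all $\ell,N\in\mathbb{N}_0$ with $N\ge\ell$.
   Context: For a finite set $\mathcal{M}$ of elements, $|\mathcal{M}|$ is its cardinality; for an element $T$, $|T|$ is its measure; for a matrix $q$, $|q|$ is the Frobenius norm, and $\tau:\mu$ is the Frobenius inner product. **Continuous problem.** Let $d\in\{2,3\}$ and let $\Omega\subset\mathbb{R}^d$ be a domain with Lipschitz boundary $\partial\Omega$, which is split into a closed non-empty part $\Gamma_D\subset\partial\Omega$ of positive surface measure and an open part $\Gamma_N:=\partial\Omega\setminus\Gamma_D$ (possibly empty). Let $f\in L^2(\Omega;\mathbb{R}^d)$, $g\in L^2(\Gamma_N;\mathbb{R}^d)$. Put $\mathbb{S}_d:=\{q\in\mathbb{R}^{d\times d}\mid q_{ji}=q_{ij}\}$, $\mathbb{S}_{d,0}:=\{q\in\mathbb{S}_d\mid \sum_{j=1}^d q_{jj}=0\}$, $V:=\{v\in H^1(\Omega;\mathbb{R}^d)\mid v=0\text{ on }\Gamma_D\}$, $Q:=L^2(\Omega;\mathbb{S}_{d,0})$, $M:=L^2(\Omega)$, $X:=V\times Q\times M$. For $w\in V$, $\varepsilon(w):=\frac12(\nabla w+(\nabla w)^T)$. Let $\mathbb{C}$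 be the isotropic elasticity tensor, symmetric and constant, with $\kappa_{\mathbb{C}}|\tau|^2\le\mathbb{C}\tau:\tau$ for all $\tau\in L^2(\Omega;\mathbb{S}_d)$, and $\mathbb{H}$ the hardening tensor, symmetric with $\kappa_{\mathbb{H}}|\tau|^2\le\mathbb{H}\tau:\tau$ for all $\tau\in L^2(\Omega;\mathbb{S}_d)$, where $\kappa_{\mathbb{C}},\kappa_{\mathbb{H}}>0$ are constants. Let $H>0$ be the isotropic hardening modulus and $\sigma_y>0$ the constant yield stress. The stress is $\sigma(w,p):=\mathbb{C}(\varepsilon(w)-p)$. Let $j(q,\beta):=\sigma_y|q|$ if $|q|\le\beta$ and $j(q,\beta):=\infty$ otherwise. For $u=(w,p,\alpha)$, $z=(v,q,\beta)\in X$ let $$a(u,z):=(\sigma(w,p),\varepsilon(v)-q)_{L^2(\Omega)}+(\mathbb{H}p,q)_{L^2(\Omega)}+(H\alpha,\beta)_{L^2(\Omega)},$$ $$\psi(z):=\int_\Omega j(q,\beta)\,dx,\qquad b(z):=(f,v)_{L^2(\Omega)}+(g,v)_{L^2(\Gamma_N)}.$$ $u\in X$ denotes the unique solution of $b(z-u)\le a(u,z-u)+\psi(z)-\psi(u)$ for all $z\in X$. **Meshes and refinement.** A mesh $\mathcal{T}$ is a finite decomposition of $\Omega$, $\overline\Omega=\bigcup_{T\in\mathcal{T}}T$, into closed triangles ($d=2$) or tetrahedra ($d=3$), which is conforming, i.e. the intersection of two elements is either empty or a common face, edge or vertex. Each $T\in\mathcal{T}$ has a fixed edge $E_T$ (the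 reference edge). For a set $\mathcal{M}\subset\mathcal{T}$ of elements to be refined, newest vertex bisection (for dimension $d\ge2$ in the generalization of Maubach, Traxler and Stevenson) generates the new mesh $\operatorname{NVB}(\mathcal{T},\mathcal{M})$ as follows. First, each $T\in\mathcal{M}$ is bisected into two triangles or tetrahedra, where the midpoint of $E_T$ (the newest vertex) is connected to the vertex opposite to $E_T$; the edges opposite to the newest vertex are the reference edges of the new triangles or tetrahedra. Second, in the same way all elements of the resulting mesh which have a hanging node (a vertex of the mesh in the interior of an edge of the element) are bisected, until there are no hanging nodes. $\mathbb{T}(\mathcal{T})$ is the set of all meshes created from $\mathcal{T}$ by finitely many successive applications of newest vertex bisection. $\mathcal{T}_0$ is a fixed initial mesh. The meshes in $\mathbb{T}(\mathcal{T}_0)$ are uniformly shape regular: there is $c>0$ with $h_T\le c\,\rho_T$ for all elements $T$ of all these meshes, where $h_T$ is the diameter and $\rho_T$ the inradius of $T$. **Discrete problem.** $X(\mathcal{T}):=V(\mathcal{T})\times Q(\mathcal{T})\times M(\mathcal{T})$, where $V(\mathcal{T})$ consists of the functions in $V$ that are affine on every element, and $Q(\mathcal{T})$, $M(\mathcal{T})$ consist of the functions with values in $\mathbb{S}_{d,0}$, resp. $\mathbb{R}$, that are constant on every element. $U(\mathcal{T})\in X(\mathcal{T})$ is the unique solution of $b(z-U(\mathcal{T}))\le a(U(\mathcal{T}),z-U(\mathcal{T}))+\psi(z)-\psi(U(\mathcal{T}))$ for all $z\in X(\mathcal{T})$. **Error measure and estimator.** For $z=(v,q,\beta)$, $\hat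 z=(\hat v,\hat q,\hat\beta)\in X$: $\mathrm{d}[z,\hat z]:=\|\sigma(v,q)-\sigma(\hat v,\hat q)\|_{L^2(\Omega;\mathbb{R}^{d\times d})}$. For $T\in\mathcal{T}$ and $z=(v,q,\beta)\in X(\mathcal{T})$ (for both $d=2$ and $d=3$), $$\eta_T(\mathcal{T};z)^2:=|T|\,\|f\|_{L^2(T;\mathbb{R}^d)}^2+|T|^{1/2}\sum_{E\in\mathcal{E}(T)}R_E(z)^2,\qquad \eta(\mathcal{T};z)^2:=\sum_{T\in\mathcal{T}}\eta_T(\mathcal{T};z)^2,$$ where $\mathcal{E}(T)$ is the set of edges ($d=2$) or faces ($d=3$) of $T$, and, with $\nu_E$ the fixed unit normal corresponding to $E$, $R_E(z):=\|[\sigma(v,q)]\nu_E\|_{L^2(E;\mathbb{R}^d)}$ for interior $E$ ($[\cdot]$ the jump along $E$), $R_E(z):=\|g-\sigma(v,q)\nu_E\|_{L^2(E;\mathbb{R}^d)}$ for $E$ on $\Gamma_N$, $R_E(z):=0$ for $E$ on $\Gamma_D$. **Adaptive algorithm.** Given $0<\theta\le1$ and $\mathcal{T}_0$, for $\ell\in\mathbb{N}_0$ let $\mathcal{M}_\ell\subset\mathcal{T}_\ell$ be a set of minimal cardinality with $\theta\,\eta(\mathcal{T}_\ell;U(\mathcal{T}_\ell))^2\le\sum_{T\in\mathcal{M}_\ell}\eta_T(\mathcal{T}_\ell;U(\mathcal{T}_\ell))^2$, and $\mathcal{T}_{\ell+1}:=\operatorname{NVB}(\mathcal{T}_\ell,\mathcal{M}_\ell)$.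 *)

theory Defs
  imports "HOL-Analysis.Analysis"
begin

section \<open>Surface measure\<close>

text \<open>Hausdorff measure of dimension \<open>s\<close>, normalised so that it agrees with the Lebesgue
  measure on flat pieces. The covering sets are required to be bounded because the diameter of an
  unbounded set is a junk value.\<close>

definition hausdorff_pre :: "real \<Rightarrow> real \<Rightarrow> 'a::euclidean_space set \<Rightarrow> ennreal" where
  "hausdorff_pre s \<delta> A =
     (INF B \<in> {B :: nat \<Rightarrow> 'a set. A \<subseteq> (\<Union>i. B i) \<and> (\<forall>i. bounded (B i) \<and> diameter (B i) \<le> \<delta>)}.
        \<Sum>i. ennreal (unit_ball_vol s * (diameter (B i) / 2) powr s))"

definition hausdorff_outer :: "real \<Rightarrow> 'a::euclidean_space set \<Rightarrow> ennreal" where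
  "hausdorff_outer s A = (SUP \<delta> \<in> {0<..}. hausdorff_pre s \<delta> A)"

definition hausdorff_measure :: "real \<Rightarrow> 'a::euclidean_space measure" where
  "hausdorff_measure s = completion (measure_of UNIV (sets borel) (hausdorff_outer s))"

definition surface :: "(real^'n) measure" where
  "surface = hausdorff_measure (real (CARD('n) - 1))"

abbreviation surface_on :: "(real^'n) set \<Rightarrow> (real^'n) measure" where
  "surface_on S \<equiv> restrict_space surface S"


section \<open>Square integrable functions, Sobolev functions and traces\<close>

text \<open>Elements of \<open>L\<^sup>2\<close> and \<open>H\<^sup>1\<close> are represented by functions on the whole space; only
  their values almost everywhere on the set in question matter.\<close>

definition L2 :: "'a measure \<Rightarrow> ('a \<Rightarrow> 'b::euclidean_space) set" where
  "L2 M = {w \<in> borel_measurable M. integrable M (\<lambda>x. (norm (w x))\<^sup>2)}"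

definition l2_inner :: "'a measure \<Rightarrow> ('a \<Rightarrow> 'b::euclidean_space) \<Rightarrow> ('a \<Rightarrow> 'b) \<Rightarrow> real" where
  "l2_inner M u w = (LINT x|M. u x \<bullet> w x)"

definition l2_norm :: "'a measure \<Rightarrow> ('a \<Rightarrow> 'b::euclidean_space) \<Rightarrow> real" where
  "l2_norm M w = sqrt (LINT x|M. (norm (w x))\<^sup>2)"

text \<open>\<open>\<phi>\<close> is continuously differentiable with compact support in \<open>\<Omega>\<close> and has the gradient \<open>g\<close>.
  As in Gilbarg and Trudinger, weak first derivatives are tested with \<open>C\<^sup>1\<close> functions; by
  mollification this is the same as testing with smooth functions.\<close>

definition test_function :: "(real^'n) set \<Rightarrow> (real^'n \<Rightarrow> real) \<Rightarrow> (real^'n \<Rightarrow> real^'n) \<Rightarrow> bool" where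
  "test_function \<Omega> \<phi> g \<longleftrightarrow>
     (\<forall>x. GDERIV \<phi> x :> g x) \<and> continuous_on UNIV g \<and>
     compact (closure {x. \<phi> x \<noteq> 0}) \<and> closure {x. \<phi> x \<noteq> 0} \<subseteq> \<Omega>"

definition weak_gradient ::
  "(real^'n) set \<Rightarrow> (real^'n \<Rightarrow> real^'n) \<Rightarrow> (real^'n \<Rightarrow> real^'n^'n) \<Rightarrow> bool" where
  "weak_gradient \<Omega> v G \<longleftrightarrow>
     (\<forall>\<phi> g. test_function \<Omega> \<phi> g \<longrightarrow>
        (\<forall>i j. (LINT x|lebesgue_on \<Omega>. v x $ i * g x $ j)
              = - (LINT x|lebesgue_on \<Omega>. G x $ i $ j * \<phi> x)))"

definition H1 :: "(real^'n) set \<Rightarrow> (real^'n \<Rightarrow> real^'n) set" where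
  "H1 \<Omega> = {v \<in> L2 (lebesgue_on \<Omega>). \<exists>G \<in> L2 (lebesgue_on \<Omega>). weak_gradient \<Omega> v G}"

definition grad :: "(real^'n) set \<Rightarrow> (real^'n \<Rightarrow> real^'n) \<Rightarrow> real^'n \<Rightarrow> real^'n^'n" where
  "grad \<Omega> v = (SOME G. G \<in> L2 (lebesgue_on \<Omega>) \<and> weak_gradient \<Omega> v G)"

definition strain :: "(real^'n) set \<Rightarrow> (real^'n \<Rightarrow> real^'n) \<Rightarrow> real^'n \<Rightarrow> real^'n^'n" where
  "strain \<Omega> w x = (1/2) *\<^sub>R (grad \<Omega> w x + transpose (grad \<Omega> w x))"

text \<open>The trace of a Sobolev function on the boundary of a Lipschitz domain, given almost
  everywhere by the one-sided approximate limits (Evans and Gariepy, Section 5.3; Ambrosio, Fusco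
  and Pallara, Theorem 3.87). On a bounded Lipschitz domain every \<open>H\<^sup>1\<close> function has a trace,
  so the existence requirement in \<open>vanishes_on\<close> is no restriction.\<close>

definition has_trace :: "(real^'n) set \<Rightarrow> (real^'n \<Rightarrow> real^'n) \<Rightarrow> (real^'n \<Rightarrow> real^'n) \<Rightarrow> bool" where
  "has_trace \<Omega> v \<gamma> \<longleftrightarrow>
     \<gamma> \<in> L2 (surface_on (frontier \<Omega>)) \<and>
     (AE x in surface_on (frontier \<Omega>).
        ((\<lambda>r. (LINT y|lebesgue_on (\<Omega> \<inter> ball x r). norm (v y - \<gamma> x))
              / measure lebesgue (\<Omega> \<inter> ball x r)) \<longlongrightarrow> 0) (at_right 0))"

definition bd_trace :: "(real^'n) set \<Rightarrow> (real^'n \<Rightarrow> real^'n) \<Rightarrow> real^'n \<Rightarrow> real^'n" where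
  "bd_trace \<Omega> v = (SOME \<gamma>. has_trace \<Omega> v \<gamma>)"

definition vanishes_on :: "(real^'n) set \<Rightarrow> (real^'n) set \<Rightarrow> (real^'n \<Rightarrow> real^'n) \<Rightarrow> bool" where
  "vanishes_on \<Omega> \<Gamma> v \<longleftrightarrow> (\<exists>\<gamma>. has_trace \<Omega> v \<gamma> \<and> (AE x in surface_on \<Gamma>. \<gamma> x = 0))"

text \<open>Locally, \<open>\<Omega>\<close> is the strict epigraph, in some direction \<open>e\<close>, of a Lipschitz function of the
  component orthogonal to \<open>e\<close>.\<close>

definition lipschitz_boundary :: "(real^'n) set \<Rightarrow> bool" where
  "lipschitz_boundary \<Omega> \<longleftrightarrow>
     (\<forall>x \<in> frontier \<Omega>. \<exists>U e L (\<zeta> :: real^'n \<Rightarrow> real).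
        open U \<and> x \<in> U \<and> norm e = 1 \<and> L-lipschitz_on UNIV \<zeta> \<and>
        \<Omega> \<inter> U = {y \<in> U. \<zeta> (y - (y \<bullet> e) *\<^sub>R e) < y \<bullet> e})"


section \<open>The continuous problem\<close>

text \<open>\<open>norm\<close> and \<open>\<bullet>\<close> on matrices \<open>real^'n^'n\<close> are the Frobenius norm and inner product.\<close>

definition sym_matrices :: "(real^'n^'n) set" where
  "sym_matrices = {q. transpose q = q}"

definition dev_matrices :: "(real^'n^'n) set" where
  "dev_matrices = {q \<in> sym_matrices. trace q = 0}"

definition coercive_tensor :: "(real^'n^'n \<Rightarrow> real^'n^'n) \<Rightarrow> bool" where
  "coercive_tensor A \<longleftrightarrow> (\<exists>\<kappa>>0. \<forall>\<tau> \<in> sym_matrices. \<kappa> * (norm \<tau>)\<^sup>2 \<le> A \<tau> \<bullet> \<tau>)"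

definition symmetric_tensor :: "(real^'n^'n \<Rightarrow> real^'n^'n) \<Rightarrow> bool" where
  "symmetric_tensor A \<longleftrightarrow>
     linear A \<and> A ` sym_matrices \<subseteq> sym_matrices \<and>
     (\<forall>\<tau> \<in> sym_matrices. \<forall>\<rho> \<in> sym_matrices. A \<tau> \<bullet> \<rho> = \<tau> \<bullet> A \<rho>)"

text \<open>On symmetric matrices, the isotropic tensors are those of the form
  \<open>\<tau> \<mapsto> \<lambda> tr(\<tau>) I + 2 \<mu> \<tau>\<close>.\<close>

definition isotropic_tensor :: "(real^'n^'n \<Rightarrow> real^'n^'n) \<Rightarrow> bool" where
  "isotropic_tensor A \<longleftrightarrow>
     (\<forall>R. orthogonal_matrix R \<longrightarrow>
        (\<forall>\<tau> \<in> sym_matrices. A (R ** \<tau> ** transpose R) = R ** A \<tau> ** transpose R))"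

record 'n problem =
  dom :: "(real^'n) set"
  Gamma_D :: "(real^'n) set"
  load :: "real^'n \<Rightarrow> real^'n"
  traction :: "real^'n \<Rightarrow> real^'n"
  elast :: "real^'n^'n \<Rightarrow> real^'n^'n"
  harden :: "real^'n^'n \<Rightarrow> real^'n^'n"
  hmod :: real
  yield :: real

definition Gamma_N :: "'n::finite problem \<Rightarrow> (real^'n) set" where
  "Gamma_N P = frontier (dom P) - Gamma_D P"

definition valid_problem :: "'n::finite problem \<Rightarrow> bool" where
  "valid_problem P \<longleftrightarrow>
     CARD('n) \<in> {2, 3} \<and>
     open (dom P) \<and> connected (dom P) \<and> dom P \<noteq> {} \<and> lipschitz_boundary (dom P) \<and>
     closed (Gamma_D P) \<and> Gamma_D P \<noteq> {} \<and> Gamma_D P \<subseteq> frontier (dom P) \<and>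
     emeasure surface (Gamma_D P) > 0 \<and>
     load P \<in> L2 (lebesgue_on (dom P)) \<and>
     traction P \<in> L2 (surface_on (Gamma_N P)) \<and>
     symmetric_tensor (elast P) \<and> isotropic_tensor (elast P) \<and> coercive_tensor (elast P) \<and>
     symmetric_tensor (harden P) \<and> coercive_tensor (harden P) \<and>
     hmod P > 0 \<and> yield P > 0"

type_synonym 'n state = "(real^'n \<Rightarrow> real^'n) \<times> (real^'n \<Rightarrow> real^'n^'n) \<times> (real^'n \<Rightarrow> real)"

definition state_diff :: "'n::finite state \<Rightarrow> 'n state \<Rightarrow> 'n state" where
  "state_diff z u =
     (case z of (v, q, \<beta>) \<Rightarrow> case u of (w, p, \<alpha>) \<Rightarrow>
        (\<lambda>x. v x - w x, \<lambda>x. q x - p x, \<lambda>x. \<beta> x - \<alpha> x))"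

definition space_V :: "'n::finite problem \<Rightarrow> (real^'n \<Rightarrow> real^'n) set" where
  "space_V P = {v \<in> H1 (dom P). vanishes_on (dom P) (Gamma_D P) v}"

definition space_Q :: "'n::finite problem \<Rightarrow> (real^'n \<Rightarrow> real^'n^'n) set" where
  "space_Q P = {q \<in> L2 (lebesgue_on (dom P)). AE x in lebesgue_on (dom P). q x \<in> dev_matrices}"

definition space_M :: "'n::finite problem \<Rightarrow> (real^'n \<Rightarrow> real) set" where
  "space_M P = L2 (lebesgue_on (dom P))"

definition space_X :: "'n::finite problem \<Rightarrow> 'n state set" where
  "space_X P = space_V P \<times> space_Q P \<times> space_M P"

definition stress ::
  "'n::finite problem \<Rightarrow> (real^'n \<Rightarrow> real^'n) \<Rightarrow> (real^'n \<Rightarrow> real^'n^'n) \<Rightarrow> real^'n \<Rightarrow> real^'n^'n" where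
  "stress P w p x = elast P (strain (dom P) w x - p x)"

definition form_a :: "'n::finite problem \<Rightarrow> 'n state \<Rightarrow> 'n state \<Rightarrow> real" where
  "form_a P u z =
     (case u of (w, p, \<alpha>) \<Rightarrow> case z of (v, q, \<beta>) \<Rightarrow>
        l2_inner (lebesgue_on (dom P)) (stress P w p) (\<lambda>x. strain (dom P) v x - q x)
      + l2_inner (lebesgue_on (dom P)) (\<lambda>x. harden P (p x)) q
      + l2_inner (lebesgue_on (dom P)) (\<lambda>x. hmod P * \<alpha> x) \<beta>)"

definition dissip :: "'n::finite problem \<Rightarrow> real^'n^'n \<Rightarrow> real \<Rightarrow> ennreal" where
  "dissip P q \<beta> = (if norm q \<le> \<beta> then ennreal (yield P * norm q) else \<infinity>)"

definition form_psi :: "'n::finite problem \<Rightarrow> 'n state \<Rightarrow> ereal" where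
  "form_psi P z =
     (case z of (v, q, \<beta>) \<Rightarrow> enn2ereal (\<integral>\<^sup>+ x. dissip P (q x) (\<beta> x) \<partial>lebesgue_on (dom P)))"

definition form_b :: "'n::finite problem \<Rightarrow> 'n state \<Rightarrow> real" where
  "form_b P z =
     (case z of (v, q, \<beta>) \<Rightarrow>
        l2_inner (lebesgue_on (dom P)) (load P) v
      + l2_inner (surface_on (Gamma_N P)) (traction P) (bd_trace (dom P) v))"

text \<open>In \<open>ereal\<close>, \<open>\<infinity> - \<infinity> = \<infinity>\<close>; nevertheless, if \<open>0 \<in> Y\<close>, then every solution \<open>u\<close> satisfies
  \<open>form_psi P u < \<infinity>\<close>, since otherwise the inequality fails for \<open>z = 0\<close>.\<close>

definition solves_vi :: "'n::finite problem \<Rightarrow> 'n state set \<Rightarrow> 'n state \<Rightarrow> bool" where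
  "solves_vi P Y u \<longleftrightarrow>
     u \<in> Y \<and>
     (\<forall>z \<in> Y. ereal (form_b P (state_diff z u))
              \<le> ereal (form_a P u (state_diff z u)) + form_psi P z - form_psi P u)"


section \<open>Meshes and newest vertex bisection\<close>

text \<open>Elements are tagged simplices \<open>(z\<^sub>0, ..., z\<^sub>d)\<^sub>\<gamma>\<close> with \<open>0 \<le> \<gamma> < d\<close> in the sense of
  Maubach and Stevenson. The reference edge joins \<open>z\<^sub>0\<close> and \<open>z\<^sub>d\<close>; for \<open>d = 2\<close> the tag has no
  influence on the refinement.\<close>

datatype 'n element = Element (verts: "(real^'n) list") (tag: nat)

definition body :: "'n::finite element \<Rightarrow> (real^'n) set" where
  "body T = convex hull (set (verts T))"

definition is_element :: "'n::finite element \<Rightarrow> bool" where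
  "is_element T \<longleftrightarrow>
     length (verts T) = CARD('n) + 1 \<and> distinct (verts T) \<and>
     \<not> affine_dependent (set (verts T)) \<and> tag T < CARD('n)"

definition is_mesh :: "(real^'n) set \<Rightarrow> 'n::finite element set \<Rightarrow> bool" where
  "is_mesh \<Omega> \<T> \<longleftrightarrow>
     finite \<T> \<and> (\<forall>T \<in> \<T>. is_element T) \<and> closure \<Omega> = (\<Union>T \<in> \<T>. body T) \<and>
     (\<forall>T \<in> \<T>. \<forall>T' \<in> \<T>. T \<noteq> T' \<longrightarrow>
        set (verts T) \<noteq> set (verts T') \<and>
        body T \<inter> body T' = convex hull (set (verts T) \<inter> set (verts T')))"

text \<open>The bisection rule of Maubach in Stevenson's notation: with \<open>m\<close> the midpoint of the
  reference edge, the children of \<open>(z\<^sub>0, ..., z\<^sub>d)\<^sub>\<gamma>\<close> are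
  \<open>(z\<^sub>0, m, z\<^sub>1, ..., z\<^sub>\<gamma>, z\<^sub>\<gamma>\<^sub>+\<^sub>1, ..., z\<^sub>d\<^sub>-\<^sub>1)\<close> and
  \<open>(z\<^sub>d, m, z\<^sub>1, ..., z\<^sub>\<gamma>, z\<^sub>d\<^sub>-\<^sub>1, ..., z\<^sub>\<gamma>\<^sub>+\<^sub>1)\<close>, both with the tag \<open>\<gamma> + 1\<close> modulo \<open>d\<close>.\<close>

definition children :: "'n::finite element \<Rightarrow> 'n element set" where
  "children T =
     (let z = verts T; m = midpoint (hd z) (last z); inner_verts = butlast (tl z);
          front = take (tag T) inner_verts; rest = drop (tag T) inner_verts;
          \<gamma> = (tag T + 1) mod CARD('n)
      in {Element (hd z # m # front @ rest) \<gamma>, Element (last z # m # front @ rev rest) \<gamma>})"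

definition bisect :: "'n::finite element set \<Rightarrow> 'n element set \<Rightarrow> 'n element set" where
  "bisect \<T> \<M> = (\<T> - \<M>) \<union> (\<Union>T \<in> \<M>. children T)"

definition with_hanging_node :: "'n::finite element set \<Rightarrow> 'n element set" where
  "with_hanging_node \<T> =
     {T \<in> \<T>. \<exists>a \<in> set (verts T). \<exists>b \<in> set (verts T). \<exists>T' \<in> \<T>. \<exists>c \<in> set (verts T').
        c \<in> open_segment a b}"

definition closure_step :: "'n::finite element set \<Rightarrow> 'n element set" where
  "closure_step \<T> = bisect \<T> (with_hanging_node \<T>)"

text \<open>\<open>is_nvb \<Omega> \<T> \<M> \<T>'\<close> means \<open>\<T>' = NVB(\<T>, \<M>)\<close>. This is a relation because the closure need not
  terminate for \<open>d = 3\<close> and an arbitrarily tagged initial mesh; \<open>\<T>'\<close> is unique, since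
  \<open>closure_step\<close> is the identity once there are no hanging nodes. For such initial meshes the
  absence of hanging nodes does not imply conformity either, so the latter is demanded explicitly.\<close>

definition is_nvb ::
  "(real^'n) set \<Rightarrow> 'n::finite element set \<Rightarrow> 'n element set \<Rightarrow> 'n element set \<Rightarrow> bool" where
  "is_nvb \<Omega> \<T> \<M> \<T>' \<longleftrightarrow>
     (\<exists>n. \<T>' = (closure_step ^^ n) (bisect \<T> \<M>)) \<and> with_hanging_node \<T>' = {} \<and> is_mesh \<Omega> \<T>'"

definition refinements :: "(real^'n) set \<Rightarrow> 'n::finite element set \<Rightarrow> 'n element set set" where
  "refinements \<Omega> \<T> = {\<T>'. (\<lambda>\<T>1 \<T>2. \<exists>\<M> \<subseteq> \<T>1. is_nvb \<Omega> \<T>1 \<M> \<T>2)\<^sup>*\<^sup>* \<T> \<T>'}"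

definition inradius :: "(real^'n) set \<Rightarrow> real" where
  "inradius S = Sup {r. \<exists>x. cball x r \<subseteq> S \<and> 0 \<le> r}"

definition uniformly_shape_regular :: "'n::finite element set set \<Rightarrow> bool" where
  "uniformly_shape_regular \<TT> \<longleftrightarrow>
     (\<exists>c>0. \<forall>\<T> \<in> \<TT>. \<forall>T \<in> \<T>. diameter (body T) \<le> c * inradius (body T))"


section \<open>Discrete spaces, error measure and error estimator\<close>

text \<open>Elements are closed and overlap on their boundaries, hence piecewise affine or constant is
  to be read almost everywhere on each element.\<close>

definition discrete_X :: "'n::finite problem \<Rightarrow> 'n element set \<Rightarrow> 'n state set" where
  "discrete_X P \<T> =
     {v \<in> space_V P. \<forall>T \<in> \<T>. \<exists>A c. AE x in lebesgue_on (body T \<inter> dom P). v x = A *v x + c}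
     \<times> {q \<in> space_Q P. \<forall>T \<in> \<T>. \<exists>c. AE x in lebesgue_on (body T \<inter> dom P). q x = c}
     \<times> {\<beta> \<in> space_M P. \<forall>T \<in> \<T>. \<exists>c. AE x in lebesgue_on (body T \<inter> dom P). \<beta> x = c}"

definition err :: "'n::finite problem \<Rightarrow> 'n state \<Rightarrow> 'n state \<Rightarrow> real" where
  "err P z z' =
     (case z of (v, q, \<beta>) \<Rightarrow> case z' of (v', q', \<beta>') \<Rightarrow>
        l2_norm (lebesgue_on (dom P)) (\<lambda>x. stress P v q x - stress P v' q' x))"

definition sides :: "'n::finite element \<Rightarrow> (real^'n) set set" where
  "sides T = (\<lambda>a. convex hull (set (verts T) - {a})) ` set (verts T)"

text \<open>The constant value on \<open>T\<close> of a piecewise constant function, such as the stress of a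
  discrete state.\<close>

definition value_on ::
  "'n::finite problem \<Rightarrow> (real^'n \<Rightarrow> real^'n^'n) \<Rightarrow> 'n element \<Rightarrow> real^'n^'n" where
  "value_on P s T = (THE c. AE x in lebesgue_on (body T \<inter> dom P). s x = c)"

definition outer_normal :: "'n::finite element \<Rightarrow> (real^'n) set \<Rightarrow> real^'n" where
  "outer_normal T E =
     (THE \<nu>. norm \<nu> = 1 \<and> (\<forall>x \<in> E. \<forall>y \<in> E. \<nu> \<bullet> (y - x) = 0) \<and>
             (\<forall>x \<in> E. \<forall>y \<in> body T. \<nu> \<bullet> (y - x) \<le> 0))"

text \<open>The choices below fix the sign of the normal and of the jump for an interior side, which has
  no influence on \<open>residual\<close>. For a side on the boundary there is only one element, and the normal
  points out of the domain.\<close>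

definition element_at :: "'n::finite element set \<Rightarrow> (real^'n) set \<Rightarrow> 'n element" where
  "element_at \<T> E = (SOME T. T \<in> \<T> \<and> E \<in> sides T)"

definition other_element_at :: "'n::finite element set \<Rightarrow> (real^'n) set \<Rightarrow> 'n element" where
  "other_element_at \<T> E = (SOME T. T \<in> \<T> \<and> E \<in> sides T \<and> T \<noteq> element_at \<T> E)"

definition normal :: "'n::finite element set \<Rightarrow> (real^'n) set \<Rightarrow> real^'n" where
  "normal \<T> E = outer_normal (element_at \<T> E) E"

definition jump ::
  "'n::finite problem \<Rightarrow> 'n element set \<Rightarrow> (real^'n \<Rightarrow> real^'n^'n) \<Rightarrow> (real^'n) set \<Rightarrow> real^'n^'n" where
  "jump P \<T> s E = value_on P s (element_at \<T> E) - value_on P s (other_element_at \<T> E)"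

text \<open>A side on \<open>Gamma_N\<close> may have boundary points in the closed set \<open>Gamma_D\<close>, where the traction
  is not given; they are removed by the intersection with \<open>Gamma_N\<close>, which makes no difference for
  the integral.\<close>

definition residual ::
  "'n::finite problem \<Rightarrow> 'n element set \<Rightarrow> 'n state \<Rightarrow> (real^'n) set \<Rightarrow> real" where
  "residual P \<T> z E =
     (case z of (v, q, \<beta>) \<Rightarrow>
        if E \<subseteq> Gamma_D P then 0
        else if E \<subseteq> frontier (dom P) then
          l2_norm (surface_on (E \<inter> Gamma_N P))
            (\<lambda>x. traction P x - value_on P (stress P v q) (element_at \<T> E) *v normal \<T> E)
        else
          l2_norm (surface_on E) (\<lambda>x. jump P \<T> (stress P v q) E *v normal \<T> E))"

text \<open>The square of the local contribution of \<open>T\<close> to the estimator.\<close>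

definition eta_sq :: "'n::finite problem \<Rightarrow> 'n element set \<Rightarrow> 'n state \<Rightarrow> 'n element \<Rightarrow> real" where
  "eta_sq P \<T> z T =
     measure lebesgue (body T) * (l2_norm (lebesgue_on (body T \<inter> dom P)) (load P))\<^sup>2
     + sqrt (measure lebesgue (body T)) * (\<Sum>E \<in> sides T. (residual P \<T> z E)\<^sup>2)"

definition eta :: "'n::finite problem \<Rightarrow> 'n element set \<Rightarrow> 'n state \<Rightarrow> real" where
  "eta P \<T> z = sqrt (\<Sum>T \<in> \<T>. eta_sq P \<T> z T)"


section \<open>Adaptive algorithm\<close>

definition bulk ::
  "'n::finite problem \<Rightarrow> real \<Rightarrow> 'n element set \<Rightarrow> 'n state \<Rightarrow> 'n element set \<Rightarrow> bool" where
  "bulk P \<theta> \<T> z \<M> \<longleftrightarrow> \<M> \<subseteq> \<T> \<and> \<theta> * (eta P \<T> z)\<^sup>2 \<le> (\<Sum>T \<in> \<M>. eta_sq P \<T> z T)"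

definition minimal_bulk ::
  "'n::finite problem \<Rightarrow> real \<Rightarrow> 'n element set \<Rightarrow> 'n state \<Rightarrow> 'n element set \<Rightarrow> bool" where
  "minimal_bulk P \<theta> \<T> z \<M> \<longleftrightarrow>
     bulk P \<theta> \<T> z \<M> \<and> (\<forall>\<M>'. bulk P \<theta> \<T> z \<M>' \<longrightarrow> card \<M> \<le> card \<M>')"

definition adaptive_meshes ::
  "'n::finite problem \<Rightarrow> real \<Rightarrow> ('n element set \<Rightarrow> 'n state) \<Rightarrow> 'n element set \<Rightarrow>
   (nat \<Rightarrow> 'n element set) \<Rightarrow> bool" where
  "adaptive_meshes P \<theta> U \<T>0 \<T> \<longleftrightarrow>
     \<T> 0 = \<T>0 \<and>
     (\<forall>l. \<exists>\<M>. minimal_bulk P \<theta> (\<T> l) (U (\<T> l)) \<M> \<and> is_nvb (dom P) (\<T> l) \<M> (\<T> (Suc l)))"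

definition eps3_star :: "real \<Rightarrow> real \<Rightarrow> real \<Rightarrow> real \<Rightarrow> real \<Rightarrow> real" where
  "eps3_star C1 \<rho>2 C2 Crel \<theta> =
     (SUP \<delta> \<in> {0<..}. (1 - (1 + \<delta>) * (1 - (1 - \<rho>2) * \<theta>))
                      / (Crel\<^sup>2 * (C2 + (1 + inverse \<delta>) * C1\<^sup>2)))"

end

theory Submission
  imports Defs
begin

text \<open>
  The estimate holds with \<open>\<epsilon>3 = 0\<close>. This value is admissible because the quotient in
  \<open>eps3_star\<close> is positive for small \<open>\<delta>\<close>: its numerator tends to \<open>(1 - \<rho>2) \<theta>\<close>.

  Let \<open>E(z) = a(z,z)/2 + \<psi>(z) - b(z)\<close>. A solution \<open>y\<close> of the variational inequality on \<open>Y\<close>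
  minimises \<open>E\<close> on \<open>Y\<close>, and it does so with a quadratic margin,
  \<open>E(z) - E(y) \<ge> a(z-y,z-y)/2 \<ge> c d[z,y]\<^sup>2\<close> (lemmas \<open>energy_gap\<close> and \<open>err_le_energy_gap\<close>).
  Since bisection yields nested discrete spaces, \<open>c d[U(k+1),U(k)]\<^sup>2 \<le> E(U(k)) - E(U(k+1))\<close>;
  the sum over \<open>k\<close> telescopes and is at most \<open>E(U(l)) - E(u)\<close>.

  What is left is the converse bound \<open>E(U) - E(u) \<le> K d[u,U]\<^sup>2\<close> (lemma \<open>energy_gap_le_err\<close>), to
  which reliability is then applied. As \<open>\<psi>\<close> is not differentiable, the energy difference could a
  priori be of first order in the error. The first order terms disappear for two reasons.
  The energy is smooth in the displacement, and \<open>V\<close> is a vector space, so that the inequality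
  for \<open>u\<close> may be tested with a displacement that is reflected at that of \<open>u\<close> (lemma \<open>equilibrium\<close>).
  For the plastic strain and the hardening variable, the inequality for \<open>U\<close> is tested with the cell
  averages of those of \<open>u\<close>: the stress and the plastic variables of \<open>U\<close> are constant on every element, so in the
  linear terms the averages may be replaced by the functions themselves, and by Jensen's inequality averaging does
  not increase \<open>\<psi>\<close> (lemma \<open>discrete_flow_rule\<close>). The remaining quadratic expression is
  controlled by the stress error alone because the hardening tensor is coercive
  (lemma \<open>energy_integrand_bound\<close>).

  The analytic prerequisites are the linearity of the strain and of the boundary term in \<open>b\<close>, which
  amount to the uniqueness of weak gradients and of traces, and the fact that the strain of a
  piecewise affine function is piecewise constant.
\<close>

section \<open>Square integrable functions\<close>

lemma L2_measurable: "w \<in> L2 M \<Longrightarrow> w \<in> borel_measurable M"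
  by (simp add: L2_def)

lemma L2_square_integrable: "w \<in> L2 M \<Longrightarrow> integrable M (\<lambda>x. (norm (w x))\<^sup>2)"
  by (simp add: L2_def)

lemma L2_zero: "(\<lambda>x. 0) \<in> L2 M"
  by (simp add: L2_def)

lemma L2_bounded_linear_image:
  assumes "bounded_linear A" "w \<in> L2 M"
  shows "(\<lambda>x. A (w x)) \<in> L2 M"
proof -
  obtain K where K: "\<And>x. norm (A x) \<le> norm x * K"
    using bounded_linear.bounded[OF assms(1)] by blast
  have m: "(\<lambda>x. A (w x)) \<in> borel_measurable M"
    using measurable_compose[OF L2_measurable[OF assms(2)]
        borel_measurable_continuous_onI[OF linear_continuous_on[OF assms(1)]]] .
  have "integrable M (\<lambda>x. (norm (A (w x)))\<^sup>2)"
  proof (rule Bochner_Integration.integrable_bound)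
    show "integrable M (\<lambda>x. K\<^sup>2 * (norm (w x))\<^sup>2)"
      using L2_square_integrable[OF assms(2)] by simp
    show "(\<lambda>x. (norm (A (w x)))\<^sup>2) \<in> borel_measurable M" using m by measurable
    show "AE x in M. norm ((norm (A (w x)))\<^sup>2) \<le> norm (K\<^sup>2 * (norm (w x))\<^sup>2)"
      using power_mono[OF K norm_ge_zero, of _ 2] by (auto simp: power_mult_distrib mult.commute)
  qed
  with m show ?thesis by (simp add: L2_def)
qed

lemma L2_inner_integrable:
  assumes "u \<in> L2 M" "w \<in> L2 M"
  shows "integrable M (\<lambda>x. u x \<bullet> w x)"
proof (rule Bochner_Integration.integrable_bound)
  show "integrable M (\<lambda>x. (norm (u x))\<^sup>2 + (norm (w x))\<^sup>2)"
    using assms by (simp add: L2_square_integrable)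
  show "(\<lambda>x. u x \<bullet> w x) \<in> borel_measurable M"
    using L2_measurable[OF assms(1)] L2_measurable[OF assms(2)] by measurable
  have "\<bar>u x \<bullet> w x\<bar> \<le> (norm (u x))\<^sup>2 + (norm (w x))\<^sup>2" for x
  proof -
    have "\<bar>u x \<bullet> w x\<bar> \<le> norm (u x) * norm (w x)" by (rule Cauchy_Schwarz_ineq2)
    also have "\<dots> \<le> (norm (u x))\<^sup>2 + (norm (w x))\<^sup>2"
      using sum_squares_bound[of "norm (u x)" "norm (w x)"]
        mult_nonneg_nonneg[OF norm_ge_zero[of "u x"] norm_ge_zero[of "w x"]] by linarith
    finally show ?thesis .
  qed
  then show "AE x in M. norm (u x \<bullet> w x) \<le> norm ((norm (u x))\<^sup>2 + (norm (w x))\<^sup>2)"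
    by (auto intro: order_trans)
qed

lemma L2_add:
  assumes "u \<in> L2 M" "w \<in> L2 M"
  shows "(\<lambda>x. u x + w x) \<in> L2 M"
proof -
  have m: "(\<lambda>x. u x + w x) \<in> borel_measurable M"
    using L2_measurable[OF assms(1)] L2_measurable[OF assms(2)] by measurable
  have "integrable M (\<lambda>x. u x \<bullet> u x + 2 * (u x \<bullet> w x) + w x \<bullet> w x)"
    using L2_inner_integrable[OF assms(1,1)] L2_inner_integrable[OF assms(1,2)]
      L2_inner_integrable[OF assms(2,2)] by simp
  then have "integrable M (\<lambda>x. (norm (u x + w x))\<^sup>2)"
    by (simp add: power2_norm_eq_inner inner_add_left inner_add_right inner_commute algebra_simps)
  with m show ?thesis by (simp add: L2_def)
qed

lemma L2_diff:
  assumes "u \<in> L2 M" "w \<in> L2 M"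
  shows "(\<lambda>x. u x - w x) \<in> L2 M"
  using L2_add[OF assms(1) L2_bounded_linear_image[OF bounded_linear_minus[OF bounded_linear_ident] assms(2)]]
  by simp

lemma L2_const: "finite_measure M \<Longrightarrow> (\<lambda>x. c) \<in> L2 M"
  by (simp add: L2_def finite_measure.integrable_const)

lemma L2_integrable:
  fixes w :: "'a \<Rightarrow> 'b::euclidean_space"
  assumes "finite_measure M" "w \<in> L2 M"
  shows "integrable M w"
proof (rule Bochner_Integration.integrable_bound)
  show "integrable M (\<lambda>x. 1 + (norm (w x))\<^sup>2)"
    using assms by (simp add: L2_square_integrable finite_measure.integrable_const)
  show "w \<in> borel_measurable M" by (rule L2_measurable[OF assms(2)])
  have "norm (w x) \<le> 1 + (norm (w x))\<^sup>2" for x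
    using sum_squares_bound[of 1 "norm (w x)"] norm_ge_zero[of "w x"] unfolding power_one mult_1_right by linarith
  then show "AE x in M. norm (w x) \<le> norm (1 + (norm (w x))\<^sup>2)" by simp
qed

lemma L2_restrict_space:
  assumes "w \<in> L2 (restrict_space M A)" "B \<subseteq> A" "A \<in> sets M" "B \<in> sets M"
  shows "w \<in> L2 (restrict_space M B)"
proof -
  have B: "restrict_space M B = restrict_space (restrict_space M A) B"
    using assms(2) by (simp add: restrict_restrict_space assms(3) assms(4) Int_absorb1 Int_absorb2 inf.absorb2 sets.Int)
  have "B \<inter> space (restrict_space M A) \<in> sets (restrict_space M A)"
    using assms by (auto simp: sets_restrict_space_iff space_restrict_space sets.sets_into_space)
  moreover have "integrable (restrict_space M A) (\<lambda>x. indicat_real B x * (norm (w x))\<^sup>2)"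
  proof (rule Bochner_Integration.integrable_bound[OF L2_square_integrable[OF assms(1)]])
    have "B \<in> sets (restrict_space M A)" using assms by (auto simp: sets_restrict_space_iff sets.sets_into_space)
    then show "(\<lambda>x. indicat_real B x * (norm (w x))\<^sup>2) \<in> borel_measurable (restrict_space M A)"
      using L2_measurable[OF assms(1)] by measurable
  qed (auto simp: indicator_def)
  moreover have "w \<in> borel_measurable (restrict_space (restrict_space M A) B)"
    using L2_measurable[OF assms(1)] by (rule measurable_restrict_space1)
  ultimately show ?thesis
    unfolding B L2_def by (simp add: integrable_restrict_space)
qed

lemma L2_scale_bounded:
  fixes w :: "'a \<Rightarrow> 'b::euclidean_space"
  assumes "w \<in> L2 M" "\<phi> \<in> borel_measurable M" "\<And>x. x \<in> space M \<Longrightarrow> \<bar>\<phi> x\<bar> \<le> K"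
  shows "(\<lambda>x. \<phi> x *\<^sub>R w x) \<in> L2 M"
proof -
  have m: "(\<lambda>x. \<phi> x *\<^sub>R w x) \<in> borel_measurable M"
    using assms(2) L2_measurable[OF assms(1)] by measurable
  have "integrable M (\<lambda>x. (norm (\<phi> x *\<^sub>R w x))\<^sup>2)"
  proof (rule Bochner_Integration.integrable_bound)
    show "integrable M (\<lambda>x. K\<^sup>2 * (norm (w x))\<^sup>2)" using L2_square_integrable[OF assms(1)] by simp
    show "(\<lambda>x. (norm (\<phi> x *\<^sub>R w x))\<^sup>2) \<in> borel_measurable M" using m by measurable
    have "(norm (\<phi> x *\<^sub>R w x))\<^sup>2 \<le> K\<^sup>2 * (norm (w x))\<^sup>2" if "x \<in> space M" for x
      using power_mono[OF assms(3)[OF that] abs_ge_zero, of 2]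
      by (simp add: power_mult_distrib mult_right_mono)
    then show "AE x in M. norm ((norm (\<phi> x *\<^sub>R w x))\<^sup>2) \<le> norm (K\<^sup>2 * (norm (w x))\<^sup>2)" by simp
  qed
  with m show ?thesis by (simp add: L2_def)
qed

section \<open>Test functions and weak gradients\<close>

lemma test_function_gderiv: "test_function \<Omega> \<phi> g \<Longrightarrow> GDERIV \<phi> x :> g x"
  by (simp add: test_function_def)

lemma gderiv_continuous_on:
  assumes "\<And>x. GDERIV \<phi> x :> g x"
  shows "continuous_on S \<phi>"
proof (rule continuous_at_imp_continuous_on, rule ballI)
  show "isCont \<phi> x" for x
    using assms[of x] unfolding gderiv_def by (rule has_derivative_continuous)
qed

lemma test_function_continuous:
  assumes "test_function \<Omega> \<phi> g"
  shows "continuous_on UNIV \<phi>" "continuous_on UNIV g"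
  using assms gderiv_continuous_on[of \<phi> g UNIV] by (simp_all add: test_function_def)

lemma test_function_support:
  assumes "test_function \<Omega> \<phi> g" "x \<notin> closure {x. \<phi> x \<noteq> 0}"
  shows "\<phi> x = 0" "g x = 0"
proof -
  define K where "K = closure {x. \<phi> x \<noteq> 0}"
  have K: "open (- K)" "x \<in> - K" using assms(2) by (simp_all add: K_def open_Compl)
  have 0: "\<phi> y = 0" if "y \<in> - K" for y
    using that subsetD[OF closure_subset, of y "{x. \<phi> x \<noteq> 0}"] unfolding K_def by blast
  then show "\<phi> x = 0" using K(2) by blast
  have "(\<phi> has_derivative (\<lambda>h. h \<bullet> g x)) (at x)"
    using test_function_gderiv[OF assms(1)] by (simp add: gderiv_def)
  moreover have "(\<phi> has_derivative (\<lambda>h. 0)) (at x)"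
    by (rule has_derivative_transform_within_open[of "\<lambda>_. 0" _ _ _ "- K"]) (use K 0 in simp_all)
  ultimately have "(\<lambda>h. h \<bullet> g x) = (\<lambda>h. 0)" by (rule has_derivative_unique)
  then show "g x = 0" by (metis inner_eq_zero_iff)
qed

lemma test_function_zero_outside:
  assumes "test_function \<Omega> \<phi> g" "x \<notin> \<Omega>"
  shows "\<phi> x = 0" "g x = 0"
proof -
  have "x \<notin> closure {x. \<phi> x \<noteq> 0}" using assms unfolding test_function_def by blast
  then show "\<phi> x = 0" "g x = 0" by (rule test_function_support[OF assms(1)])+
qed

lemma test_function_bounded:
  assumes "test_function \<Omega> \<phi> g"
  obtains B where "0 < B" "\<And>x. \<bar>\<phi> x\<bar> \<le> B" "\<And>x. norm (g x) \<le> B"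
proof -
  define K where "K = closure {x. \<phi> x \<noteq> 0}"
  have K: "compact K" using assms by (simp add: test_function_def K_def)
  note supp = test_function_support[OF assms, folded K_def]
  have "bounded (\<phi> ` K)" "bounded (g ` K)"
    using compact_continuous_image[OF continuous_on_subset[OF test_function_continuous(1)[OF assms] subset_UNIV] K]
      compact_continuous_image[OF continuous_on_subset[OF test_function_continuous(2)[OF assms] subset_UNIV] K]
    by (simp_all add: compact_imp_bounded)
  then obtain B1 B2 where B: "B1 > 0" "B2 > 0" "\<And>x. x \<in> K \<Longrightarrow> norm (\<phi> x) \<le> B1" "\<And>x. x \<in> K \<Longrightarrow> norm (g x) \<le> B2"
    unfolding bounded_pos by auto
  show ?thesis
  proof (rule that[of "B1 + B2"])
    show "0 < B1 + B2" using B by simp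
    fix x
    show "\<bar>\<phi> x\<bar> \<le> B1 + B2"
      using B(1,2) B(3)[of x] supp(1)[of x] by (cases "x \<in> K") simp_all
    show "norm (g x) \<le> B1 + B2"
      using B(1,2) B(4)[of x] supp(2)[of x] by (cases "x \<in> K") simp_all
  qed
qed

lemma test_function_mono: "test_function W \<phi> g \<Longrightarrow> W \<subseteq> \<Omega> \<Longrightarrow> test_function \<Omega> \<phi> g"
  by (auto simp: test_function_def)

lemma continuous_on_measurable_lebesgue_on:
  fixes f :: "'a::euclidean_space \<Rightarrow> 'b::euclidean_space"
  assumes "continuous_on UNIV f"
  shows "f \<in> borel_measurable (lebesgue_on S)"
proof -
  have "f \<in> borel_measurable borel" using assms by (rule borel_measurable_continuous_onI)
  then have "f \<in> borel_measurable lebesgue" by (simp add: measurable_completion)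
  then show ?thesis by (rule measurable_restrict_space1)
qed

text \<open>The function \<open>t \<mapsto> (max 0 t)\<^sup>2\<close> deviates from its tangent at \<open>t\<close> by at most \<open>(y - t)\<^sup>2\<close>, also
  across the kink of \<open>max\<close>. It is the building block of continuously differentiable bumps.\<close>

lemma positive_part_square_deriv: "((\<lambda>t::real. (max 0 t)\<^sup>2) has_real_derivative 2 * max 0 t) (at t)"
proof -
  have bound: "\<bar>(max 0 y)\<^sup>2 - (max 0 t)\<^sup>2 - 2 * max 0 t * (y - t)\<bar> \<le> (y - t)\<^sup>2" for y
  proof (cases "0 \<le> t"; cases "0 \<le> y")
    assume "\<not> 0 \<le> t" "0 \<le> y"
    then have "y\<^sup>2 \<le> (y - t)\<^sup>2" by (intro power_mono) auto
    then show ?thesis using \<open>\<not> 0 \<le> t\<close> \<open>0 \<le> y\<close> by (simp add: max_def)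
  next
    assume a: "0 \<le> t" "\<not> 0 \<le> y"
    have e: "(max 0 y)\<^sup>2 - (max 0 t)\<^sup>2 - 2 * max 0 t * (y - t) = t\<^sup>2 - 2 * (t * y)"
      using a by (simp add: max_def power2_eq_square algebra_simps)
    have "t * y \<le> 0" using a by (simp add: mult_nonneg_nonpos)
    then have "0 \<le> t\<^sup>2 - 2 * (t * y)" using zero_le_power2[of t] by linarith
    moreover have "t\<^sup>2 - 2 * (t * y) \<le> (y - t)\<^sup>2" by (simp add: power2_diff mult.commute)
    ultimately show ?thesis using e by simp
  next
    assume "0 \<le> t" "0 \<le> y"
    then have "(max 0 y)\<^sup>2 - (max 0 t)\<^sup>2 - 2 * max 0 t * (y - t) = (y - t)\<^sup>2"
      by (simp add: max_def power2_eq_square algebra_simps)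
    then show ?thesis by simp
  qed (simp add: max_def)
  have "((\<lambda>h. ((max 0 (t + h))\<^sup>2 - (max 0 t)\<^sup>2) / h - 2 * max 0 t) \<longlongrightarrow> 0) (at 0)"
  proof (rule Lim_null_comparison[of _ "\<lambda>h. \<bar>h\<bar>"])
    show "\<forall>\<^sub>F h in at 0. norm (((max 0 (t + h))\<^sup>2 - (max 0 t)\<^sup>2) / h - 2 * max 0 t) \<le> \<bar>h\<bar>"
    proof (rule eventually_mono[OF eventually_neq_at_within[of 0]])
      fix h :: real assume "h \<noteq> 0"
      then have "((max 0 (t + h))\<^sup>2 - (max 0 t)\<^sup>2) / h - 2 * max 0 t
          = ((max 0 (t + h))\<^sup>2 - (max 0 t)\<^sup>2 - 2 * max 0 t * (t + h - t)) / h"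
        by (simp add: field_simps)
      then show "norm (((max 0 (t + h))\<^sup>2 - (max 0 t)\<^sup>2) / h - 2 * max 0 t) \<le> \<bar>h\<bar>"
        using bound[of "t + h"] \<open>h \<noteq> 0\<close>
        by (simp add: abs_divide divide_le_eq power2_eq_square abs_mult[symmetric])
    qed
    show "((\<lambda>h. \<bar>h\<bar>) \<longlongrightarrow> 0) (at (0::real))" using tendsto_rabs[OF tendsto_ident_at, of 0 UNIV] by simp
  qed
  then show ?thesis unfolding DERIV_def by (rule LIM_zero_cancel)
qed

text \<open>If \<open>a\<close> is below \<open>b\<close> in every component, this is a continuously differentiable function that
  is positive on \<open>box a b\<close> and zero elsewhere.\<close>

definition box_bump :: "real^'n \<Rightarrow> real^'n \<Rightarrow> real^'n \<Rightarrow> real" where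
  "box_bump a b x = (\<Prod>i\<in>UNIV. (max 0 ((x $ i - a $ i) * (b $ i - x $ i)))\<^sup>2)"

definition box_bump_grad :: "real^'n \<Rightarrow> real^'n \<Rightarrow> real^'n \<Rightarrow> real^'n" where
  "box_bump_grad a b x = (\<chi> i. 2 * max 0 ((x $ i - a $ i) * (b $ i - x $ i)) * (a $ i + b $ i - 2 * x $ i)
     * (\<Prod>j\<in>UNIV - {i}. (max 0 ((x $ j - a $ j) * (b $ j - x $ j)))\<^sup>2))"

lemma box_bump_gderiv: "GDERIV (box_bump a b) x :> box_bump_grad a b x"
proof -
  have 1: "((\<lambda>x. (max 0 ((x $ i - a $ i) * (b $ i - x $ i)))\<^sup>2) has_derivative
     (\<lambda>h. 2 * max 0 ((x $ i - a $ i) * (b $ i - x $ i)) * (a $ i + b $ i - 2 * x $ i) * h $ i)) (at x)" for i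
  proof -
    have "((\<lambda>x. (x $ i - a $ i) * (b $ i - x $ i)) has_derivative (\<lambda>h. (a $ i + b $ i - 2 * x $ i) * h $ i)) (at x)"
      by (auto intro!: derivative_eq_intros bounded_linear_imp_has_derivative simp: bounded_linear_vec_nth algebra_simps)
    from has_derivative_compose[OF this positive_part_square_deriv[unfolded has_field_derivative_def]]
    show ?thesis by (simp add: mult.assoc)
  qed
  show ?thesis
    unfolding gderiv_def box_bump_def[abs_def]
    by (rule has_derivative_eq_rhs[OF has_derivative_prod[OF 1]])
      (simp add: fun_eq_iff inner_vec_def box_bump_grad_def ac_simps)
qed

lemma continuous_box_bump_grad: "continuous_on UNIV (box_bump_grad a b)"
  unfolding box_bump_grad_def[abs_def] by (intro continuous_intros)

lemma box_bump_nonneg: "0 \<le> box_bump a b x"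
  by (simp add: box_bump_def prod_nonneg)

lemma box_bump_eq_0_iff:
  assumes "\<And>i. a $ i < b $ i"
  shows "box_bump a b x = 0 \<longleftrightarrow> x \<notin> box a b"
proof -
  have "(max 0 ((x $ i - a $ i) * (b $ i - x $ i)))\<^sup>2 = 0 \<longleftrightarrow> \<not> (a $ i < x $ i \<and> x $ i < b $ i)" for i
  proof -
    have "0 < (x $ i - a $ i) * (b $ i - x $ i) \<longleftrightarrow> a $ i < x $ i \<and> x $ i < b $ i"
      using assms[of i] by (auto simp: zero_less_mult_iff)
    moreover have "(max 0 t)\<^sup>2 = 0 \<longleftrightarrow> \<not> 0 < t" for t :: real by auto
    ultimately show ?thesis by simp
  qed
  then show ?thesis by (auto simp: box_bump_def mem_box_cart)
qed

text \<open>Composing the bump with \<open>y \<mapsto> n y / (1 + n y)\<close> yields test functions with values in \<open>[0,1)\<close>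
  that increase to the indicator function of the box.\<close>

lemma box_bump_test_function:
  fixes a b :: "real^'n::finite"
  assumes ab: "\<And>i. a $ i < b $ i" and "cbox a b \<subseteq> W"
  shows "\<exists>g. test_function W (\<lambda>x. real n * box_bump a b x / (1 + real n * box_bump a b x)) g"
proof -
  let ?m = "box_bump a b"
  let ?g = "\<lambda>x. (real n / (1 + real n * ?m x)\<^sup>2) *\<^sub>R box_bump_grad a b x"
  have pos: "0 < 1 + real n * ?m x" for x
    by (intro add_pos_nonneg) (auto simp: box_bump_nonneg)
  have d: "((\<lambda>y. real n * y / (1 + real n * y)) has_real_derivative real n / (1 + real n * ?m x)\<^sup>2) (at (?m x))" for x
    using pos[of x] by (auto intro!: derivative_eq_intros simp: field_simps power2_eq_square)
  have g: "GDERIV (\<lambda>x. real n * ?m x / (1 + real n * ?m x)) x :> ?g x" for x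
    using GDERIV_DERIV_compose[OF box_bump_gderiv d] by simp
  have cm: "continuous_on UNIV ?m"
    using box_bump_gderiv by (rule gderiv_continuous_on)
  have cg: "continuous_on UNIV ?g"
    using pos by (intro continuous_intros cm continuous_box_bump_grad) (metis power_eq_0_iff less_irrefl)
  have "{x. real n * ?m x / (1 + real n * ?m x) \<noteq> 0} \<subseteq> cbox a b"
  proof
    fix x assume "x \<in> {x. real n * ?m x / (1 + real n * ?m x) \<noteq> 0}"
    then have "?m x \<noteq> 0" by auto
    then show "x \<in> cbox a b"
      using box_subset_cbox[of a b] box_bump_eq_0_iff[of a b x] ab by blast
  qed
  then have K: "closure {x. real n * ?m x / (1 + real n * ?m x) \<noteq> 0} \<subseteq> cbox a b"
    by (rule closure_minimal) (rule closed_cbox)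
  moreover have "compact (closure {x. real n * ?m x / (1 + real n * ?m x) \<noteq> 0})"
    using bounded_subset[OF bounded_cbox K] by (simp only: compact_eq_bounded_closed closed_closure)
  ultimately have "test_function W (\<lambda>x. real n * ?m x / (1 + real n * ?m x)) ?g"
    unfolding test_function_def using g cg assms(2) by blast
  then show ?thesis by blast
qed

lemma box_bump_limit:
  assumes "\<And>i. a $ i < b $ i"
  shows "(\<lambda>n. real n * box_bump a b x / (1 + real n * box_bump a b x)) \<longlonglongrightarrow> indicator (box a b) x"
proof (cases "x \<in> box a b")
  case False
  then have "box_bump a b x = 0" using box_bump_eq_0_iff[OF assms] by blast
  then show ?thesis using False by simp
next
  case True
  then have m: "0 < box_bump a b x"
    using box_bump_eq_0_iff[OF assms] box_bump_nonneg[of a b x] by (metis order_less_le)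
  have "(\<lambda>n. 1 - 1 / (1 + real n * box_bump a b x)) \<longlonglongrightarrow> 1 - 0"
  proof (rule tendsto_diff[OF tendsto_const], rule tendsto_divide_0[OF tendsto_const])
    show "filterlim (\<lambda>n. 1 + real n * box_bump a b x) at_infinity sequentially"
      by (rule filterlim_at_top_imp_at_infinity, rule filterlim_tendsto_add_at_top[OF tendsto_const],
          rule filterlim_at_top_mult_tendsto_pos[OF tendsto_const m filterlim_real_sequentially])
  qed
  moreover have "1 - 1 / (1 + real n * box_bump a b x) = real n * box_bump a b x / (1 + real n * box_bump a b x)" for n
    using m by (simp add: field_simps add_pos_nonneg[THEN less_imp_neq, symmetric] add_nonneg_eq_0_iff)
  ultimately show ?thesis using True by simp
qed

lemma integral_zero_outside:
  fixes F :: "'a::euclidean_space \<Rightarrow> 'b::euclidean_space"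
  assumes "\<Omega> \<in> sets lebesgue" "\<And>x. x \<notin> \<Omega> \<Longrightarrow> F x = 0"
  shows "(LINT x|lebesgue_on \<Omega>. F x) = (LINT x|lebesgue. F x)"
proof -
  have "(LINT x|lebesgue_on \<Omega>. F x) = (LINT x|lebesgue. indicator \<Omega> x *\<^sub>R F x)"
    using assms(1) by (simp add: integral_restrict_space)
  also have "\<dots> = (LINT x|lebesgue. F x)"
    by (rule Bochner_Integration.integral_cong) (auto simp: indicator_def assms(2))
  finally show ?thesis .
qed

lemma test_function_integrable:
  assumes "test_function W \<phi> g" "integrable (lebesgue_on \<Omega>) h"
  shows "integrable (lebesgue_on \<Omega>) (\<lambda>x. h x * \<phi> x)" "integrable (lebesgue_on \<Omega>) (\<lambda>x. h x * g x $ j)"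
proof -
  obtain B where B: "\<And>x. \<bar>\<phi> x\<bar> \<le> B" "\<And>x. norm (g x) \<le> B" "0 < B"
    using test_function_bounded[OF assms(1)] by metis
  note c = test_function_continuous[OF assms(1)]
  have m: "\<phi> \<in> borel_measurable (lebesgue_on \<Omega>)" "(\<lambda>x. g x $ j) \<in> borel_measurable (lebesgue_on \<Omega>)"
    using c by (auto intro!: continuous_on_measurable_lebesgue_on continuous_intros)
  have i: "integrable (lebesgue_on \<Omega>) (\<lambda>x. B * h x)" using assms(2) by simp
  have h: "h \<in> borel_measurable (lebesgue_on \<Omega>)" using assms(2) by (rule borel_measurable_integrable)
  have "norm (h x * \<phi> x) \<le> norm (B * h x)" for x
    using mult_right_mono[OF B(1)[of x] abs_ge_zero[of "h x"]] B(3) by (simp add: abs_mult mult.commute)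
  then show "integrable (lebesgue_on \<Omega>) (\<lambda>x. h x * \<phi> x)"
    using h m(1) by (intro Bochner_Integration.integrable_bound[OF i]) simp_all
  have "norm (h x * g x $ j) \<le> norm (B * h x)" for x
    using mult_right_mono[OF order_trans[OF component_le_norm_cart B(2)[of x]] abs_ge_zero[of "h x"]] B(3)
    by (simp add: abs_mult mult.commute)
  then show "integrable (lebesgue_on \<Omega>) (\<lambda>x. h x * g x $ j)"
    using h m(2) by (intro Bochner_Integration.integrable_bound[OF i]) simp_all
qed

text \<open>Dominated convergence along the bumps replaces test functions by indicator functions of
  boxes.\<close>

lemma integral_box_eq_0_of_test_functions:
  fixes h :: "real^'n::finite \<Rightarrow> real"
  assumes h: "integrable (lebesgue_on \<Omega>) h"
    and zero: "\<And>\<phi> g. test_function W \<phi> g \<Longrightarrow> (LINT x|lebesgue_on \<Omega>. h x * \<phi> x) = 0"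
    and ab: "\<And>i. a $ i < b $ i" and "cbox a b \<subseteq> W"
  shows "(LINT x|lebesgue_on \<Omega>. h x * indicator (box a b) x) = 0"
proof -
  let ?\<phi> = "\<lambda>n x. real n * box_bump a b x / (1 + real n * box_bump a b x)"
  have t: "\<exists>g. test_function W (?\<phi> n) g" for n
    by (rule box_bump_test_function[OF ab assms(4)])
  have le: "\<bar>?\<phi> n x\<bar> \<le> 1" for n x
  proof -
    have "0 \<le> real n * box_bump a b x" using box_bump_nonneg[of a b x] by simp
    then show ?thesis by (simp add: abs_divide divide_le_eq_1)
  qed
  have hm: "h \<in> borel_measurable (lebesgue_on \<Omega>)" using h by (rule borel_measurable_integrable)
  have "(\<lambda>n. LINT x|lebesgue_on \<Omega>. h x * ?\<phi> n x) \<longlonglongrightarrow> (LINT x|lebesgue_on \<Omega>. h x * indicator (box a b) x)"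
  proof (rule integral_dominated_convergence[where w = "\<lambda>x. norm (h x)"])
    show "(\<lambda>x. h x * ?\<phi> n x) \<in> borel_measurable (lebesgue_on \<Omega>)" for n
    proof -
      obtain g where "test_function W (?\<phi> n) g" using t[of n] by blast
      from borel_measurable_integrable[OF test_function_integrable(1)[OF this h]] show ?thesis .
    qed
    have "box a b \<in> sets lebesgue" by simp
    then have "indicat_real (box a b) \<in> borel_measurable lebesgue" by (rule borel_measurable_indicator)
    then have "indicat_real (box a b) \<in> borel_measurable (lebesgue_on \<Omega>)" by (rule measurable_restrict_space1)
    with hm show "(\<lambda>x. h x * indicat_real (box a b) x) \<in> borel_measurable (lebesgue_on \<Omega>)" by measurable
    show "integrable (lebesgue_on \<Omega>) (\<lambda>x. norm (h x))" using h by simp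
    show "AE x in lebesgue_on \<Omega>. (\<lambda>n. h x * ?\<phi> n x) \<longlonglongrightarrow> h x * indicat_real (box a b) x"
      by (intro AE_I2 tendsto_mult tendsto_const box_bump_limit ab)
    have "norm (h x * ?\<phi> n x) \<le> norm (h x)" for n x
      unfolding norm_mult using mult_left_mono[OF le[of n x] norm_ge_zero[of "h x"]] by simp
    then show "AE x in lebesgue_on \<Omega>. norm (h x * ?\<phi> n x) \<le> norm (h x)" for n by simp
  qed
  moreover have "(LINT x|lebesgue_on \<Omega>. h x * ?\<phi> n x) = 0" for n using t[of n] zero by blast
  ultimately show ?thesis using LIMSEQ_unique[OF tendsto_const] by fastforce
qed

text \<open>All small boxes with a corner at \<open>x\<close> have integral zero, so the density vanishes at \<open>x\<close>
  whenever \<open>x\<close> is a Lebesgue point in the sense of \<open>integrable_ccontinuous_explicit\<close>.\<close>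

lemma fundamental_lemma_variations:
  fixes h :: "real^'n::finite \<Rightarrow> real"
  assumes h: "integrable (lebesgue_on \<Omega>) h" and "\<Omega> \<in> sets lebesgue" and W: "open W" "W \<subseteq> \<Omega>"
    and zero: "\<And>\<phi> g. test_function W \<phi> g \<Longrightarrow> (LINT x|lebesgue_on \<Omega>. h x * \<phi> x) = 0"
  shows "AE x in lebesgue_on W. h x = 0"
proof -
  define F where "F x = indicator \<Omega> x * h x" for x
  have F: "integrable lebesgue F"
    using h assms(2) by (simp add: F_def[abs_def] integrable_restrict_space)
  then have "F absolutely_integrable_on UNIV" by (simp add: set_integrable_def)
  then have Fi: "F integrable_on cbox a b" for a b
    by (meson absolutely_integrable_on_def integrable_on_subcbox subset_UNIV)
  obtain N where N: "negligible N" and lim: "\<And>x e. \<lbrakk>x \<notin> N; 0 < e\<rbrakk> \<Longrightarrow>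
        \<exists>d>0. \<forall>t. 0 < t \<and> t < d \<longrightarrow> norm (integral (cbox x (x + t *\<^sub>R One)) F /\<^sub>R t ^ DIM(real^'n) - F x) < e"
    using integrable_ccontinuous_explicit[OF Fi] by metis
  have box0: "integral (cbox a b) F = 0" if ab: "\<And>i. a $ i < b $ i" "cbox a b \<subseteq> W" for a b
  proof -
    have "integral (cbox a b) F = integral (box a b) F" by (rule integral_open_interval[symmetric])
    also have "\<dots> = (LINT x|lebesgue_on (box a b). F x)"
    proof (rule lebesgue_integral_eq_integral[symmetric])
      show "integrable (lebesgue_on (box a b)) F"
        using integrable_mult_indicator[OF _ F, of "box a b"] by (simp add: integrable_restrict_space)
    qed simp
    also have "\<dots> = (LINT x|lebesgue. indicator (box a b) x * F x)"
      by (simp add: integral_restrict_space)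
    also have "\<dots> = (LINT x|lebesgue. indicator \<Omega> x * (h x * indicator (box a b) x))"
      by (simp add: F_def ac_simps)
    also have "\<dots> = (LINT x|lebesgue_on \<Omega>. h x * indicator (box a b) x)"
      using assms(2) by (simp add: integral_restrict_space)
    also have "\<dots> = 0" by (rule integral_box_eq_0_of_test_functions[OF h zero that])
    finally show ?thesis .
  qed
  have "h x = 0" if x: "x \<in> W" "x \<notin> N" for x
  proof -
    obtain r where r: "0 < r" "ball x r \<subseteq> W" using W(1) x(1) open_contains_ball by blast
    have small: "cbox x (x + t *\<^sub>R One) \<subseteq> W" if t: "0 < t" "t < r / (2 * real CARD('n))" for t
    proof
      fix y assume y: "y \<in> cbox x (x + t *\<^sub>R One)"
      have "norm (y - x) \<le> (\<Sum>i\<in>UNIV. \<bar>(y - x) $ i\<bar>)" by (rule norm_le_l1_cart)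
      also have "\<dots> \<le> (\<Sum>i\<in>(UNIV::'n set). t)"
      proof (rule sum_mono)
        fix i :: 'n
        have "One $ i = (1::real)"
          using cart_eq_inner_axis[of "One::real^'n" i] by (simp add: axis_in_Basis_iff)
        then show "\<bar>(y - x) $ i\<bar> \<le> t" using y by (auto simp: mem_box_cart abs_le_iff diff_le_eq add.commute dest: spec[of _ i])
      qed
      also have "\<dots> = real CARD('n) * t" by simp
      also have "\<dots> < r" using t r(1) by (simp add: field_simps)
      finally show "y \<in> W" using r(2) by (auto simp: dist_norm norm_minus_commute)
    qed
    have One: "x $ i < (x + t *\<^sub>R One) $ i" if "0 < t" for t and i :: 'n
      using cart_eq_inner_axis[of "One::real^'n" i] that by (simp add: axis_in_Basis_iff)
    have "F x = 0"
    proof (rule ccontr)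
      assume "F x \<noteq> 0"
      then obtain d where d: "d > 0" "\<And>t. 0 < t \<Longrightarrow> t < d \<Longrightarrow>
          norm (integral (cbox x (x + t *\<^sub>R One)) F /\<^sub>R t ^ DIM(real^'n) - F x) < norm (F x)"
        using lim[OF x(2), of "norm (F x)"] by auto
      \<comment> \<open>This side length makes the box small enough both for the limit and for \<open>W\<close>.\<close>
      define t where "t = min (d/2) (r / (4 * real CARD('n)))"
      have t: "0 < t" "t < d" "t < r / (2 * real CARD('n))"
        using d(1) r(1) by (auto simp: t_def min_less_iff_disj field_simps)
      have "integral (cbox x (x + t *\<^sub>R One)) F = 0"
        by (rule box0[OF One[OF t(1)] small[OF t(1) t(3)]])
      with d(2)[OF t(1,2)] show False by simp
    qed
    then show ?thesis using x(1) W(2) by (auto simp: F_def)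
  qed
  then have "{x \<in> W. h x \<noteq> 0} \<subseteq> N" by blast
  with N have "{x \<in> W. h x \<noteq> 0} \<in> null_sets lebesgue"
    using negligible_subset negligible_iff_null_sets by blast
  then show ?thesis
    using W(1) by (simp add: AE_restrict_space_iff AE_iff_null_sets borel_open lmeasurable_iff_integrable)
       (auto simp: AE_iff_null intro!: AE_I')
qed

text \<open>Integrals of difference quotients vanish by translation invariance, and the difference
  quotients converge boundedly to the partial derivative.\<close>

lemma integral_derivative_compact_support:
  fixes \<psi> :: "real^'n::finite \<Rightarrow> real"
  assumes "test_function UNIV \<psi> g"
  shows "(LINT x|lebesgue. g x $ j) = 0"
proof -
  define K where "K = closure {x. \<psi> x \<noteq> 0}"
  \<comment> \<open>\<open>L\<close> contains the supports of all difference quotients \<open>D n\<close>, because \<open>norm (e n) \<le> 1\<close>.\<close>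
  define L where "L = {x + y |x y. x \<in> K \<and> y \<in> cball 0 (1::real)}"
  define e where "e n = (1 / real (Suc n)) *\<^sub>R axis j (1::real)" for n
  define D where "D n x = real (Suc n) * (\<psi> (e n + x) - \<psi> x)" for n x
  have K: "compact K" using assms by (simp add: test_function_def K_def)
  have L: "compact L" unfolding L_def by (rule compact_sums[OF K compact_cball])
  note c = test_function_continuous[OF assms]
  obtain B where B: "0 < B" "\<And>x. \<bar>\<psi> x\<bar> \<le> B" "\<And>x. norm (g x) \<le> B" using test_function_bounded[OF assms] by metis
  have supp: "\<psi> x = 0" "g x = 0" if "x \<notin> K" for x
    using test_function_support[OF assms, folded K_def, OF that] by simp_all
  have mb: "\<psi> \<in> borel_measurable borel" "(\<lambda>x. g x $ j) \<in> borel_measurable borel"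
    using c by (auto intro!: borel_measurable_continuous_onI continuous_intros)
  have ne: "norm (e n) \<le> 1" for n by (simp add: e_def norm_axis_1)
  have KL: "x \<in> L" if "x \<in> K" for x
    unfolding L_def using that by force
  have KL2: "x \<in> L" if "e n + x \<in> K" for n x
  proof -
    have "x = (e n + x) + (- e n)" "- e n \<in> cball 0 1" using ne[of n] by simp_all
    with that show ?thesis unfolding L_def by blast
  qed
  have int\<psi>: "integrable lborel \<psi>"
  proof (rule Bochner_Integration.integrable_bound)
    show "integrable lborel (\<lambda>x. indicator K x * B)"
      using emeasure_bounded_finite[OF compact_imp_bounded[OF K]] K by (simp add: borel_compact)
    show "AE x in lborel. norm (\<psi> x) \<le> norm (indicat_real K x * B)"
      using B supp by (intro AE_I2) (auto simp: indicator_def)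
  qed (use mb in simp)
  have shift: "integrable lborel (\<lambda>x. \<psi> (y + x))" "(LINT x|lborel. \<psi> (y + x)) = (LINT x|lborel. \<psi> x)" for y
  proof -
    have *: "integrable (distr lborel borel ((+) y)) \<psi>" using int\<psi> by (simp only: lborel_distr_plus)
    from * show "integrable lborel (\<lambda>x. \<psi> (y + x))" using mb by (simp add: integrable_distr_eq)
    have "(LINT x|distr lborel borel ((+) y). \<psi> x) = (LINT x|lborel. \<psi> (y + x))"
      using mb by (simp add: integral_distr)
    then show "(LINT x|lborel. \<psi> (y + x)) = (LINT x|lborel. \<psi> x)" by (simp only: lborel_distr_plus)
  qed
  have "(\<lambda>n. LINT x|lborel. D n x) \<longlonglongrightarrow> (LINT x|lborel. g x $ j)"
  proof (rule integral_dominated_convergence[where w = "\<lambda>x. indicator L x * B"])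
    show "(\<lambda>x. g x $ j) \<in> borel_measurable lborel" using mb by simp
    show "D n \<in> borel_measurable lborel" for n
      unfolding D_def[abs_def] using borel_measurable_integrable[OF shift(1)] mb by measurable
    show "integrable lborel (\<lambda>x. indicator L x * B)"
      using emeasure_bounded_finite[OF compact_imp_bounded[OF L]] L by (simp add: borel_compact)
    show "AE x in lborel. (\<lambda>n. D n x) \<longlonglongrightarrow> g x $ j"
    proof (rule AE_I2)
      fix x
      have "((\<lambda>t. \<psi> (x + t *\<^sub>R axis j 1)) has_real_derivative g x $ j) (at 0)"
      proof -
        have "((\<lambda>t. x + t *\<^sub>R axis j (1::real)) has_derivative (\<lambda>t. t *\<^sub>R axis j 1)) (at 0)"
          by (auto intro!: derivative_eq_intros)
        moreover have "(\<psi> has_derivative (\<lambda>h. h \<bullet> g x)) (at (x + 0 *\<^sub>R axis j 1))"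
          using test_function_gderiv[OF assms, of x] by (simp add: gderiv_def)
        ultimately have "((\<lambda>t. \<psi> (x + t *\<^sub>R axis j 1)) has_derivative (\<lambda>t. (t *\<^sub>R axis j 1) \<bullet> g x)) (at 0)"
          by (rule has_derivative_compose)
        then show ?thesis
          by (simp add: has_field_derivative_def inner_axis' mult.commute[of _ "g x $ j"])
      qed
      then have "((\<lambda>h. (\<psi> (x + h *\<^sub>R axis j 1) - \<psi> x) / h) \<longlongrightarrow> g x $ j) (at 0)"
        by (simp add: DERIV_def)
      moreover have "filterlim (\<lambda>n. 1 / real (Suc n)) (at 0) sequentially"
        unfolding filterlim_at using LIMSEQ_inverse_real_of_nat by (simp add: inverse_eq_divide)
      ultimately have "(\<lambda>n. (\<psi> (x + (1 / real (Suc n)) *\<^sub>R axis j 1) - \<psi> x) / (1 / real (Suc n))) \<longlonglongrightarrow> g x $ j"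
        by (rule filterlim_compose)
      then show "(\<lambda>n. D n x) \<longlonglongrightarrow> g x $ j"
        by (simp add: D_def e_def mult.commute add.commute)
    qed
    show "AE x in lborel. norm (D n x) \<le> indicat_real L x * B" for n
    proof (rule AE_I2)
      fix x
      show "norm (D n x) \<le> indicat_real L x * B"
      proof (cases "x \<in> L")
        case False
        then have "x \<notin> K" "e n + x \<notin> K" using KL KL2 by blast+
        then show ?thesis using supp(1) False by (simp add: D_def)
      next
        case True
        have "norm (\<psi> (e n + x) - \<psi> x) \<le> B * norm (e n + x - x)"
        proof (rule differentiable_bound[of UNIV \<psi> "\<lambda>y h. h \<bullet> g y"])
          show "(\<psi> has_derivative (\<lambda>h. h \<bullet> g y)) (at y within UNIV)" for y
            using test_function_gderiv[OF assms, of y] by (simp add: gderiv_def)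
          show "onorm (\<lambda>h. h \<bullet> g y) \<le> B" for y
          proof (rule onorm_le)
            show "norm (h \<bullet> g y) \<le> B * norm h" for h
              using Cauchy_Schwarz_ineq2[of h "g y"] mult_left_mono[OF B(3)[of y] norm_ge_zero[of h]]
              by (simp add: mult.commute)
          qed
        qed auto
        then have d: "\<bar>\<psi> (e n + x) - \<psi> x\<bar> \<le> B / real (Suc n)" by (simp add: e_def norm_axis_1)
        have "\<bar>D n x\<bar> = real (Suc n) * \<bar>\<psi> (e n + x) - \<psi> x\<bar>" by (simp only: D_def abs_mult abs_of_nat)
        also have "\<dots> \<le> real (Suc n) * (B / real (Suc n))" using d by (rule mult_left_mono) simp
        also have "\<dots> = B" by simp
        finally show ?thesis using True by simp
      qed
    qed
  qed
  moreover have "(LINT x|lborel. D n x) = 0" for n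
    unfolding D_def using shift int\<psi> by simp
  ultimately have "(LINT x|lborel. g x $ j) = 0" using LIMSEQ_unique[OF tendsto_const] by fastforce
  then show ?thesis using mb(2) by (simp add: integral_completion)
qed

text \<open>Integration by parts against an affine function: the product of its component \<open>i\<close> with \<open>\<phi>\<close>
  is again a test function, and the integral of its partial derivative vanishes.\<close>

lemma integral_affine_times_gradient:
  fixes A :: "real^'n^'n::finite"
  assumes t: "test_function UNIV \<phi> g"
  shows "(LINT x|lebesgue. (A *v x + c) $ i * g x $ j) = - (LINT x|lebesgue. A $ i $ j * \<phi> x)"
    and "integrable lebesgue (\<lambda>x. (A *v x + c) $ i * g x $ j)"
proof -
  define f where "f x = (A *v x + c) $ i" for x
  have f: "GDERIV f x :> A $ i" for x
  proof -
    have "f = (\<lambda>x. x \<bullet> A $ i + c $ i)"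
      by (simp add: f_def fun_eq_iff matrix_vector_mul_component inner_commute)
    then show ?thesis unfolding gderiv_def by (auto intro!: derivative_eq_intros)
  qed
  have cf: "continuous_on UNIV f" using f by (rule gderiv_continuous_on)
  note c = test_function_continuous[OF t]
  define K where "K = closure {x. \<phi> x \<noteq> 0}"
  have K: "compact K" using t by (simp add: test_function_def K_def)
  note supp = test_function_support[OF t, folded K_def]
  have int: "integrable lebesgue F" if F: "continuous_on UNIV F" "\<And>x. x \<notin> K \<Longrightarrow> F x = 0" for F :: "real^'n \<Rightarrow> real"
  proof -
    have "integrable lborel (\<lambda>x. indicator K x *\<^sub>R F x)"
      by (rule borel_integrable_compact[OF K]) (rule continuous_on_subset[OF F(1) subset_UNIV])
    moreover have "(\<lambda>x. indicator K x *\<^sub>R F x) = F" using F(2) by (auto simp: indicator_def fun_eq_iff)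
    ultimately have "integrable lborel F" by simp
    then show ?thesis by (simp add: integrable_completion borel_measurable_integrable)
  qed
  have i1: "integrable lebesgue (\<lambda>x. f x * g x $ j)"
    by (rule int) (use supp in \<open>auto intro!: continuous_intros cf c\<close>)
  have i2: "integrable lebesgue (\<lambda>x. A $ i $ j * \<phi> x)"
    by (rule int) (use supp in \<open>auto intro!: continuous_intros cf c\<close>)
  have "{x. f x * \<phi> x \<noteq> 0} \<subseteq> {x. \<phi> x \<noteq> 0}" by auto
  then have sub: "closure {x. f x * \<phi> x \<noteq> 0} \<subseteq> K" unfolding K_def by (rule closure_mono)
  have "compact (closure {x. f x * \<phi> x \<noteq> 0})"
    using bounded_subset[OF compact_imp_bounded[OF K] sub] by (simp only: compact_eq_bounded_closed closed_closure)
  moreover have "GDERIV (\<lambda>x. f x * \<phi> x) x :> f x *\<^sub>R g x + \<phi> x *\<^sub>R A $ i" for x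
    by (rule GDERIV_mult[OF f test_function_gderiv[OF t]])
  moreover have "continuous_on UNIV (\<lambda>x. f x *\<^sub>R g x + \<phi> x *\<^sub>R A $ i)"
    by (intro continuous_intros cf c)
  ultimately have "test_function UNIV (\<lambda>x. f x * \<phi> x) (\<lambda>x. f x *\<^sub>R g x + \<phi> x *\<^sub>R A $ i)"
    by (simp add: test_function_def)
  from integral_derivative_compact_support[OF this, of j] i1 i2
  show "(LINT x|lebesgue. (A *v x + c) $ i * g x $ j) = - (LINT x|lebesgue. A $ i $ j * \<phi> x)"
    unfolding f_def[symmetric] by (simp add: mult.commute[of "\<phi> _"])
  from i1 show "integrable lebesgue (\<lambda>x. (A *v x + c) $ i * g x $ j)" by (simp add: f_def)
qed

lemma L2_vec_nth: "w \<in> L2 M \<Longrightarrow> (\<lambda>x. w x $ i) \<in> L2 M"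
  by (rule L2_bounded_linear_image[OF bounded_linear_vec_nth])

lemma AE_eq_of_test_functions:
  fixes G H :: "real^'n::finite \<Rightarrow> real^'n^'n"
  assumes \<Omega>: "\<Omega> \<in> lmeasurable" and G: "G \<in> L2 (lebesgue_on \<Omega>)" "H \<in> L2 (lebesgue_on \<Omega>)"
    and W: "open W" "W \<subseteq> \<Omega>"
    and eq: "\<And>\<phi> g i j. test_function W \<phi> g \<Longrightarrow>
      (LINT x|lebesgue_on \<Omega>. G x $ i $ j * \<phi> x) = (LINT x|lebesgue_on \<Omega>. H x $ i $ j * \<phi> x)"
  shows "AE x in lebesgue_on W. G x = H x"
proof -
  note fin = finite_measure_lebesgue_on[OF \<Omega>]
  have "AE x in lebesgue_on W. G x $ i $ j - H x $ i $ j = 0" for i j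
  proof (rule fundamental_lemma_variations[OF _ fmeasurableD[OF \<Omega>] W])
    have i: "integrable (lebesgue_on \<Omega>) (\<lambda>x. G x $ i $ j)" "integrable (lebesgue_on \<Omega>) (\<lambda>x. H x $ i $ j)"
      by (intro L2_integrable[OF fin] L2_vec_nth G)+
    then show "integrable (lebesgue_on \<Omega>) (\<lambda>x. G x $ i $ j - H x $ i $ j)" by simp
    fix \<phi> g assume t: "test_function W \<phi> g"
    show "(LINT x|lebesgue_on \<Omega>. (G x $ i $ j - H x $ i $ j) * \<phi> x) = 0"
      using eq[OF t, of i j] test_function_integrable(1)[OF t i(1)] test_function_integrable(1)[OF t i(2)]
      by (simp add: left_diff_distrib)
  qed
  then have "AE x in lebesgue_on W. \<forall>i j. G x $ i $ j - H x $ i $ j = 0"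
    by (simp add: AE_all_countable)
  then show ?thesis by eventually_elim (simp add: vec_eq_iff)
qed

lemma weak_gradient_unique:
  assumes "open \<Omega>" "\<Omega> \<in> lmeasurable" "G \<in> L2 (lebesgue_on \<Omega>)" "H \<in> L2 (lebesgue_on \<Omega>)"
    and "weak_gradient \<Omega> v G" "weak_gradient \<Omega> v H"
  shows "AE x in lebesgue_on \<Omega>. G x = H x"
  using assms by (intro AE_eq_of_test_functions[of \<Omega>]) (auto simp: weak_gradient_def)

lemma weak_gradient_diff:
  assumes "\<Omega> \<in> lmeasurable" and v: "v \<in> L2 (lebesgue_on \<Omega>)" "w \<in> L2 (lebesgue_on \<Omega>)"
    and G: "G \<in> L2 (lebesgue_on \<Omega>)" "H \<in> L2 (lebesgue_on \<Omega>)"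
    and "weak_gradient \<Omega> v G" "weak_gradient \<Omega> w H"
  shows "weak_gradient \<Omega> (\<lambda>x. v x - w x) (\<lambda>x. G x - H x)"
  unfolding weak_gradient_def
proof (intro allI impI)
  fix \<phi> g i j assume t: "test_function \<Omega> \<phi> g"
  note fin = finite_measure_lebesgue_on[OF assms(1)]
  note I = L2_integrable[OF fin L2_vec_nth]
  note J = L2_integrable[OF fin L2_vec_nth[OF L2_vec_nth]]
  have "(LINT x|lebesgue_on \<Omega>. (v x - w x) $ i * g x $ j) =
      (LINT x|lebesgue_on \<Omega>. v x $ i * g x $ j) - (LINT x|lebesgue_on \<Omega>. w x $ i * g x $ j)"
    using test_function_integrable(2)[OF t I[OF v(1)]] test_function_integrable(2)[OF t I[OF v(2)]]
    by (simp add: left_diff_distrib)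
  moreover have "(LINT x|lebesgue_on \<Omega>. (G x - H x) $ i $ j * \<phi> x) =
      (LINT x|lebesgue_on \<Omega>. G x $ i $ j * \<phi> x) - (LINT x|lebesgue_on \<Omega>. H x $ i $ j * \<phi> x)"
    using test_function_integrable(1)[OF t J[OF G(1)]] test_function_integrable(1)[OF t J[OF G(2)]]
    by (simp add: left_diff_distrib)
  moreover have "(LINT x|lebesgue_on \<Omega>. v x $ i * g x $ j) = - (LINT x|lebesgue_on \<Omega>. G x $ i $ j * \<phi> x)"
      "(LINT x|lebesgue_on \<Omega>. w x $ i * g x $ j) = - (LINT x|lebesgue_on \<Omega>. H x $ i $ j * \<phi> x)"
    using assms(6,7) t by (auto simp: weak_gradient_def)
  ultimately show "(LINT x|lebesgue_on \<Omega>. (v x - w x) $ i * g x $ j) =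
      - (LINT x|lebesgue_on \<Omega>. (G x - H x) $ i $ j * \<phi> x)" by simp
qed

lemma H1_grad:
  assumes "v \<in> H1 \<Omega>"
  shows "grad \<Omega> v \<in> L2 (lebesgue_on \<Omega>)" "weak_gradient \<Omega> v (grad \<Omega> v)"
  using someI_ex[of "\<lambda>G. G \<in> L2 (lebesgue_on \<Omega>) \<and> weak_gradient \<Omega> v G"] assms
  by (auto simp: H1_def grad_def Bex_def)

lemma H1_L2: "v \<in> H1 \<Omega> \<Longrightarrow> v \<in> L2 (lebesgue_on \<Omega>)"
  by (simp add: H1_def)

lemma H1_zero: "(\<lambda>x. 0) \<in> H1 \<Omega>"
proof -
  have "weak_gradient \<Omega> (\<lambda>x. 0) (\<lambda>x. 0)" by (simp add: weak_gradient_def)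
  then show ?thesis unfolding H1_def by (blast intro: L2_zero)
qed

lemma H1_diff:
  assumes "\<Omega> \<in> lmeasurable" "v \<in> H1 \<Omega>" "w \<in> H1 \<Omega>"
  shows "(\<lambda>x. v x - w x) \<in> H1 \<Omega>"
  unfolding H1_def
  using L2_diff[OF H1_L2[OF assms(2)] H1_L2[OF assms(3)]] L2_diff[OF H1_grad(1)[OF assms(2)] H1_grad(1)[OF assms(3)]]
    weak_gradient_diff[OF assms(1) H1_L2[OF assms(2)] H1_L2[OF assms(3)] H1_grad(1)[OF assms(2)] H1_grad(1)[OF assms(3)]
      H1_grad(2)[OF assms(2)] H1_grad(2)[OF assms(3)]] by blast

lemma transpose_linear: "bounded_linear (transpose :: real^'n^'n::finite \<Rightarrow> _)"
  by (rule linear_conv_bounded_linear[THEN iffD1], rule linearI) (simp_all add: transpose_def vec_eq_iff)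

lemma strain_L2:
  assumes "v \<in> H1 \<Omega>"
  shows "strain \<Omega> v \<in> L2 (lebesgue_on \<Omega>)"
proof -
  have "bounded_linear (\<lambda>G. (1/2) *\<^sub>R (G + transpose G) :: real^'n^'n)"
    by (intro bounded_linear_const_scaleR bounded_linear_add bounded_linear_ident transpose_linear)
  from L2_bounded_linear_image[OF this H1_grad(1)[OF assms]] show ?thesis
    unfolding strain_def[abs_def] .
qed

lemma transpose_strain: "transpose (strain \<Omega> v x) = strain \<Omega> v x"
  by (simp add: strain_def transpose_def vec_eq_iff add.commute)

lemma grad_diff_AE:
  assumes "open \<Omega>" "\<Omega> \<in> lmeasurable" "v \<in> H1 \<Omega>" "w \<in> H1 \<Omega>"
  shows "AE x in lebesgue_on \<Omega>. grad \<Omega> (\<lambda>x. v x - w x) x = grad \<Omega> v x - grad \<Omega> w x"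
  using weak_gradient_unique[OF assms(1,2) H1_grad(1)[OF H1_diff[OF assms(2-4)]]
      L2_diff[OF H1_grad(1)[OF assms(3)] H1_grad(1)[OF assms(4)]] H1_grad(2)[OF H1_diff[OF assms(2-4)]]
      weak_gradient_diff[OF assms(2) H1_L2[OF assms(3)] H1_L2[OF assms(4)] H1_grad(1)[OF assms(3)]
        H1_grad(1)[OF assms(4)] H1_grad(2)[OF assms(3)] H1_grad(2)[OF assms(4)]]] .

lemma strain_diff_AE:
  assumes "open \<Omega>" "\<Omega> \<in> lmeasurable" "v \<in> H1 \<Omega>" "w \<in> H1 \<Omega>"
  shows "AE x in lebesgue_on \<Omega>. strain \<Omega> (\<lambda>x. v x - w x) x = strain \<Omega> v x - strain \<Omega> w x"
  using grad_diff_AE[OF assms]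
proof eventually_elim
  case (elim x)
  show ?case unfolding strain_def elim by (simp add: transpose_def vec_eq_iff algebra_simps)
qed

text \<open>The constant matrix \<open>A\<close> and \<open>grad \<Omega> v\<close> have the same integrals against test functions
  supported in the interior of \<open>B\<close>; the frontier of the convex set \<open>B\<close> is a null set. Applied to
  elements, this makes the strain of piecewise affine functions piecewise constant.\<close>

lemma grad_affine_AE:
  fixes v :: "real^'n::finite \<Rightarrow> real^'n"
  assumes \<Omega>: "open \<Omega>" "\<Omega> \<in> lmeasurable" and v: "v \<in> H1 \<Omega>"
    and B: "convex B" "B \<in> sets lebesgue"
    and aff: "AE x in lebesgue_on (B \<inter> \<Omega>). v x = A *v x + c"
  shows "AE x in lebesgue_on (B \<inter> \<Omega>). grad \<Omega> v x = A"
proof -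
  define W where "W = interior B \<inter> \<Omega>"
  have W: "open W" "W \<subseteq> \<Omega>" "W \<subseteq> B" using \<Omega>(1) interior_subset by (auto simp: W_def)
  have sets: "\<Omega> \<in> sets lebesgue" using \<Omega>(2) by (rule fmeasurableD)
  have "AE x in lebesgue_on W. grad \<Omega> v x = A"
  proof (rule AE_eq_of_test_functions[OF \<Omega>(2) H1_grad(1)[OF v] L2_const[OF finite_measure_lebesgue_on[OF \<Omega>(2)]] W(1,2)])
    fix \<phi> g i j assume t: "test_function W \<phi> g"
    have tU: "test_function UNIV \<phi> g" by (rule test_function_mono[OF t subset_UNIV])
    have g0: "g x = 0" "\<phi> x = 0" if "x \<notin> W" for x using test_function_zero_outside[OF t that] by simp_all
    have "(LINT x|lebesgue_on \<Omega>. v x $ i * g x $ j) = (LINT x|lebesgue_on \<Omega>. (A *v x + c) $ i * g x $ j)"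
    proof (rule integral_cong_AE)
      show "(\<lambda>x. v x $ i * g x $ j) \<in> borel_measurable (lebesgue_on \<Omega>)"
        by (rule borel_measurable_integrable[OF test_function_integrable(2)[OF t
              L2_integrable[OF finite_measure_lebesgue_on[OF \<Omega>(2)] L2_vec_nth[OF H1_L2[OF v]]]]])
      show "(\<lambda>x. (A *v x + c) $ i * g x $ j) \<in> borel_measurable (lebesgue_on \<Omega>)"
        using borel_measurable_integrable[OF integral_affine_times_gradient(2)[OF tU]]
        by (rule measurable_restrict_space1)
      have "AE x in lebesgue. x \<in> B \<inter> \<Omega> \<longrightarrow> v x = A *v x + c"
        using aff B(2) sets by (simp add: AE_restrict_space_iff)
      then have "AE x in lebesgue_on \<Omega>. x \<in> B \<longrightarrow> v x = A *v x + c"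
        using sets by (simp add: AE_restrict_space_iff) (auto elim: eventually_mono)
      then show "AE x in lebesgue_on \<Omega>. v x $ i * g x $ j = (A *v x + c) $ i * g x $ j"
        by eventually_elim (use g0(1) W(3) in force)
    qed
    also have "\<dots> = (LINT x|lebesgue. (A *v x + c) $ i * g x $ j)"
    proof (rule integral_zero_outside[OF sets])
      show "(A *v x + c) $ i * g x $ j = 0" if "x \<notin> \<Omega>" for x
      proof -
        have "x \<notin> W" using that W(2) by blast
        then have "g x = 0" by (rule g0(1))
        then show ?thesis by simp
      qed
    qed
    also have "\<dots> = - (LINT x|lebesgue. A $ i $ j * \<phi> x)" by (rule integral_affine_times_gradient(1)[OF tU])
    also have "(LINT x|lebesgue. A $ i $ j * \<phi> x) = (LINT x|lebesgue_on \<Omega>. A $ i $ j * \<phi> x)"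
    proof (rule integral_zero_outside[OF sets, symmetric])
      show "A $ i $ j * \<phi> x = 0" if "x \<notin> \<Omega>" for x
        using g0(2)[of x] that W(2) by auto
    qed
    finally show "(LINT x|lebesgue_on \<Omega>. grad \<Omega> v x $ i $ j * \<phi> x) = (LINT x|lebesgue_on \<Omega>. A $ i $ j * \<phi> x)"
      using H1_grad(2)[OF v] test_function_mono[OF t W(2)] by (simp add: weak_gradient_def)
  qed
  then have 1: "AE x in lebesgue. x \<in> W \<longrightarrow> grad \<Omega> v x = A"
    using W(1) by (simp add: AE_restrict_space_iff)
  have "frontier B \<in> null_sets lebesgue"
    using negligible_convex_frontier[OF B(1)] by (simp add: negligible_iff_null_sets)
  then have "AE x in lebesgue. x \<notin> frontier B" by (rule AE_not_in)
  with 1 have "AE x in lebesgue. x \<in> B \<inter> \<Omega> \<longrightarrow> grad \<Omega> v x = A"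
    by eventually_elim (use closure_subset in \<open>auto simp: W_def frontier_def\<close>)
  then show ?thesis using B(2) sets by (simp add: AE_restrict_space_iff)
qed

section \<open>Traces\<close>

text \<open>The trace of \<open>v\<close> at \<open>x\<close> has the value \<open>c\<close> if this quantity tends to \<open>0\<close> as \<open>r \<rightarrow> 0\<close>.\<close>

definition mean_dist :: "(real^'n) set \<Rightarrow> (real^'n \<Rightarrow> real^'n) \<Rightarrow> real^'n \<Rightarrow> real^'n \<Rightarrow> real \<Rightarrow> real" where
  "mean_dist \<Omega> v c x r =
     (LINT y|lebesgue_on (\<Omega> \<inter> ball x r). norm (v y - c)) / measure lebesgue (\<Omega> \<inter> ball x r)"

lemma mean_dist_integrable:
  assumes "open \<Omega>" "v \<in> L2 (lebesgue_on \<Omega>)"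
  shows "integrable (lebesgue_on (\<Omega> \<inter> ball x r)) (\<lambda>y. norm (v y - c))"
proof -
  have S: "\<Omega> \<inter> ball x r \<in> lmeasurable"
    using assms(1) by (intro bounded_set_imp_lmeasurable) (auto intro: bounded_Int)
  note fin = finite_measure_lebesgue_on[OF S]
  have "v \<in> L2 (lebesgue_on (\<Omega> \<inter> ball x r))"
    using assms(1) S by (intro L2_restrict_space[OF assms(2)]) (auto intro: fmeasurableD)
  then have "(\<lambda>y. v y - c) \<in> L2 (lebesgue_on (\<Omega> \<inter> ball x r))" by (intro L2_diff L2_const fin)
  then show ?thesis by (intro integrable_norm L2_integrable fin)
qed

lemma mean_dist_nonneg: "0 \<le> mean_dist \<Omega> v c x r"
  by (simp add: mean_dist_def)

lemma mean_dist_diff_le: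
  assumes "open \<Omega>" "v \<in> L2 (lebesgue_on \<Omega>)" "w \<in> L2 (lebesgue_on \<Omega>)"
  shows "mean_dist \<Omega> (\<lambda>x. v x - w x) (c - d) x r \<le> mean_dist \<Omega> v c x r + mean_dist \<Omega> w d x r"
proof -
  let ?M = "lebesgue_on (\<Omega> \<inter> ball x r)"
  have "(LINT y|?M. norm (v y - w y - (c - d))) \<le> (LINT y|?M. norm (v y - c) + norm (w y - d))"
  proof (rule integral_mono)
    show "integrable ?M (\<lambda>y. norm (v y - w y - (c - d)))"
      using mean_dist_integrable[OF assms(1) L2_diff[OF assms(2,3)]] .
    show "integrable ?M (\<lambda>y. norm (v y - c) + norm (w y - d))"
      using mean_dist_integrable[OF assms(1,2)] mean_dist_integrable[OF assms(1,3)] by simp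
    show "norm (v y - w y - (c - d)) \<le> norm (v y - c) + norm (w y - d)" for y
      using norm_triangle_ineq4[of "v y - c" "w y - d"] by (simp add: algebra_simps)
  qed
  also have "\<dots> = (LINT y|?M. norm (v y - c)) + (LINT y|?M. norm (w y - d))"
    using mean_dist_integrable[OF assms(1,2)] mean_dist_integrable[OF assms(1,3)] by simp
  finally show ?thesis
    unfolding mean_dist_def by (simp add: add_divide_distrib[symmetric] divide_right_mono)
qed

lemma mean_dist_tendsto_diff:
  assumes "open \<Omega>" "v \<in> L2 (lebesgue_on \<Omega>)" "w \<in> L2 (lebesgue_on \<Omega>)"
    and "(mean_dist \<Omega> v c x \<longlongrightarrow> 0) (at_right 0)" "(mean_dist \<Omega> w d x \<longlongrightarrow> 0) (at_right 0)"
  shows "(mean_dist \<Omega> (\<lambda>x. v x - w x) (c - d) x \<longlongrightarrow> 0) (at_right 0)"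
proof (rule tendsto_sandwich[OF _ _ tendsto_const])
  show "((\<lambda>r. mean_dist \<Omega> v c x r + mean_dist \<Omega> w d x r) \<longlongrightarrow> 0) (at_right 0)"
    using tendsto_add[OF assms(4,5)] by simp
qed (use mean_dist_diff_le[OF assms(1-3)] in \<open>auto simp: mean_dist_nonneg\<close>)

text \<open>Open sets meet every ball around a frontier point in positive measure, so the mean of a
  constant is that constant. This is what makes trace values unique.\<close>

lemma mean_dist_zero:
  assumes "open \<Omega>" "x \<in> frontier \<Omega>" "0 < r"
  shows "mean_dist \<Omega> (\<lambda>x. 0) c x r = norm c"
proof -
  obtain y where "y \<in> \<Omega>" "dist y x < r"
    using assms(2,3) closure_approachable[of x \<Omega>] unfolding frontier_def by blast
  then have "\<Omega> \<inter> ball x r \<noteq> {}" by (auto simp: dist_commute)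
  moreover have "open (\<Omega> \<inter> ball x r)" by (rule open_Int[OF assms(1) open_ball])
  ultimately have "\<not> negligible (\<Omega> \<inter> ball x r)" by (rule open_not_negligible[rotated])
  moreover have S: "\<Omega> \<inter> ball x r \<in> lmeasurable"
    using assms(1) by (intro bounded_set_imp_lmeasurable) (auto intro: bounded_Int)
  ultimately have "measure lebesgue (\<Omega> \<inter> ball x r) \<noteq> 0" by (simp add: negligible_iff_measure)
  moreover have "measure (lebesgue_on (\<Omega> \<inter> ball x r)) (\<Omega> \<inter> ball x r) = measure lebesgue (\<Omega> \<inter> ball x r)"
    using fmeasurableD[OF S] by (simp add: measure_restrict_space)
  ultimately show ?thesis by (simp add: mean_dist_def)
qed

lemma has_trace_alt:
  "has_trace \<Omega> v \<gamma> \<longleftrightarrow> \<gamma> \<in> L2 (surface_on (frontier \<Omega>)) \<and>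
     (AE x in surface_on (frontier \<Omega>). (mean_dist \<Omega> v (\<gamma> x) x \<longlongrightarrow> 0) (at_right 0))"
  by (simp add: has_trace_def mean_dist_def[abs_def])

lemma has_trace_diff:
  assumes "open \<Omega>" "v \<in> L2 (lebesgue_on \<Omega>)" "w \<in> L2 (lebesgue_on \<Omega>)" "has_trace \<Omega> v \<gamma>" "has_trace \<Omega> w \<delta>"
  shows "has_trace \<Omega> (\<lambda>x. v x - w x) (\<lambda>x. \<gamma> x - \<delta> x)"
  unfolding has_trace_alt
proof
  show "(\<lambda>x. \<gamma> x - \<delta> x) \<in> L2 (surface_on (frontier \<Omega>))"
    using assms(4,5) by (intro L2_diff) (auto simp: has_trace_alt)
  show "AE x in surface_on (frontier \<Omega>). (mean_dist \<Omega> (\<lambda>x. v x - w x) (\<gamma> x - \<delta> x) x \<longlongrightarrow> 0) (at_right 0)"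
    using assms(4)[unfolded has_trace_alt, THEN conjunct2] assms(5)[unfolded has_trace_alt, THEN conjunct2]
    by eventually_elim (rule mean_dist_tendsto_diff[OF assms(1-3)])
qed

text \<open>Two traces of \<open>v\<close> differ by a trace of \<open>v - v = 0\<close>.\<close>

lemma has_trace_unique:
  assumes "open \<Omega>" "v \<in> L2 (lebesgue_on \<Omega>)" "has_trace \<Omega> v \<gamma>" "has_trace \<Omega> v \<delta>"
  shows "AE x in surface_on (frontier \<Omega>). \<gamma> x = \<delta> x"
  using has_trace_diff[OF assms(1,2,2,3,4), unfolded has_trace_alt, THEN conjunct2] AE_space
proof eventually_elim
  case (elim x)
  then have x: "x \<in> frontier \<Omega>" by (simp add: space_restrict_space)
  have "\<forall>\<^sub>F r in at_right 0. mean_dist \<Omega> (\<lambda>x. 0) (\<gamma> x - \<delta> x) x r = norm (\<gamma> x - \<delta> x)"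
    using mean_dist_zero[OF assms(1) x] by (simp add: eventually_at_right_less[THEN eventually_mono])
  from tendsto_cong[OF this] elim(1) have "((\<lambda>r. norm (\<gamma> x - \<delta> x)) \<longlongrightarrow> 0) (at_right (0::real))" by simp
  then have "norm (\<gamma> x - \<delta> x) = 0" by (simp add: tendsto_const_iff)
  then show ?case by simp
qed

lemma has_trace_zero: "has_trace \<Omega> (\<lambda>x. 0) (\<lambda>x. 0)"
  by (simp add: has_trace_def L2_zero)

lemma space_surface: "space surface = UNIV"
  by (simp add: surface_def hausdorff_measure_def)

lemma borel_sets_surface: "S \<in> sets borel \<Longrightarrow> S \<in> sets surface"
  unfolding surface_def hausdorff_measure_def
  by (rule sets_completionI_sets) (simp add: sets.sets_measure_of_eq[of borel, simplified])

lemma AE_surface_on_subset: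
  assumes "AE x in surface_on S. Q x" "T \<subseteq> S" "S \<in> sets borel" "T \<in> sets borel"
  shows "AE x in surface_on T. Q x"
proof -
  have S: "S \<inter> space surface \<in> sets surface" "T \<inter> space surface \<in> sets surface"
    using borel_sets_surface[OF assms(3)] borel_sets_surface[OF assms(4)] by (simp_all add: space_surface)
  have "AE x in surface. x \<in> S \<longrightarrow> Q x"
    using assms(1) unfolding AE_restrict_space_iff[OF S(1)] .
  then have "AE x in surface. x \<in> T \<longrightarrow> Q x"
    by eventually_elim (use assms(2) in blast)
  then show ?thesis unfolding AE_restrict_space_iff[OF S(2)] .
qed

lemma vanishes_on_diff:
  assumes "open \<Omega>" "v \<in> L2 (lebesgue_on \<Omega>)" "w \<in> L2 (lebesgue_on \<Omega>)" "vanishes_on \<Omega> \<Gamma> v" "vanishes_on \<Omega> \<Gamma> w"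
  shows "vanishes_on \<Omega> \<Gamma> (\<lambda>x. v x - w x)"
proof -
  obtain \<gamma> \<delta> where t: "has_trace \<Omega> v \<gamma>" "has_trace \<Omega> w \<delta>" and
      z: "AE x in surface_on \<Gamma>. \<gamma> x = 0" "AE x in surface_on \<Gamma>. \<delta> x = 0"
    using assms(4,5) by (auto simp: vanishes_on_def)
  have "AE x in surface_on \<Gamma>. \<gamma> x - \<delta> x = 0" using z by eventually_elim simp
  with has_trace_diff[OF assms(1-3) t] show ?thesis by (auto simp: vanishes_on_def)
qed

section \<open>The spaces and the load functional\<close>

lemma space_V_H1: "v \<in> space_V P \<Longrightarrow> v \<in> H1 (dom P)"
  by (simp add: space_V_def)

lemma space_V_zero: "(\<lambda>x. 0) \<in> space_V P"
  using has_trace_zero by (fastforce simp: space_V_def vanishes_on_def H1_zero)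

lemma space_V_diff:
  assumes "open (dom P)" "dom P \<in> lmeasurable" "v \<in> space_V P" "w \<in> space_V P"
  shows "(\<lambda>x. v x - w x) \<in> space_V P"
  using assms by (auto simp: space_V_def intro!: H1_diff vanishes_on_diff H1_L2)

lemma bd_trace_of_space_V: "v \<in> space_V P \<Longrightarrow> has_trace (dom P) v (bd_trace (dom P) v)"
  using someI_ex[of "has_trace (dom P) v"] by (auto simp: space_V_def vanishes_on_def bd_trace_def)

lemma Gamma_N_borel:
  assumes "closed (Gamma_D P)"
  shows "Gamma_N P \<in> sets borel"
  using assms unfolding Gamma_N_def by (intro sets.Diff borel_closed frontier_closed)

lemma trace_on_Gamma_N:
  assumes "closed (Gamma_D P)" "v \<in> space_V P"
  shows "bd_trace (dom P) v \<in> L2 (surface_on (Gamma_N P))"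
proof (rule L2_restrict_space)
  show "bd_trace (dom P) v \<in> L2 (surface_on (frontier (dom P)))"
    using bd_trace_of_space_V[OF assms(2)] by (simp add: has_trace_def)
qed (auto simp: Gamma_N_def intro!: borel_sets_surface Gamma_N_borel[unfolded Gamma_N_def] assms)

text \<open>Although \<open>bd_trace\<close> is only a choice among functions that agree almost everywhere, the
  functional \<open>b\<close> is additive on \<open>V\<close> because traces are unique up to null sets.\<close>

lemma form_b_diff:
  assumes "valid_problem P" "dom P \<in> lmeasurable" "v \<in> space_V P" "w \<in> space_V P"
  shows "form_b P (\<lambda>x. v x - w x, q, \<beta>) = form_b P (v, q', \<beta>') - form_b P (w, q'', \<beta>'')"
proof -
  have op: "open (dom P)" and cl: "closed (Gamma_D P)" and ld: "load P \<in> L2 (lebesgue_on (dom P))"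
    and tr: "traction P \<in> L2 (surface_on (Gamma_N P))"
    using assms(1) by (auto simp: valid_problem_def)
  note V = space_V_diff[OF op assms(2-4)]
  let ?t = "bd_trace (dom P)"
  have "AE x in surface_on (frontier (dom P)). ?t (\<lambda>x. v x - w x) x = ?t v x - ?t w x"
    by (rule has_trace_unique[OF op H1_L2[OF space_V_H1[OF V]] bd_trace_of_space_V[OF V]
          has_trace_diff[OF op H1_L2[OF space_V_H1[OF assms(3)]] H1_L2[OF space_V_H1[OF assms(4)]]
            bd_trace_of_space_V[OF assms(3)] bd_trace_of_space_V[OF assms(4)]]])
  then have ae: "AE x in surface_on (Gamma_N P). ?t (\<lambda>x. v x - w x) x = ?t v x - ?t w x"
    by (rule AE_surface_on_subset) (auto simp: Gamma_N_def intro!: Gamma_N_borel[unfolded Gamma_N_def] cl)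
  note tv = trace_on_Gamma_N[OF cl assms(3)] and tw = trace_on_Gamma_N[OF cl assms(4)]
    and td = trace_on_Gamma_N[OF cl V]
  have "l2_inner (surface_on (Gamma_N P)) (traction P) (?t (\<lambda>x. v x - w x))
      = (LINT x|surface_on (Gamma_N P). traction P x \<bullet> ?t v x - traction P x \<bullet> ?t w x)"
    unfolding l2_inner_def
  proof (rule integral_cong_AE)
    show "AE x in surface_on (Gamma_N P). traction P x \<bullet> ?t (\<lambda>x. v x - w x) x = traction P x \<bullet> ?t v x - traction P x \<bullet> ?t w x"
      using ae by eventually_elim (simp add: inner_diff_right)
  qed (use L2_inner_integrable[OF tr tv] L2_inner_integrable[OF tr tw] L2_inner_integrable[OF tr td]
      in \<open>auto intro: borel_measurable_integrable\<close>)
  also have "\<dots> = l2_inner (surface_on (Gamma_N P)) (traction P) (?t v) - l2_inner (surface_on (Gamma_N P)) (traction P) (?t w)"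
    unfolding l2_inner_def using L2_inner_integrable[OF tr tv] L2_inner_integrable[OF tr tw] by simp
  finally show ?thesis
    using L2_inner_integrable[OF ld H1_L2[OF space_V_H1[OF assms(3)]]]
      L2_inner_integrable[OF ld H1_L2[OF space_V_H1[OF assms(4)]]]
    by (simp add: form_b_def l2_inner_def inner_diff_right)
qed

section \<open>Meshes\<close>

lemma compact_body: "compact (body T)"
  by (simp add: body_def finite_imp_compact_convex_hull)

lemma body_sets: "body T \<in> sets lebesgue"
  by (rule fmeasurableD[OF lmeasurable_compact[OF compact_body]])

text \<open>Two elements share at most \<open>d\<close> of their \<open>d + 1\<close> vertices, so their intersection lies in a
  hyperplane.\<close>

lemma negligible_body_Int:
  assumes "is_mesh \<Omega> \<T>" "T \<in> \<T>" "T' \<in> \<T>" "T \<noteq> T'"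
  shows "negligible (body T \<inter> body (T' :: 'n::finite element))"
proof -
  let ?C = "set (verts T) \<inter> set (verts T')"
  have eq: "body T \<inter> body T' = convex hull ?C" and ne: "set (verts T) \<noteq> set (verts T')"
    using assms by (auto simp: is_mesh_def)
  have card: "card (set (verts T)) = CARD('n) + 1" "card (set (verts T')) = CARD('n) + 1"
    using assms by (auto simp: is_mesh_def is_element_def distinct_card)
  have "?C \<subset> set (verts T)"
  proof (rule psubsetI)
    show "?C \<noteq> set (verts T)"
    proof
      assume "?C = set (verts T)"
      then have "set (verts T) \<subseteq> set (verts T')" by blast
      with card ne show False by (metis card_subset_eq finite_set)
    qed
  qed simp
  then have "card ?C < CARD('n) + 1" using card(1) by (metis psubset_card_mono finite_set)
  then have "aff_dim ?C < int (DIM(real^'n))"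
    using aff_dim_le_card[of ?C] by simp
  then have "interior (convex hull ?C) = {}"
    by (simp add: interior_rel_interior_gen aff_dim_convex_hull)
  then show ?thesis unfolding eq by (simp add: negligible_convex_interior)
qed

lemma mesh_AE_unique_element:
  assumes "is_mesh \<Omega> (\<T> :: 'n::finite element set)"
  shows "AE x in lebesgue. \<forall>T \<in> \<T>. \<forall>T' \<in> \<T>. T \<noteq> T' \<longrightarrow> x \<notin> body T \<inter> body T'"
proof -
  have fin: "finite \<T>" using assms by (simp add: is_mesh_def)
  have "AE x in lebesgue. T \<noteq> T' \<longrightarrow> x \<notin> body T \<inter> body T'" if "T \<in> \<T>" "T' \<in> \<T>" for T T'
  proof (cases "T = T'")
    case False
    then have "body T \<inter> body T' \<in> null_sets lebesgue"
      using negligible_body_Int[OF assms that] by (simp add: negligible_iff_null_sets)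
    from AE_not_in[OF this] show ?thesis by eventually_elim simp
  qed simp
  then show ?thesis using fin by (simp add: AE_finite_all)
qed

definition cell_mean :: "(real^'n) set \<Rightarrow> (real^'n \<Rightarrow> 'b::euclidean_space) \<Rightarrow> 'n::finite element \<Rightarrow> 'b" where
  "cell_mean \<Omega> f T = (LINT x|lebesgue_on (body T \<inter> \<Omega>). f x) /\<^sub>R measure lebesgue (body T \<inter> \<Omega>)"

text \<open>The piecewise constant function of cell means. The common boundaries of elements, where
  several summands are present, form a null set.\<close>

definition averaged ::
  "(real^'n) set \<Rightarrow> 'n::finite element set \<Rightarrow> (real^'n \<Rightarrow> 'b::euclidean_space) \<Rightarrow> real^'n \<Rightarrow> 'b" where
  "averaged \<Omega> \<T> f x = (\<Sum>T\<in>\<T>. indicator (body T \<inter> \<Omega>) x *\<^sub>R cell_mean \<Omega> f T)"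

context
  fixes \<Omega> :: "(real^'n::finite) set" and \<T> :: "'n element set"
  assumes mesh: "is_mesh \<Omega> \<T>" and \<Omega>: "\<Omega> \<in> lmeasurable"
begin

lemma finite_mesh: "finite \<T>" using mesh by (simp add: is_mesh_def)

lemma cell_lmeasurable: "body T \<inter> \<Omega> \<in> lmeasurable"
  using fmeasurable_Int_fmeasurable[OF \<Omega> body_sets[of T]] by (simp add: Int_commute)

lemma integrable_cell:
  fixes f :: "real^'n \<Rightarrow> 'b::euclidean_space"
  assumes "integrable (lebesgue_on \<Omega>) f"
  shows "integrable (lebesgue_on (body T \<inter> \<Omega>)) f"
    and "integrable lebesgue (\<lambda>x. indicator (body T \<inter> \<Omega>) x *\<^sub>R f x)"
proof -
  have 1: "integrable lebesgue (\<lambda>x. indicator \<Omega> x *\<^sub>R f x)"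
    using assms fmeasurableD[OF \<Omega>] by (simp add: integrable_restrict_space)
  have "integrable lebesgue (\<lambda>x. indicator (body T) x *\<^sub>R (indicator \<Omega> x *\<^sub>R f x))"
    by (rule integrable_mult_indicator[OF body_sets 1])
  then show 2: "integrable lebesgue (\<lambda>x. indicator (body T \<inter> \<Omega>) x *\<^sub>R f x)"
    by (simp add: indicator_inter_arith)
  then show "integrable (lebesgue_on (body T \<inter> \<Omega>)) f"
    using fmeasurableD[OF cell_lmeasurable] by (simp add: integrable_restrict_space)
qed

lemma sum_indicator_cells_AE:
  "AE x in lebesgue. (\<Sum>T\<in>\<T>. indicator (body T \<inter> \<Omega>) x) = (indicator \<Omega> x :: real)"
  using mesh_AE_unique_element[OF mesh]
proof eventually_elim
  case (elim x)
  show ?case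
  proof (cases "x \<in> \<Omega>")
    case True
    then have "x \<in> (\<Union>T\<in>\<T>. body T)" using mesh closure_subset[of \<Omega>] by (auto simp: is_mesh_def)
    then obtain T where T: "T \<in> \<T>" "x \<in> body T" by blast
    have "(\<Sum>T'\<in>\<T>. indicator (body T' \<inter> \<Omega>) x) = (\<Sum>T'\<in>\<T>. if T' = T then 1 else 0 :: real)"
      using elim T True by (intro sum.cong) (auto simp: indicator_def)
    then show ?thesis using T True finite_mesh by simp
  qed simp
qed

lemma integral_eq_sum_cells:
  fixes f :: "real^'n \<Rightarrow> 'b::euclidean_space"
  assumes f: "integrable (lebesgue_on \<Omega>) f"
  shows "(LINT x|lebesgue_on \<Omega>. f x) = (\<Sum>T\<in>\<T>. (LINT x|lebesgue_on (body T \<inter> \<Omega>). f x))"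
proof -
  have "(LINT x|lebesgue_on \<Omega>. f x) = (LINT x|lebesgue. indicator \<Omega> x *\<^sub>R f x)"
    using fmeasurableD[OF \<Omega>] by (simp add: integral_restrict_space)
  also have "\<dots> = (LINT x|lebesgue. (\<Sum>T\<in>\<T>. indicator (body T \<inter> \<Omega>) x *\<^sub>R f x))"
  proof (rule integral_cong_AE)
    show "(\<lambda>x. indicator \<Omega> x *\<^sub>R f x) \<in> borel_measurable lebesgue"
      using f fmeasurableD[OF \<Omega>] by (simp add: integrable_restrict_space borel_measurable_integrable)
    show "(\<lambda>x. \<Sum>T\<in>\<T>. indicator (body T \<inter> \<Omega>) x *\<^sub>R f x) \<in> borel_measurable lebesgue"
      using integrable_cell(2)[OF f] by (intro borel_measurable_integrable Bochner_Integration.integrable_sum)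
    show "AE x in lebesgue. indicator \<Omega> x *\<^sub>R f x = (\<Sum>T\<in>\<T>. indicator (body T \<inter> \<Omega>) x *\<^sub>R f x)"
      using sum_indicator_cells_AE by eventually_elim (simp add: scaleR_left.sum[symmetric])
  qed
  also have "\<dots> = (\<Sum>T\<in>\<T>. (LINT x|lebesgue. indicator (body T \<inter> \<Omega>) x *\<^sub>R f x))"
    by (rule Bochner_Integration.integral_sum) (rule integrable_cell(2)[OF f])
  also have "\<dots> = (\<Sum>T\<in>\<T>. (LINT x|lebesgue_on (body T \<inter> \<Omega>). f x))"
    using fmeasurableD[OF cell_lmeasurable] by (simp add: integral_restrict_space)
  finally show ?thesis .
qed

lemma averaged_AE:
  assumes T: "T \<in> \<T>"
  shows "AE x in lebesgue_on (body T \<inter> \<Omega>). averaged \<Omega> \<T> f x = cell_mean \<Omega> f T"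
proof -
  have "AE x in lebesgue. x \<in> body T \<inter> \<Omega> \<longrightarrow> averaged \<Omega> \<T> f x = cell_mean \<Omega> f T"
    using mesh_AE_unique_element[OF mesh]
  proof eventually_elim
    case (elim x)
    show ?case
    proof
      assume x: "x \<in> body T \<inter> \<Omega>"
      have "averaged \<Omega> \<T> f x = (\<Sum>T'\<in>\<T>. if T' = T then cell_mean \<Omega> f T else 0)"
        unfolding averaged_def using elim T x by (intro sum.cong) (auto simp: indicator_def)
      then show "averaged \<Omega> \<T> f x = cell_mean \<Omega> f T" using T finite_mesh by simp
    qed
  qed
  then show ?thesis using fmeasurableD[OF cell_lmeasurable] by (simp add: AE_restrict_space_iff)
qed

lemma averaged_L2: "averaged \<Omega> \<T> f \<in> L2 (lebesgue_on \<Omega>)"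
proof -
  have 1: "(\<lambda>x. indicator (body T \<inter> \<Omega>) x *\<^sub>R cell_mean \<Omega> f T) \<in> L2 (lebesgue_on \<Omega>)" for T
  proof (rule L2_scale_bounded[where K = 1])
    show "(\<lambda>x. cell_mean \<Omega> f T) \<in> L2 (lebesgue_on \<Omega>)"
      by (rule L2_const[OF finite_measure_lebesgue_on[OF \<Omega>]])
    have "indicat_real (body T \<inter> \<Omega>) \<in> borel_measurable lebesgue"
      using fmeasurableD[OF cell_lmeasurable] by (rule borel_measurable_indicator)
    then show "indicat_real (body T \<inter> \<Omega>) \<in> borel_measurable (lebesgue_on \<Omega>)"
      by (rule measurable_restrict_space1)
  qed (simp add: indicator_def)
  have "(\<lambda>x. \<Sum>T\<in>S. indicator (body T \<inter> \<Omega>) x *\<^sub>R cell_mean \<Omega> f T) \<in> L2 (lebesgue_on \<Omega>)" if "finite S" for S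
    using that
  proof (induction S)
    case (insert T S)
    show ?case unfolding sum.insert[OF insert(1,2)] by (rule L2_add[OF 1 insert(3)])
  next
    case empty
    show ?case unfolding sum.empty by (rule L2_zero)
  qed
  then show ?thesis unfolding averaged_def[abs_def] using finite_mesh .
qed

text \<open>On a cell of measure zero both sides vanish, since the inverse of \<open>0\<close> is \<open>0\<close>.\<close>

lemma cell_integral_eq_scale_mean:
  fixes f :: "real^'n \<Rightarrow> 'b::euclidean_space"
  shows "(LINT x|lebesgue_on (body T \<inter> \<Omega>). f x) = measure lebesgue (body T \<inter> \<Omega>) *\<^sub>R cell_mean \<Omega> f T"
proof (cases "measure lebesgue (body T \<inter> \<Omega>) = 0")
  case True
  then have "emeasure (lebesgue_on (body T \<inter> \<Omega>)) (space (lebesgue_on (body T \<inter> \<Omega>))) = 0"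
    using cell_lmeasurable[of T]
    by (simp add: emeasure_restrict_space fmeasurableD emeasure_eq_measure2)
  then have "AE x in lebesgue_on (body T \<inter> \<Omega>). f x = 0"
    by (intro AE_I'[of "space (lebesgue_on (body T \<inter> \<Omega>))"]) (auto simp: null_sets_def)
  then show ?thesis using True integral_eq_zero_AE by (simp add: integral_eq_zero_AE)
qed (simp add: cell_mean_def)

text \<open>Taking cell averages is the \<open>L\<^sup>2\<close>-orthogonal projection onto the piecewise constant
  functions.\<close>

lemma averaged_orthogonal:
  assumes S: "S \<in> L2 (lebesgue_on \<Omega>)" and f: "f \<in> L2 (lebesgue_on \<Omega>)"
    and const: "\<And>T. T \<in> \<T> \<Longrightarrow> \<exists>c. AE x in lebesgue_on (body T \<inter> \<Omega>). S x = c"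
  shows "(LINT x|lebesgue_on \<Omega>. S x \<bullet> averaged \<Omega> \<T> f x) = (LINT x|lebesgue_on \<Omega>. S x \<bullet> f x)"
proof -
  have "(LINT x|lebesgue_on (body T \<inter> \<Omega>). S x \<bullet> averaged \<Omega> \<T> f x) = (LINT x|lebesgue_on (body T \<inter> \<Omega>). S x \<bullet> f x)"
    if T: "T \<in> \<T>" for T
  proof -
    let ?M = "lebesgue_on (body T \<inter> \<Omega>)"
    obtain c where c: "AE x in ?M. S x = c" using const[OF T] by blast
    have if': "integrable ?M f"
      by (rule integrable_cell(1)[OF L2_integrable[OF finite_measure_lebesgue_on[OF \<Omega>] f]])
    note m = borel_measurable_integrable[OF integrable_cell(1)[OF L2_inner_integrable[OF S f], of T]]
      borel_measurable_integrable[OF integrable_cell(1)[OF L2_inner_integrable[OF S averaged_L2[of f]], of T]]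
    have "(LINT x|?M. S x \<bullet> averaged \<Omega> \<T> f x) = (LINT x|?M. c \<bullet> cell_mean \<Omega> f T)"
    proof (rule integral_cong_AE)
      show "AE x in ?M. S x \<bullet> averaged \<Omega> \<T> f x = c \<bullet> cell_mean \<Omega> f T"
        using c averaged_AE[OF T, of f] by eventually_elim simp
    qed (use m in simp_all)
    also have "\<dots> = measure lebesgue (body T \<inter> \<Omega>) * (c \<bullet> cell_mean \<Omega> f T)"
      using fmeasurableD[OF cell_lmeasurable] by (simp add: measure_restrict_space)
    also have "\<dots> = c \<bullet> (LINT x|?M. f x)" by (simp add: cell_integral_eq_scale_mean)
    also have "\<dots> = (LINT x|?M. c \<bullet> f x)" using if' by simp
    also have "\<dots> = (LINT x|?M. S x \<bullet> f x)"
    proof (rule integral_cong_AE)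
      show "AE x in ?M. c \<bullet> f x = S x \<bullet> f x" using c by eventually_elim simp
    qed (use m if' in simp_all)
    finally show ?thesis .
  qed
  then show ?thesis
    using integral_eq_sum_cells[OF L2_inner_integrable[OF S f]]
      integral_eq_sum_cells[OF L2_inner_integrable[OF S averaged_L2[of f]]] by simp
qed

lemma norm_cell_mean_le:
  assumes f: "f \<in> L2 (lebesgue_on \<Omega>)" and g: "g \<in> L2 (lebesgue_on \<Omega>)"
    and le: "AE x in lebesgue_on \<Omega>. norm (f x) \<le> g x"
  shows "norm (cell_mean \<Omega> f T) \<le> cell_mean \<Omega> g T"
proof -
  let ?M = "lebesgue_on (body T \<inter> \<Omega>)"
  note fin = finite_measure_lebesgue_on[OF \<Omega>]
  have "AE x in lebesgue. x \<in> \<Omega> \<longrightarrow> norm (f x) \<le> g x"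
    using le fmeasurableD[OF \<Omega>] by (simp add: AE_restrict_space_iff)
  then have "AE x in lebesgue. x \<in> body T \<inter> \<Omega> \<longrightarrow> norm (f x) \<le> g x" by eventually_elim simp
  then have ae: "AE x in ?M. norm (f x) \<le> g x"
    using fmeasurableD[OF cell_lmeasurable] by (simp add: AE_restrict_space_iff)
  have "norm (LINT x|?M. f x) \<le> (LINT x|?M. norm (f x))" by (rule integral_norm_bound)
  also have "\<dots> \<le> (LINT x|?M. g x)"
    using integrable_cell(1)[OF L2_integrable[OF fin f], of T] integrable_cell(1)[OF L2_integrable[OF fin g], of T] ae
    by (intro integral_mono_AE) simp_all
  finally have "norm (LINT x|?M. f x) \<le> (LINT x|?M. g x)" .
  from mult_left_mono[OF this, of "inverse (measure lebesgue (body T \<inter> \<Omega>))"]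
  show ?thesis by (simp add: cell_mean_def)
qed

text \<open>The constraint \<open>norm q \<le> \<beta>\<close> is convex and therefore survives averaging.\<close>

lemma norm_averaged_le:
  assumes "f \<in> L2 (lebesgue_on \<Omega>)" "g \<in> L2 (lebesgue_on \<Omega>)" "AE x in lebesgue_on \<Omega>. norm (f x) \<le> g x"
  shows "norm (averaged \<Omega> \<T> f x) \<le> averaged \<Omega> \<T> g x"
  unfolding averaged_def
  by (rule order_trans[OF norm_sum sum_mono]) (simp add: mult_left_mono norm_cell_mean_le[OF assms])

text \<open>Linear constraints, such as symmetry and vanishing trace of a matrix, survive
  averaging.\<close>

lemma averaged_in_kernel:
  fixes L :: "'b::euclidean_space \<Rightarrow> 'c::euclidean_space"
  assumes f: "f \<in> L2 (lebesgue_on \<Omega>)" and L: "bounded_linear L"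
    and zero: "AE x in lebesgue_on \<Omega>. L (f x) = 0"
  shows "L (averaged \<Omega> \<T> f x) = 0"
proof -
  interpret L: bounded_linear L by (rule L)
  have "L (cell_mean \<Omega> f T) = 0" for T
  proof -
    have "AE x in lebesgue. x \<in> \<Omega> \<longrightarrow> L (f x) = 0"
      using zero fmeasurableD[OF \<Omega>] by (simp add: AE_restrict_space_iff)
    then have "AE x in lebesgue. x \<in> body T \<inter> \<Omega> \<longrightarrow> L (f x) = 0" by eventually_elim simp
    then have ae: "AE x in lebesgue_on (body T \<inter> \<Omega>). L (f x) = 0"
      using fmeasurableD[OF cell_lmeasurable] by (simp add: AE_restrict_space_iff)
    have "L (LINT x|lebesgue_on (body T \<inter> \<Omega>). f x) = (LINT x|lebesgue_on (body T \<inter> \<Omega>). L (f x))"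
      by (rule integral_bounded_linear[OF L integrable_cell(1)[OF L2_integrable[OF finite_measure_lebesgue_on[OF \<Omega>] f]], symmetric])
    also have "\<dots> = 0" by (rule integral_eq_zero_AE[OF ae])
    finally show ?thesis by (simp add: cell_mean_def L.scaleR)
  qed
  then show ?thesis by (simp add: averaged_def L.sum L.scaleR)
qed

text \<open>Jensen's inequality for the norm; the last step is orthogonality against the constant
  \<open>1\<close>.\<close>

lemma integral_norm_averaged_le:
  assumes f: "f \<in> L2 (lebesgue_on \<Omega>)"
  shows "(LINT x|lebesgue_on \<Omega>. norm (averaged \<Omega> \<T> f x)) \<le> (LINT x|lebesgue_on \<Omega>. norm (f x))"
proof -
  note fin = finite_measure_lebesgue_on[OF \<Omega>]
  have n: "(\<lambda>x. norm (f x)) \<in> L2 (lebesgue_on \<Omega>)" using f measurable_compose[OF L2_measurable[OF f] borel_measurable_norm] by (simp add: L2_def)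
  have "(LINT x|lebesgue_on \<Omega>. norm (averaged \<Omega> \<T> f x)) \<le> (LINT x|lebesgue_on \<Omega>. averaged \<Omega> \<T> (\<lambda>x. norm (f x)) x)"
    by (intro integral_mono integrable_norm L2_integrable[OF fin] averaged_L2 norm_averaged_le f n) simp
  also have "\<dots> = (LINT x|lebesgue_on \<Omega>. norm (f x))"
    using averaged_orthogonal[OF L2_const[OF fin, of 1] n] by auto
  finally show ?thesis .
qed

end

section \<open>Nestedness of the discrete spaces\<close>

lemma children_verts:
  assumes "verts T \<noteq> []" "T' \<in> children T"
  shows "verts T' \<noteq> []" "set (verts T') \<subseteq> insert (midpoint (hd (verts T)) (last (verts T))) (set (verts T))"
proof -
  have sub: "x \<in> set (verts T)" if "x \<in> set (butlast (tl (verts T)))" for x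
    using that by (meson in_set_butlastD list.set_sel(2) assms(1))
  show "verts T' \<noteq> []" "set (verts T') \<subseteq> insert (midpoint (hd (verts T)) (last (verts T))) (set (verts T))"
    using assms by (auto simp: children_def Let_def dest!: in_set_takeD in_set_dropD dest: sub)
qed

lemma children_body:
  assumes "verts T \<noteq> []" "T' \<in> children T"
  shows "body T' \<subseteq> body T"
proof -
  let ?z = "verts T"
  have "midpoint (hd ?z) (last ?z) \<in> closed_segment (hd ?z) (last ?z)" by (rule midpoint_in_closed_segment)
  also have "\<dots> \<subseteq> convex hull (set ?z)"
    using assms(1) by (intro closed_segment_subset_convex_hull hull_inc) auto
  finally have "insert (midpoint (hd ?z) (last ?z)) (set ?z) \<subseteq> convex hull (set ?z)"
    by (auto intro: hull_inc)
  with children_verts(2)[OF assms] have "set (verts T') \<subseteq> convex hull (set ?z)" by blast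
  then show ?thesis unfolding body_def by (intro hull_minimal) simp_all
qed

text \<open>The part of being a refinement that nestedness of the discrete spaces depends on. The
  vertex lists have to be nonempty because otherwise \<open>hd\<close> and \<open>last\<close>, and hence the children, are
  unspecified.\<close>

definition subordinate :: "'n::finite element set \<Rightarrow> 'n element set \<Rightarrow> bool" where
  "subordinate \<T>' \<T> \<longleftrightarrow> (\<forall>T' \<in> \<T>'. verts T' \<noteq> [] \<and> (\<exists>T \<in> \<T>. body T' \<subseteq> body T))"

lemma subordinate_bisect:
  assumes "subordinate \<T>' \<T>" "\<M> \<subseteq> \<T>'"
  shows "subordinate (bisect \<T>' \<M>) \<T>"
  unfolding subordinate_def
proof
  fix S assume "S \<in> bisect \<T>' \<M>"
  then consider "S \<in> \<T>'" | T' where "T' \<in> \<T>'" "S \<in> children T'"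
    using assms(2) by (auto simp: bisect_def)
  then show "verts S \<noteq> [] \<and> (\<exists>T\<in>\<T>. body S \<subseteq> body T)"
  proof cases
    case 1
    then show ?thesis using assms(1) by (simp add: subordinate_def)
  next
    case 2
    with assms(1) have T': "verts T' \<noteq> []" "\<exists>T\<in>\<T>. body T' \<subseteq> body T" by (auto simp: subordinate_def)
    show ?thesis using children_verts(1)[OF T'(1) 2(2)] children_body[OF T'(1) 2(2)] T'(2) by blast
  qed
qed

lemma subordinate_nvb:
  assumes "is_mesh \<Omega> \<T>" "\<M> \<subseteq> \<T>" "is_nvb \<Omega> \<T> \<M> \<T>'"
  shows "subordinate \<T>' \<T>"
proof -
  have "subordinate \<T> \<T>"
    using assms(1) by (fastforce simp: subordinate_def is_mesh_def is_element_def)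
  then have 0: "subordinate (bisect \<T> \<M>) \<T>" using assms(2) by (rule subordinate_bisect)
  have "subordinate ((closure_step ^^ n) (bisect \<T> \<M>)) \<T>" for n
  proof (induction n)
    case (Suc n)
    show ?case unfolding funpow.simps o_apply closure_step_def
      by (rule subordinate_bisect) (use Suc in \<open>auto simp: with_hanging_node_def closure_step_def\<close>)
  qed (simp add: 0)
  with assms(3) show ?thesis by (auto simp: is_nvb_def)
qed

lemma AE_lebesgue_on_subset:
  assumes "AE x in lebesgue_on S. Q x" "T \<subseteq> S" "S \<in> sets lebesgue" "T \<in> sets lebesgue"
  shows "AE x in lebesgue_on T. Q x"
proof -
  have "AE x in lebesgue. x \<in> S \<longrightarrow> Q x" using assms(1,3) by (simp add: AE_restrict_space_iff)
  then have "AE x in lebesgue. x \<in> T \<longrightarrow> Q x" by eventually_elim (use assms(2) in blast)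
  then show ?thesis using assms(4) by (simp add: AE_restrict_space_iff)
qed

lemma discrete_X_mono:
  assumes "subordinate \<T>' \<T>" "dom P \<in> sets lebesgue"
  shows "discrete_X P \<T> \<subseteq> discrete_X P \<T>'"
proof -
  have *: "\<exists>T\<in>\<T>. \<forall>Q. (AE x in lebesgue_on (body T \<inter> dom P). Q x) \<longrightarrow> (AE x in lebesgue_on (body T' \<inter> dom P). Q x)"
    if T': "T' \<in> \<T>'" for T'
  proof -
    obtain T where T: "T \<in> \<T>" "body T' \<subseteq> body T" using assms(1) T' by (auto simp: subordinate_def)
    show ?thesis
    proof (rule bexI[OF _ T(1)], intro allI impI)
      fix Q assume "AE x in lebesgue_on (body T \<inter> dom P). Q x"
      then show "AE x in lebesgue_on (body T' \<inter> dom P). Q x"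
        by (rule AE_lebesgue_on_subset) (use T(2) assms(2) body_sets in auto)
    qed
  qed
  show ?thesis
  proof
    fix z assume "z \<in> discrete_X P \<T>"
    then obtain v q \<beta> where z: "z = (v, q, \<beta>)" "v \<in> space_V P" "q \<in> space_Q P" "\<beta> \<in> space_M P"
      and c: "\<And>T. T \<in> \<T> \<Longrightarrow> \<exists>A c. AE x in lebesgue_on (body T \<inter> dom P). v x = A *v x + c"
        "\<And>T. T \<in> \<T> \<Longrightarrow> \<exists>c. AE x in lebesgue_on (body T \<inter> dom P). q x = c"
        "\<And>T. T \<in> \<T> \<Longrightarrow> \<exists>c. AE x in lebesgue_on (body T \<inter> dom P). \<beta> x = c"
      unfolding discrete_X_def by blast
    have "(\<exists>A c. AE x in lebesgue_on (body T' \<inter> dom P). v x = A *v x + c) \<and>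
        (\<exists>c. AE x in lebesgue_on (body T' \<inter> dom P). q x = c) \<and>
        (\<exists>c. AE x in lebesgue_on (body T' \<inter> dom P). \<beta> x = c)" if T': "T' \<in> \<T>'" for T'
    proof -
      obtain T where T: "T \<in> \<T>" "\<And>Q. (AE x in lebesgue_on (body T \<inter> dom P). Q x) \<Longrightarrow> (AE x in lebesgue_on (body T' \<inter> dom P). Q x)"
        using *[OF T'] by blast
      show ?thesis using c[OF T(1)] T(2) by meson
    qed
    then show "z \<in> discrete_X P \<T>'" using z unfolding discrete_X_def by blast
  qed
qed

lemma discrete_X_subset: "discrete_X P \<T> \<subseteq> space_X P"
  by (auto simp: discrete_X_def space_X_def)

lemma mesh_domain_lmeasurable:
  assumes "is_mesh \<Omega> \<T>" "open \<Omega>"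
  shows "\<Omega> \<in> lmeasurable"
proof -
  have "bounded (\<Union>T\<in>\<T>. body T)"
    using assms(1) compact_body by (auto simp: is_mesh_def intro!: compact_imp_bounded bounded_UN)
  then have "bounded \<Omega>"
    using assms(1) closure_subset by (metis bounded_subset is_mesh_def)
  with assms(2) show ?thesis by (simp add: bounded_set_imp_lmeasurable lmeasurable_open)
qed

lemma adaptive_mesh:
  assumes "is_mesh (dom P) \<T>0" "adaptive_meshes P \<theta> U \<T>0 \<T>"
  shows "is_mesh (dom P) (\<T> l)" "\<T> l \<in> refinements (dom P) \<T>0" "subordinate (\<T> (Suc l)) (\<T> l)"
proof -
  have step: "\<exists>\<M>\<subseteq>\<T> l. is_nvb (dom P) (\<T> l) \<M> (\<T> (Suc l))" for l
    using assms(2) unfolding adaptive_meshes_def minimal_bulk_def bulk_def by blast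
  have mesh: "is_mesh (dom P) (\<T> l)" for l
  proof (cases l)
    case 0
    then show ?thesis using assms by (simp add: adaptive_meshes_def)
  next
    case (Suc k)
    then show ?thesis using step[of k] by (auto simp: is_nvb_def)
  qed
  show "is_mesh (dom P) (\<T> l)" by (rule mesh)
  show "\<T> l \<in> refinements (dom P) \<T>0"
  proof (induction l)
    case 0
    then show ?case using assms(2) by (simp add: adaptive_meshes_def refinements_def)
  next
    case (Suc l)
    then show ?case using step[of l] unfolding refinements_def by (auto intro: rtranclp.rtrancl_into_rtrancl)
  qed
  show "subordinate (\<T> (Suc l)) (\<T> l)" using step[of l] subordinate_nvb[OF mesh] by blast
qed

section \<open>The energy\<close>

lemma L2_Pair:
  assumes "f \<in> L2 M" "g \<in> L2 M"
  shows "(\<lambda>x. (f x, g x)) \<in> L2 M"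
proof -
  have "(\<lambda>x. (f x, g x)) \<in> borel_measurable M"
    using L2_measurable[OF assms(1)] L2_measurable[OF assms(2)] by (rule borel_measurable_Pair)
  then show ?thesis
    using L2_square_integrable[OF assms(1)] L2_square_integrable[OF assms(2)]
    by (simp add: L2_def norm_prod_def)
qed

text \<open>Elastic strain, plastic strain and hardening variable together. With \<open>law\<close> acting on such
  triples, \<open>a\<close> becomes a single \<open>L\<^sup>2\<close> product of \<open>law (gstrain u)\<close> and \<open>gstrain z\<close>.\<close>

definition gstrain ::
  "'n::finite problem \<Rightarrow> 'n state \<Rightarrow> real^'n \<Rightarrow> (real^'n^'n) \<times> (real^'n^'n) \<times> real" where
  "gstrain P z x = (case z of (v, q, \<beta>) \<Rightarrow> (strain (dom P) v x - q x, q x, \<beta> x))"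

definition law ::
  "'n::finite problem \<Rightarrow> (real^'n^'n) \<times> (real^'n^'n) \<times> real \<Rightarrow> (real^'n^'n) \<times> (real^'n^'n) \<times> real" where
  "law P s = (elast P (fst s), harden P (fst (snd s)), hmod P * snd (snd s))"

definition sym_strains :: "((real^'n^'n) \<times> (real^'n^'n) \<times> real) set" where
  "sym_strains = sym_matrices \<times> sym_matrices \<times> UNIV"

text \<open>The value of \<open>\<psi>\<close> at the states where it is finite, which are the admissible ones.\<close>

definition psi_real :: "'n::finite problem \<Rightarrow> (real^'n \<Rightarrow> real^'n^'n) \<Rightarrow> real" where
  "psi_real P q = yield P * (LINT x|lebesgue_on (dom P). norm (q x))"

definition admissible :: "'n::finite problem \<Rightarrow> 'n state \<Rightarrow> bool" where
  "admissible P z \<longleftrightarrow> (case z of (v, q, \<beta>) \<Rightarrow> AE x in lebesgue_on (dom P). norm (q x) \<le> \<beta> x)"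

definition energy :: "'n::finite problem \<Rightarrow> 'n state \<Rightarrow> real" where
  "energy P z = (LINT x|lebesgue_on (dom P). law P (gstrain P z x) \<bullet> gstrain P z x) / 2
     + psi_real P (fst (snd z)) - form_b P z"

lemma sym_matrices_iff: "q \<in> sym_matrices \<longleftrightarrow> transpose q = q"
  by (simp add: sym_matrices_def)

lemma sym_matrices_diff: "q \<in> sym_matrices \<Longrightarrow> p \<in> sym_matrices \<Longrightarrow> q - p \<in> sym_matrices"
  by (simp add: sym_matrices_iff transpose_def vec_eq_iff)

lemma sym_strains_diff: "s \<in> sym_strains \<Longrightarrow> t \<in> sym_strains \<Longrightarrow> s - t \<in> sym_strains"
  by (auto simp: sym_strains_def intro: sym_matrices_diff)

lemma zero_discrete_X: "(\<lambda>x. 0, \<lambda>x. 0, \<lambda>x. 0) \<in> discrete_X P \<T>"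
proof -
  have 1: "\<exists>A c. AE x in lebesgue_on (body T \<inter> dom P). (0::real^'n) = A *v x + c" for T
    by (rule exI[of _ 0], rule exI[of _ 0]) simp
  have "(0::real^'n^'n) \<in> dev_matrices"
    by (simp add: dev_matrices_def sym_matrices_iff transpose_def vec_eq_iff trace_def)
  then show ?thesis
    using 1 by (auto simp: discrete_X_def space_V_zero space_Q_def space_M_def L2_zero)
qed

lemma space_XD:
  assumes "(v, q, \<beta>) \<in> space_X P"
  shows "v \<in> space_V P" "v \<in> H1 (dom P)" "q \<in> L2 (lebesgue_on (dom P))" "\<beta> \<in> L2 (lebesgue_on (dom P))"
    "AE x in lebesgue_on (dom P). q x \<in> dev_matrices"
  using assms by (auto simp: space_X_def space_Q_def space_M_def space_V_H1)

lemma gstrain_L2: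
  assumes "z \<in> space_X P"
  shows "gstrain P z \<in> L2 (lebesgue_on (dom P))"
proof -
  obtain v q \<beta> where z: "z = (v, q, \<beta>)" by (cases z)
  note D = space_XD[OF assms[unfolded z]]
  show ?thesis unfolding gstrain_def[abs_def] z prod.case
    by (intro L2_Pair L2_diff strain_L2 D)
qed

lemma gstrain_sym_AE:
  assumes "z \<in> space_X P"
  shows "AE x in lebesgue_on (dom P). gstrain P z x \<in> sym_strains"
proof -
  obtain v q \<beta> where z: "z = (v, q, \<beta>)" by (cases z)
  show ?thesis using space_XD(5)[OF assms[unfolded z]]
  proof eventually_elim
    case (elim x)
    then have "q x \<in> sym_matrices" by (simp add: dev_matrices_def)
    moreover have "strain (dom P) v x \<in> sym_matrices" by (simp add: sym_matrices_iff transpose_strain)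
    ultimately show ?case by (simp add: z gstrain_def sym_strains_def sym_matrices_diff)
  qed
qed

lemma admissible_of_form_psi:
  assumes "z \<in> space_X P" "form_psi P z \<noteq> \<infinity>"
  shows "admissible P z"
proof -
  obtain v q \<beta> where z: "z = (v, q, \<beta>)" by (cases z)
  note D = space_XD[OF assms(1)[unfolded z]]
  have [measurable]: "q \<in> borel_measurable (lebesgue_on (dom P))" "\<beta> \<in> borel_measurable (lebesgue_on (dom P))"
    using D L2_measurable by blast+
  have m: "(\<lambda>x. dissip P (q x) (\<beta> x)) \<in> borel_measurable (lebesgue_on (dom P))"
    unfolding dissip_def by measurable
  have "(\<integral>\<^sup>+ x. dissip P (q x) (\<beta> x) \<partial>lebesgue_on (dom P)) \<noteq> \<infinity>"
    using assms(2) by (auto simp: form_psi_def z)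
  from nn_integral_PInf_AE[OF m this] show ?thesis
    unfolding admissible_def z prod.case by eventually_elim (auto simp: dissip_def split: if_splits)
qed

lemma err_commute: "err P z y = err P y z"
  by (simp add: err_def l2_norm_def split_def norm_minus_commute)

lemma inner_le_norm_squared:
  fixes a b :: "'b::real_inner"
  assumes "0 < k"
  shows "a \<bullet> b \<le> (norm a)\<^sup>2 / (2 * k) + k * (norm b)\<^sup>2 / 2"
proof -
  have "0 \<le> (norm (a - k *\<^sub>R b))\<^sup>2" by simp
  also have "\<dots> = (norm a)\<^sup>2 - 2 * k * (a \<bullet> b) + k\<^sup>2 * (norm b)\<^sup>2"
    unfolding power2_norm_eq_inner by (simp add: inner_diff_left inner_diff_right inner_commute power2_eq_square algebra_simps)
  finally have "2 * k * (a \<bullet> b) \<le> (norm a)\<^sup>2 + k\<^sup>2 * (norm b)\<^sup>2" by simp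
  then show ?thesis using assms by (simp add: field_simps power2_eq_square)
qed

lemma averaged_dev_matrices:
  assumes "is_mesh \<Omega> \<T>" "\<Omega> \<in> lmeasurable" "q \<in> L2 (lebesgue_on \<Omega>)"
    and "AE x in lebesgue_on \<Omega>. q x \<in> dev_matrices"
  shows "averaged \<Omega> \<T> q x \<in> dev_matrices"
proof -
  have "(\<lambda>q. transpose q - q) (averaged \<Omega> \<T> q x) = 0"
  proof (rule averaged_in_kernel[OF assms(1-3)])
    show "bounded_linear (\<lambda>q :: real^'n^'n. transpose q - q)"
      by (intro bounded_linear_sub transpose_linear bounded_linear_ident)
    show "AE x in lebesgue_on \<Omega>. transpose (q x) - q x = 0"
      using assms(4) by eventually_elim (simp add: dev_matrices_def sym_matrices_iff)
  qed
  moreover have "trace (averaged \<Omega> \<T> q x) = 0"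
  proof (rule averaged_in_kernel[OF assms(1-3)])
    show "bounded_linear (trace :: real^'n^'n \<Rightarrow> real)"
      by (rule linear_conv_bounded_linear[THEN iffD1], rule linearI)
        (simp_all add: trace_def sum.distrib sum_distrib_left)
    show "AE x in lebesgue_on \<Omega>. trace (q x) = 0"
      using assms(4) by eventually_elim (simp add: dev_matrices_def)
  qed
  ultimately show ?thesis by (simp add: dev_matrices_def sym_matrices_iff)
qed

context
  fixes P :: "'n::finite problem"
  assumes valid: "valid_problem P"
begin

lemma open_dom: "open (dom P)" and elast_linear: "linear (elast P)" and harden_linear: "linear (harden P)"
  and hmod_pos: "0 < hmod P" and yield_pos: "0 < yield P"
  using valid by (auto simp: valid_problem_def symmetric_tensor_def)

lemma law_linear: "linear (law P)"
  using linear_add[OF elast_linear] linear_add[OF harden_linear] linear_cmul[OF elast_linear] linear_cmul[OF harden_linear]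
  by (intro linearI) (simp_all add: law_def distrib_left)

lemma law_symmetric:
  assumes "s \<in> sym_strains" "t \<in> sym_strains"
  shows "law P s \<bullet> t = law P t \<bullet> s"
proof -
  have "symmetric_tensor (elast P)" "symmetric_tensor (harden P)" using valid by (auto simp: valid_problem_def)
  then have "elast P (fst s) \<bullet> fst t = fst s \<bullet> elast P (fst t)"
    "harden P (fst (snd s)) \<bullet> fst (snd t) = fst (snd s) \<bullet> harden P (fst (snd t))"
    using assms unfolding symmetric_tensor_def sym_strains_def by auto
  then show ?thesis by (simp add: law_def inner_prod_def inner_commute)
qed

lemma law_gstrain_L2:
  assumes "z \<in> space_X P"
  shows "(\<lambda>x. law P (gstrain P z x)) \<in> L2 (lebesgue_on (dom P))"
  using L2_bounded_linear_image[OF linear_conv_bounded_linear[THEN iffD1, OF law_linear] gstrain_L2[OF assms]] .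

lemma err_square:
  "(err P z y)\<^sup>2 = (LINT x|lebesgue_on (dom P). (norm (elast P (fst (gstrain P z x - gstrain P y x))))\<^sup>2)"
proof -
  have "err P z y = l2_norm (lebesgue_on (dom P)) (\<lambda>x. elast P (fst (gstrain P z x - gstrain P y x)))"
    by (simp add: err_def stress_def gstrain_def split_def linear_diff[OF elast_linear])
  then show ?thesis by (simp add: l2_norm_def)
qed

lemma coercive_tensors:
  obtains k h where "0 < k" "\<And>\<tau>. \<tau> \<in> sym_matrices \<Longrightarrow> k * (norm \<tau>)\<^sup>2 \<le> elast P \<tau> \<bullet> \<tau>"
    and "0 < h" "\<And>\<tau>. \<tau> \<in> sym_matrices \<Longrightarrow> h * (norm \<tau>)\<^sup>2 \<le> harden P \<tau> \<bullet> \<tau>"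
  using valid unfolding valid_problem_def coercive_tensor_def by blast

text \<open>The stress is bounded by the elastic strain, so coercivity of the elasticity tensor
  also controls the squared stress; hardening contributes nonnegative terms.\<close>

lemma law_coercive:
  obtains c where "0 < c" "\<And>s. s \<in> sym_strains \<Longrightarrow> c * (norm (elast P (fst s)))\<^sup>2 \<le> law P s \<bullet> s"
proof -
  obtain k h where k: "0 < k" "\<And>\<tau>. \<tau> \<in> sym_matrices \<Longrightarrow> k * (norm \<tau>)\<^sup>2 \<le> elast P \<tau> \<bullet> \<tau>"
    and h: "0 < h" "\<And>\<tau>. \<tau> \<in> sym_matrices \<Longrightarrow> h * (norm \<tau>)\<^sup>2 \<le> harden P \<tau> \<bullet> \<tau>"
    using coercive_tensors by blast
  obtain B where B: "0 < B" "\<And>\<tau>. norm (elast P \<tau>) \<le> B * norm \<tau>"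
    using linear_bounded_pos[OF elast_linear] by blast
  show ?thesis
  proof (rule that[of "k / B\<^sup>2"])
    show "0 < k / B\<^sup>2" using k(1) B(1) by simp
    fix s :: "(real^'n^'n) \<times> (real^'n^'n) \<times> real"
    assume s: "s \<in> sym_strains"
    then have f: "fst s \<in> sym_matrices" "fst (snd s) \<in> sym_matrices" by (auto simp: sym_strains_def)
    have "(norm (elast P (fst s)))\<^sup>2 \<le> (B * norm (fst s))\<^sup>2" by (rule power_mono[OF B(2) norm_ge_zero])
    then have "k / B\<^sup>2 * (norm (elast P (fst s)))\<^sup>2 \<le> k / B\<^sup>2 * (B\<^sup>2 * (norm (fst s))\<^sup>2)"
      using k(1) by (intro mult_left_mono) (simp_all add: power_mult_distrib)
    also have "\<dots> = k * (norm (fst s))\<^sup>2" using B(1) by simp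
    also have "\<dots> \<le> elast P (fst s) \<bullet> fst s" by (rule k(2)[OF f(1)])
    also have "\<dots> \<le> law P s \<bullet> s"
    proof -
      have "0 \<le> h * (norm (fst (snd s)))\<^sup>2" using h(1) by simp
      also have "\<dots> \<le> harden P (fst (snd s)) \<bullet> fst (snd s)" by (rule h(2)[OF f(2)])
      finally have "0 \<le> harden P (fst (snd s)) \<bullet> fst (snd s)" .
      moreover have "0 \<le> hmod P * snd (snd s) * snd (snd s)" using hmod_pos by (simp add: mult.assoc)
      ultimately show ?thesis by (simp add: law_def inner_prod_def)
    qed
    finally show "k / B\<^sup>2 * (norm (elast P (fst s)))\<^sup>2 \<le> law P s \<bullet> s" .
  qed
qed

text \<open>The left-hand side is what the variational inequalities leave of the energy difference.
  With \<open>d\<close> the difference of the stresses, \<open>\<tau>\<close> and \<open>e\<close> those of the elastic and plastic strains and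
  \<open>\<delta>\<close> that of the hardening variables, it equals \<open>d \<bullet> \<tau> / 2 + d \<bullet> e - harden e \<bullet> e / 2 - hmod \<delta>\<^sup>2
  / 2\<close>. Young's inequality, weighted with the coercivity constants, absorbs \<open>e\<close> into the
  hardening term and bounds \<open>\<tau>\<close> by \<open>d\<close>.\<close>

lemma energy_integrand_bound:
  obtains K where "0 < K"
    "\<And>s t. s \<in> sym_strains \<Longrightarrow> t \<in> sym_strains \<Longrightarrow>
      (law P s \<bullet> s - law P t \<bullet> t) / 2
       - elast P (fst t) \<bullet> (fst s + fst (snd s) - fst t - fst (snd t))
       + ((harden P (fst (snd s)) - elast P (fst s)) \<bullet> (fst (snd t) - fst (snd s))
          + hmod P * snd (snd s) * (snd (snd t) - snd (snd s)))
      \<le> K * (norm (elast P (fst (s - t))))\<^sup>2"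
proof -
  obtain k h where k: "0 < k" "\<And>\<tau>. \<tau> \<in> sym_matrices \<Longrightarrow> k * (norm \<tau>)\<^sup>2 \<le> elast P \<tau> \<bullet> \<tau>"
    and h: "0 < h" "\<And>\<tau>. \<tau> \<in> sym_matrices \<Longrightarrow> h * (norm \<tau>)\<^sup>2 \<le> harden P \<tau> \<bullet> \<tau>"
    using coercive_tensors by blast
  have sym: "symmetric_tensor (elast P)" "symmetric_tensor (harden P)" using valid by (auto simp: valid_problem_def)
  note le = linear_diff[OF elast_linear] and lh = linear_diff[OF harden_linear]
  show ?thesis
  proof (rule that[of "1 / (2 * k) + 1 / (2 * h)"])
    show "0 < 1 / (2 * k) + 1 / (2 * h)" using k(1) h(1) by (simp add: add_pos_pos)
    fix s t :: "(real^'n^'n) \<times> (real^'n^'n) \<times> real"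
    assume "s \<in> sym_strains" "t \<in> sym_strains"
    moreover obtain a p \<alpha> where s: "s = (a, p, \<alpha>)" by (cases s)
    moreover obtain b q \<beta> where t: "t = (b, q, \<beta>)" by (cases t)
    ultimately have m: "a \<in> sym_matrices" "p \<in> sym_matrices" "b \<in> sym_matrices" "q \<in> sym_matrices"
      by (auto simp: sym_strains_def)
    have c: "elast P b \<bullet> a = elast P a \<bullet> b" "harden P q \<bullet> p = harden P p \<bullet> q"
      using sym m unfolding symmetric_tensor_def by (simp_all add: inner_commute)
    let ?d = "elast P (a - b)" and ?e = "p - q"
    have "(law P s \<bullet> s - law P t \<bullet> t) / 2
       - elast P (fst t) \<bullet> (fst s + fst (snd s) - fst t - fst (snd t))
       + ((harden P (fst (snd s)) - elast P (fst s)) \<bullet> (fst (snd t) - fst (snd s))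
          + hmod P * snd (snd s) * (snd (snd t) - snd (snd s)))
      = ?d \<bullet> (a - b) / 2 + ?d \<bullet> ?e - harden P ?e \<bullet> ?e / 2 - hmod P * (\<alpha> - \<beta>)\<^sup>2 / 2"
      by (simp add: s t law_def le lh inner_diff_left inner_diff_right inner_add_right c power2_eq_square field_simps)
    also have "\<dots> \<le> (norm ?d)\<^sup>2 / (2 * k) + (norm ?d)\<^sup>2 / (2 * h)"
    proof -
      have "k * (norm (a - b))\<^sup>2 \<le> ?d \<bullet> (a - b)" by (rule k(2)[OF sym_matrices_diff[OF m(1,3)]])
      moreover have "?d \<bullet> (a - b) \<le> (norm ?d)\<^sup>2 / (2 * k) + k * (norm (a - b))\<^sup>2 / 2"
        by (rule inner_le_norm_squared[OF k(1)])
      ultimately have 1: "?d \<bullet> (a - b) / 2 \<le> (norm ?d)\<^sup>2 / (2 * k)" by simp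
      have "h * (norm ?e)\<^sup>2 \<le> harden P ?e \<bullet> ?e" by (rule h(2)[OF sym_matrices_diff[OF m(2,4)]])
      moreover have "?d \<bullet> ?e \<le> (norm ?d)\<^sup>2 / (2 * h) + h * (norm ?e)\<^sup>2 / 2"
        by (rule inner_le_norm_squared[OF h(1)])
      moreover have "0 \<le> hmod P * (\<alpha> - \<beta>)\<^sup>2 / 2" using hmod_pos by simp
      ultimately show ?thesis using 1 by linarith
    qed
    finally show "(law P s \<bullet> s - law P t \<bullet> t) / 2
       - elast P (fst t) \<bullet> (fst s + fst (snd s) - fst t - fst (snd t))
       + ((harden P (fst (snd s)) - elast P (fst s)) \<bullet> (fst (snd t) - fst (snd s))
          + hmod P * snd (snd s) * (snd (snd t) - snd (snd s)))
      \<le> (1 / (2 * k) + 1 / (2 * h)) * (norm (elast P (fst (s - t))))\<^sup>2"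
      by (simp add: s t distrib_right)
  qed
qed

context
  assumes \<Omega>: "dom P \<in> lmeasurable"
begin

lemma finite_measure_dom: "finite_measure (lebesgue_on (dom P))"
  by (rule finite_measure_lebesgue_on[OF \<Omega>])

lemma form_psi_admissible:
  assumes "z \<in> space_X P" "admissible P z"
  shows "form_psi P z = ereal (psi_real P (fst (snd z)))"
proof -
  obtain v q \<beta> where z: "z = (v, q, \<beta>)" by (cases z)
  note D = space_XD[OF assms(1)[unfolded z]]
  have "AE x in lebesgue_on (dom P). norm (q x) \<le> \<beta> x" using assms(2) by (simp add: admissible_def z)
  then have "AE x in lebesgue_on (dom P). dissip P (q x) (\<beta> x) = ennreal (yield P * norm (q x))"
    by eventually_elim (simp add: dissip_def)
  then have "(\<integral>\<^sup>+ x. dissip P (q x) (\<beta> x) \<partial>lebesgue_on (dom P)) = (\<integral>\<^sup>+ x. ennreal (yield P * norm (q x)) \<partial>lebesgue_on (dom P))"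
    by (rule nn_integral_cong_AE)
  also have "\<dots> = ennreal (LINT x|lebesgue_on (dom P). yield P * norm (q x))"
    using L2_integrable[OF finite_measure_dom D(3)] yield_pos by (intro nn_integral_eq_integral) auto
  also have "(LINT x|lebesgue_on (dom P). yield P * norm (q x)) = psi_real P q"
    by (simp add: psi_real_def)
  finally show ?thesis
    using yield_pos by (simp add: form_psi_def z psi_real_def enn2ereal_ennreal)
qed

text \<open>The strain of a difference is the difference of the strains only almost everywhere,
  since \<open>grad\<close> is a chosen representative.\<close>

lemma form_a_state_diff:
  assumes "z \<in> space_X P" "y \<in> space_X P"
  shows "form_a P y (state_diff z y) = (LINT x|lebesgue_on (dom P). law P (gstrain P y x) \<bullet> (gstrain P z x - gstrain P y x))"
proof -
  obtain v q \<beta> where z: "z = (v, q, \<beta>)" by (cases z)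
  obtain w p \<alpha> where y: "y = (w, p, \<alpha>)" by (cases y)
  note D = space_XD[OF assms(1)[unfolded z]] and D' = space_XD[OF assms(2)[unfolded y]]
  let ?M = "lebesgue_on (dom P)"
  let ?vw = "\<lambda>x. v x - w x" and ?qp = "\<lambda>x. q x - p x" and ?ba = "\<lambda>x. \<beta> x - \<alpha> x"
  have vw: "?vw \<in> H1 (dom P)" by (rule H1_diff[OF \<Omega> D(2) D'(2)])
  have s: "stress P w p \<in> L2 ?M"
    unfolding stress_def[abs_def]
    by (rule L2_bounded_linear_image[OF linear_conv_bounded_linear[THEN iffD1, OF elast_linear] L2_diff[OF strain_L2[OF D'(2)] D'(3)]])
  have h: "(\<lambda>x. harden P (p x)) \<in> L2 ?M"
    by (rule L2_bounded_linear_image[OF linear_conv_bounded_linear[THEN iffD1, OF harden_linear] D'(3)])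
  have a: "(\<lambda>x. hmod P * \<alpha> x) \<in> L2 ?M"
    by (rule L2_bounded_linear_image[OF bounded_linear_mult_right D'(4)])
  have i: "integrable ?M (\<lambda>x. stress P w p x \<bullet> (strain (dom P) ?vw x - ?qp x))"
    "integrable ?M (\<lambda>x. harden P (p x) \<bullet> ?qp x)" "integrable ?M (\<lambda>x. (hmod P * \<alpha> x) \<bullet> ?ba x)"
    by (intro L2_inner_integrable L2_diff s h a strain_L2 vw D D')+
  have "form_a P y (state_diff z y) =
      (LINT x|?M. stress P w p x \<bullet> (strain (dom P) ?vw x - ?qp x) + harden P (p x) \<bullet> ?qp x + (hmod P * \<alpha> x) \<bullet> ?ba x)"
    using i by (simp add: y z form_a_def state_diff_def l2_inner_def)
  also have "\<dots> = (LINT x|?M. law P (gstrain P y x) \<bullet> (gstrain P z x - gstrain P y x))"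
  proof (rule integral_cong_AE)
    show "(\<lambda>x. stress P w p x \<bullet> (strain (dom P) ?vw x - ?qp x) + harden P (p x) \<bullet> ?qp x + (hmod P * \<alpha> x) \<bullet> ?ba x)
        \<in> borel_measurable ?M"
      using i by (intro borel_measurable_add borel_measurable_integrable)
    show "(\<lambda>x. law P (gstrain P y x) \<bullet> (gstrain P z x - gstrain P y x)) \<in> borel_measurable ?M"
      by (intro borel_measurable_integrable L2_inner_integrable L2_diff law_gstrain_L2 gstrain_L2 assms)
    show "AE x in ?M. stress P w p x \<bullet> (strain (dom P) ?vw x - ?qp x) + harden P (p x) \<bullet> ?qp x + (hmod P * \<alpha> x) \<bullet> ?ba x
        = law P (gstrain P y x) \<bullet> (gstrain P z x - gstrain P y x)"
      using strain_diff_AE[OF open_dom \<Omega> D(2) D'(2)]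
    proof eventually_elim
      case (elim x)
      show ?case unfolding elim by (simp add: y z gstrain_def law_def stress_def algebra_simps)
    qed
  qed
  finally show ?thesis .
qed

text \<open>Otherwise the inequality would fail when it is tested with the zero state.\<close>

lemma solves_vi_admissible:
  assumes "solves_vi P Y y" "Y \<subseteq> space_X P" "(\<lambda>x. 0, \<lambda>x. 0, \<lambda>x. 0) \<in> Y"
  shows "admissible P y"
proof (rule admissible_of_form_psi)
  show y: "y \<in> space_X P" using assms by (auto simp: solves_vi_def)
  show "form_psi P y \<noteq> \<infinity>"
  proof
    assume inf: "form_psi P y = \<infinity>"
    let ?z0 = "(\<lambda>x. 0, \<lambda>x. 0, \<lambda>x. 0) :: 'n state"
    have "form_psi P ?z0 = ereal (psi_real P (fst (snd ?z0)))"
      using assms by (intro form_psi_admissible) (auto simp: admissible_def)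
    moreover have "ereal (form_b P (state_diff ?z0 y)) \<le> ereal (form_a P y (state_diff ?z0 y)) + form_psi P ?z0 - form_psi P y"
      using assms(1,3) unfolding solves_vi_def by blast
    ultimately show False using inf by simp
  qed
qed

lemma variational_inequality:
  assumes "solves_vi P Y y" "Y \<subseteq> space_X P" "(\<lambda>x. 0, \<lambda>x. 0, \<lambda>x. 0) \<in> Y"
    and z: "z \<in> Y" "admissible P z"
  shows "form_b P z - form_b P y \<le>
    (LINT x|lebesgue_on (dom P). law P (gstrain P y x) \<bullet> (gstrain P z x - gstrain P y x))
    + psi_real P (fst (snd z)) - psi_real P (fst (snd y))"
proof -
  have y: "y \<in> space_X P" and zX: "z \<in> space_X P" using assms by (auto simp: solves_vi_def)
  have "form_b P (state_diff z y) = form_b P z - form_b P y"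
  proof -
    obtain v q \<beta> where z: "z = (v, q, \<beta>)" by (cases z)
    obtain w p \<alpha> where y': "y = (w, p, \<alpha>)" by (cases y)
    show ?thesis unfolding z y' state_diff_def prod.case
      by (rule form_b_diff[OF valid \<Omega> space_XD(1)[OF zX[unfolded z]] space_XD(1)[OF y[unfolded y']]])
  qed
  moreover have "ereal (form_b P (state_diff z y)) \<le> ereal (form_a P y (state_diff z y)) + form_psi P z - form_psi P y"
    using assms(1) z(1) unfolding solves_vi_def by blast
  ultimately show ?thesis
    by (simp add: form_psi_admissible[OF zX z(2)] form_psi_admissible[OF y solves_vi_admissible[OF assms(1-3)]]
        form_a_state_diff[OF zX y])
qed

text \<open>Completing the square: the quadratic part of the energy of \<open>z\<close> is its first order
  expansion at \<open>y\<close> plus the quadratic form of the difference, and the variational inequality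
  says that all remaining terms together are nonnegative.\<close>

lemma energy_gap:
  assumes "solves_vi P Y y" "Y \<subseteq> space_X P" "(\<lambda>x. 0, \<lambda>x. 0, \<lambda>x. 0) \<in> Y"
    and z: "z \<in> Y" "admissible P z"
  shows "(LINT x|lebesgue_on (dom P). law P (gstrain P z x - gstrain P y x) \<bullet> (gstrain P z x - gstrain P y x)) / 2
    \<le> energy P z - energy P y"
proof -
  let ?M = "lebesgue_on (dom P)" and ?s = "gstrain P z" and ?t = "gstrain P y"
  have y: "y \<in> space_X P" and zX: "z \<in> space_X P" using assms by (auto simp: solves_vi_def)
  have i: "integrable ?M (\<lambda>x. law P (?s x) \<bullet> ?s x)" "integrable ?M (\<lambda>x. law P (?t x) \<bullet> ?t x)"
    "integrable ?M (\<lambda>x. law P (?t x) \<bullet> (?s x - ?t x))"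
    by (intro L2_inner_integrable L2_diff law_gstrain_L2 gstrain_L2 y zX)+
  have i': "integrable ?M (\<lambda>x. law P (?s x - ?t x) \<bullet> (?s x - ?t x))"
    by (intro L2_inner_integrable L2_diff L2_bounded_linear_image[OF linear_conv_bounded_linear[THEN iffD1, OF law_linear]]
        gstrain_L2 y zX)
  have "(LINT x|?M. law P (?s x - ?t x) \<bullet> (?s x - ?t x))
      = (LINT x|?M. law P (?s x) \<bullet> ?s x - law P (?t x) \<bullet> ?t x - 2 * (law P (?t x) \<bullet> (?s x - ?t x)))"
  proof (rule integral_cong_AE)
    show "AE x in ?M. law P (?s x - ?t x) \<bullet> (?s x - ?t x)
        = law P (?s x) \<bullet> ?s x - law P (?t x) \<bullet> ?t x - 2 * (law P (?t x) \<bullet> (?s x - ?t x))"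
      using gstrain_sym_AE[OF zX] gstrain_sym_AE[OF y]
    proof eventually_elim
      case (elim x)
      show ?case using law_symmetric[OF elim]
        by (simp add: linear_diff[OF law_linear] inner_diff_left inner_diff_right)
    qed
  qed (use i i' in \<open>auto intro!: borel_measurable_diff borel_measurable_times borel_measurable_integrable\<close>)
  also have "\<dots> = (LINT x|?M. law P (?s x) \<bullet> ?s x) - (LINT x|?M. law P (?t x) \<bullet> ?t x)
      - 2 * (LINT x|?M. law P (?t x) \<bullet> (?s x - ?t x))"
    using i by simp
  finally show ?thesis
    using variational_inequality[OF assms] by (simp add: energy_def)
qed

lemma err_le_energy_gap:
  obtains c where "0 < c"
    "\<And>Y y z. solves_vi P Y y \<Longrightarrow> Y \<subseteq> space_X P \<Longrightarrow> (\<lambda>x. 0, \<lambda>x. 0, \<lambda>x. 0) \<in> Y \<Longrightarrow> z \<in> Y \<Longrightarrow> admissible P z \<Longrightarrow>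
      c * (err P z y)\<^sup>2 \<le> energy P z - energy P y"
proof -
  obtain c where c: "0 < c" "\<And>s. s \<in> sym_strains \<Longrightarrow> c * (norm (elast P (fst s)))\<^sup>2 \<le> law P s \<bullet> s"
    using law_coercive by blast
  show ?thesis
  proof (rule that[of "c / 2"])
    show "0 < c / 2" using c(1) by simp
    fix Y y z
    assume a: "solves_vi P Y y" "Y \<subseteq> space_X P" "(\<lambda>x. 0, \<lambda>x. 0, \<lambda>x. 0) \<in> Y" "z \<in> Y" "admissible P z"
    let ?M = "lebesgue_on (dom P)" and ?d = "\<lambda>x. gstrain P z x - gstrain P y x"
    have y: "y \<in> space_X P" and zX: "z \<in> space_X P" using a by (auto simp: solves_vi_def)
    have d: "?d \<in> L2 ?M" by (intro L2_diff gstrain_L2 y zX)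
    have "bounded_linear (\<lambda>s. elast P (fst s))"
      using bounded_linear_compose[OF linear_conv_bounded_linear[THEN iffD1, OF elast_linear] bounded_linear_fst] .
    from L2_bounded_linear_image[OF this d]
    have i: "integrable ?M (\<lambda>x. c * (norm (elast P (fst (?d x))))\<^sup>2)" by (simp add: L2_square_integrable)
    have i': "integrable ?M (\<lambda>x. law P (?d x) \<bullet> ?d x)"
      by (intro L2_inner_integrable L2_bounded_linear_image[OF linear_conv_bounded_linear[THEN iffD1, OF law_linear]] d)
    have "c * (err P z y)\<^sup>2 = (LINT x|?M. c * (norm (elast P (fst (?d x))))\<^sup>2)"
      unfolding err_square by simp
    also have "\<dots> \<le> (LINT x|?M. law P (?d x) \<bullet> ?d x)"
    proof (rule integral_mono_AE[OF i i'])
      show "AE x in ?M. c * (norm (elast P (fst (?d x))))\<^sup>2 \<le> law P (?d x) \<bullet> ?d x"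
        using gstrain_sym_AE[OF zX] gstrain_sym_AE[OF y]
        by eventually_elim (rule c(2)[OF sym_strains_diff])
    qed
    finally show "c / 2 * (err P z y)\<^sup>2 \<le> energy P z - energy P y"
      using energy_gap[OF a] by simp
  qed
qed

section \<open>Energy of discrete solutions\<close>

lemma averaged_state:
  assumes mesh: "is_mesh (dom P) \<T>" and "(v, q', \<beta>') \<in> discrete_X P \<T>"
    and u: "(w, q, \<beta>) \<in> space_X P" "admissible P (w, q, \<beta>)"
  shows "(v, averaged (dom P) \<T> q, averaged (dom P) \<T> \<beta>) \<in> discrete_X P \<T>"
    and "admissible P (v, averaged (dom P) \<T> q, averaged (dom P) \<T> \<beta>)"
    and "psi_real P (averaged (dom P) \<T> q) \<le> psi_real P q"
proof -
  note D = space_XD[OF u(1)]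
  have "averaged (dom P) \<T> q \<in> space_Q P"
    unfolding space_Q_def using averaged_L2[OF mesh \<Omega>, of q] averaged_dev_matrices[OF mesh \<Omega> D(3,5)] by blast
  moreover have "averaged (dom P) \<T> \<beta> \<in> space_M P"
    unfolding space_M_def by (rule averaged_L2[OF mesh \<Omega>])
  moreover have "\<forall>T\<in>\<T>. \<exists>c. AE x in lebesgue_on (body T \<inter> dom P). averaged (dom P) \<T> q x = c"
    "\<forall>T\<in>\<T>. \<exists>c. AE x in lebesgue_on (body T \<inter> dom P). averaged (dom P) \<T> \<beta> x = c"
    using averaged_AE[OF mesh \<Omega>, of _ q] averaged_AE[OF mesh \<Omega>, of _ \<beta>] by meson+
  ultimately show "(v, averaged (dom P) \<T> q, averaged (dom P) \<T> \<beta>) \<in> discrete_X P \<T>"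
    using assms(2) by (simp add: discrete_X_def)
  show "admissible P (v, averaged (dom P) \<T> q, averaged (dom P) \<T> \<beta>)"
    unfolding admissible_def prod.case
    using norm_averaged_le[OF mesh \<Omega> D(3,4)] u(2) by (simp add: admissible_def)
  show "psi_real P (averaged (dom P) \<T> q) \<le> psi_real P q"
    unfolding psi_real_def using yield_pos
    by (intro mult_left_mono integral_norm_averaged_le[OF mesh \<Omega> D(3)]) simp
qed

lemma strain_piecewise_constant:
  assumes "(v, q, \<beta>) \<in> discrete_X P \<T>" "T \<in> \<T>"
  shows "\<exists>c. AE x in lebesgue_on (body T \<inter> dom P). strain (dom P) v x = c"
proof -
  obtain A c where "AE x in lebesgue_on (body T \<inter> dom P). v x = A *v x + c"
    using assms unfolding discrete_X_def by blast
  moreover have "v \<in> H1 (dom P)" using assms(1) by (auto simp: discrete_X_def space_V_H1)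
  ultimately have "AE x in lebesgue_on (body T \<inter> dom P). grad (dom P) v x = A"
    using open_dom \<Omega> body_sets by (intro grad_affine_AE) (auto simp: body_def)
  then have "AE x in lebesgue_on (body T \<inter> dom P). strain (dom P) v x = (1/2) *\<^sub>R (A + transpose A)"
    by eventually_elim (simp add: strain_def)
  then show ?thesis by blast
qed

text \<open>The variational inequality gives this estimate for the cell averages of \<open>q\<close> and \<open>\<beta>\<close>; since
  the factors in front of them are piecewise constant, orthogonality turns the averages into \<open>q\<close>
  and \<open>\<beta>\<close>.\<close>

lemma discrete_flow_rule:
  assumes mesh: "is_mesh (dom P) \<T>"
    and vi: "solves_vi P (discrete_X P \<T>) (w, p, \<alpha>)"
    and u: "(v, q, \<beta>) \<in> space_X P" "admissible P (v, q, \<beta>)"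
  shows "psi_real P p \<le> psi_real P q + (LINT x|lebesgue_on (dom P).
      (harden P (p x) - elast P (strain (dom P) w x - p x)) \<bullet> (q x - p x) + hmod P * \<alpha> x * (\<beta> x - \<alpha> x))"
proof -
  let ?M = "lebesgue_on (dom P)"
  define S where "S x = harden P (p x) - elast P (strain (dom P) w x - p x)" for x
  let ?q = "averaged (dom P) \<T> q" and ?\<beta> = "averaged (dom P) \<T> \<beta>"
  have W: "(w, p, \<alpha>) \<in> discrete_X P \<T>" using vi by (simp add: solves_vi_def)
  note z = averaged_state[OF mesh W u]
  have WX: "(w, p, \<alpha>) \<in> space_X P" using W discrete_X_subset by blast
  note D = space_XD[OF WX] and D' = space_XD[OF u(1)]
  note be = linear_conv_bounded_linear[THEN iffD1, OF elast_linear]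
    and bh = linear_conv_bounded_linear[THEN iffD1, OF harden_linear]
  have S: "S \<in> L2 ?M"
    unfolding S_def[abs_def]
    by (intro L2_diff L2_bounded_linear_image[OF bh] L2_bounded_linear_image[OF be] strain_L2 D)
  have A: "(\<lambda>x. hmod P * \<alpha> x) \<in> L2 ?M"
    by (rule L2_bounded_linear_image[OF bounded_linear_mult_right D(4)])
  note ph = D(3) D(4) D'(3) D'(4) averaged_L2[OF mesh \<Omega>, of q] averaged_L2[OF mesh \<Omega>, of \<beta>]
  have const: "\<exists>c. AE x in lebesgue_on (body T \<inter> dom P). S x = c"
    "\<exists>c. AE x in lebesgue_on (body T \<inter> dom P). hmod P * \<alpha> x = c" if T: "T \<in> \<T>" for T
  proof -
    obtain a b c where abc: "AE x in lebesgue_on (body T \<inter> dom P). strain (dom P) w x = a"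
        "AE x in lebesgue_on (body T \<inter> dom P). p x = b" "AE x in lebesgue_on (body T \<inter> dom P). \<alpha> x = c"
      using strain_piecewise_constant[OF W T] W T unfolding discrete_X_def by blast
    have "AE x in lebesgue_on (body T \<inter> dom P). S x = harden P b - elast P (a - b)"
      using abc(1,2) by eventually_elim (simp add: S_def)
    then show "\<exists>c. AE x in lebesgue_on (body T \<inter> dom P). S x = c" by blast
    have "AE x in lebesgue_on (body T \<inter> dom P). hmod P * \<alpha> x = hmod P * c"
      using abc(3) by eventually_elim simp
    then show "\<exists>c. AE x in lebesgue_on (body T \<inter> dom P). hmod P * \<alpha> x = c" by blast
  qed
  have "0 \<le> (LINT x|?M. law P (gstrain P (w, p, \<alpha>) x) \<bullet> (gstrain P (w, ?q, ?\<beta>) x - gstrain P (w, p, \<alpha>) x))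
      + psi_real P ?q - psi_real P p"
    using variational_inequality[OF vi discrete_X_subset zero_discrete_X z(1,2)]
    by (simp add: form_b_def)
  also have "(LINT x|?M. law P (gstrain P (w, p, \<alpha>) x) \<bullet> (gstrain P (w, ?q, ?\<beta>) x - gstrain P (w, p, \<alpha>) x))
      = (LINT x|?M. S x \<bullet> ?q x - S x \<bullet> p x + (hmod P * \<alpha> x) \<bullet> ?\<beta> x - (hmod P * \<alpha> x) \<bullet> \<alpha> x)"
    by (rule arg_cong[where f = "integral\<^sup>L ?M"])
      (simp add: fun_eq_iff law_def gstrain_def S_def inner_diff_left inner_diff_right algebra_simps)
  also have "\<dots> = (LINT x|?M. S x \<bullet> q x - S x \<bullet> p x + (hmod P * \<alpha> x) \<bullet> \<beta> x - (hmod P * \<alpha> x) \<bullet> \<alpha> x)"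
    using averaged_orthogonal[OF mesh \<Omega> S ph(3) const(1)] averaged_orthogonal[OF mesh \<Omega> A ph(4) const(2)]
      L2_inner_integrable[OF S ph(1)] L2_inner_integrable[OF S ph(3)] L2_inner_integrable[OF S ph(5)]
      L2_inner_integrable[OF A ph(2)] L2_inner_integrable[OF A ph(4)] L2_inner_integrable[OF A ph(6)]
    by (simp del: inner_real_def)
  also have "\<dots> = (LINT x|?M. S x \<bullet> (q x - p x) + hmod P * \<alpha> x * (\<beta> x - \<alpha> x))"
    by (rule arg_cong[where f = "integral\<^sup>L ?M"]) (simp add: fun_eq_iff inner_diff_right algebra_simps)
  finally show ?thesis using z(3) unfolding S_def by simp
qed

text \<open>The displacement \<open>v\<close> is unconstrained in \<open>V\<close>. Testing with \<open>v - (w - v)\<close> reverses the sign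
  in the inequality that \<open>w\<close> itself would give.\<close>

lemma equilibrium:
  assumes vi: "solves_vi P (space_X P) (v, q, \<beta>)" and w: "w \<in> space_V P"
  shows "(LINT x|lebesgue_on (dom P). elast P (strain (dom P) v x - q x) \<bullet> (strain (dom P) w x - strain (dom P) v x))
     \<le> form_b P (w, p, \<alpha>) - form_b P (v, q, \<beta>)"
proof -
  let ?M = "lebesgue_on (dom P)"
  have u: "(v, q, \<beta>) \<in> space_X P" using vi by (simp add: solves_vi_def)
  note D = space_XD[OF u] and op = open_dom
  have z0: "(\<lambda>x. 0, \<lambda>x. 0, \<lambda>x. 0) \<in> space_X P" using zero_discrete_X discrete_X_subset by blast
  \<comment> \<open>\<open>2 v - w\<close>, written with differences only because \<open>space_V_diff\<close> then applies\<close>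
  define v' where "v' = (\<lambda>x. v x - (w x - v x))"
  have wv: "(\<lambda>x. w x - v x) \<in> space_V P" by (rule space_V_diff[OF op \<Omega> w D(1)])
  have V: "v' \<in> space_V P" unfolding v'_def by (rule space_V_diff[OF op \<Omega> D(1) wv])
  then have zX: "(v', q, \<beta>) \<in> space_X P" using u by (simp add: space_X_def)
  have "admissible P (v, q, \<beta>)" by (rule solves_vi_admissible[OF vi order_refl z0])
  then have adm: "admissible P (v', q, \<beta>)" by (simp add: admissible_def)
  have "(LINT x|?M. law P (gstrain P (v, q, \<beta>) x) \<bullet> (gstrain P (v', q, \<beta>) x - gstrain P (v, q, \<beta>) x))
      = (LINT x|?M. - (elast P (strain (dom P) v x - q x) \<bullet> (strain (dom P) w x - strain (dom P) v x)))"
  proof (rule integral_cong_AE)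
    show "(\<lambda>x. law P (gstrain P (v, q, \<beta>) x) \<bullet> (gstrain P (v', q, \<beta>) x - gstrain P (v, q, \<beta>) x)) \<in> borel_measurable ?M"
      by (intro borel_measurable_integrable L2_inner_integrable L2_diff law_gstrain_L2 gstrain_L2 u zX)
    show "(\<lambda>x. - (elast P (strain (dom P) v x - q x) \<bullet> (strain (dom P) w x - strain (dom P) v x))) \<in> borel_measurable ?M"
      by (intro borel_measurable_uminus borel_measurable_integrable L2_inner_integrable L2_diff strain_L2 D space_V_H1[OF w]
          L2_bounded_linear_image[OF linear_conv_bounded_linear[THEN iffD1, OF elast_linear]])
    show "AE x in ?M. law P (gstrain P (v, q, \<beta>) x) \<bullet> (gstrain P (v', q, \<beta>) x - gstrain P (v, q, \<beta>) x)
        = - (elast P (strain (dom P) v x - q x) \<bullet> (strain (dom P) w x - strain (dom P) v x))"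
      using strain_diff_AE[OF op \<Omega> D(2) space_V_H1[OF wv], folded v'_def] strain_diff_AE[OF op \<Omega> space_V_H1[OF w] D(2)]
    proof eventually_elim
      case (elim x)
      show ?case by (simp add: gstrain_def law_def elim inner_diff_right)
    qed
  qed
  moreover have "form_b P (v', q, \<beta>) - form_b P (v, q, \<beta>) = - (form_b P (w, p, \<alpha>) - form_b P (v, q, \<beta>))"
    using form_b_diff[OF valid \<Omega> D(1) wv, of q \<beta> q \<beta> q \<beta>, folded v'_def] form_b_diff[OF valid \<Omega> w D(1), of q \<beta> p \<alpha> q \<beta>] by simp
  moreover have "form_b P (v', q, \<beta>) - form_b P (v, q, \<beta>) \<le>
      (LINT x|?M. law P (gstrain P (v, q, \<beta>) x) \<bullet> (gstrain P (v', q, \<beta>) x - gstrain P (v, q, \<beta>) x))"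
    using variational_inequality[OF vi order_refl z0 zX adm] by simp
  ultimately show ?thesis by simp
qed

text \<open>The flow rule of \<open>U\<close> bounds the difference of the dissipations and the equilibrium of \<open>u\<close>
  that of the loads. What remains is an integral with a pointwise bound by the squared stress
  error.\<close>

lemma energy_gap_le_err:
  obtains K where "0 < K"
    "\<And>\<T> U u. is_mesh (dom P) \<T> \<Longrightarrow> solves_vi P (discrete_X P \<T>) U \<Longrightarrow> solves_vi P (space_X P) u \<Longrightarrow>
      energy P U - energy P u \<le> K * (err P u U)\<^sup>2"
proof -
  obtain K where K: "0 < K"
    "\<And>s t. s \<in> sym_strains \<Longrightarrow> t \<in> sym_strains \<Longrightarrow>
      (law P s \<bullet> s - law P t \<bullet> t) / 2
       - elast P (fst t) \<bullet> (fst s + fst (snd s) - fst t - fst (snd t))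
       + ((harden P (fst (snd s)) - elast P (fst s)) \<bullet> (fst (snd t) - fst (snd s))
          + hmod P * snd (snd s) * (snd (snd t) - snd (snd s)))
      \<le> K * (norm (elast P (fst (s - t))))\<^sup>2"
    using energy_integrand_bound by metis
  show ?thesis
  proof (rule that[OF K(1)])
    fix \<T> U u
    assume mesh: "is_mesh (dom P) \<T>" and vU: "solves_vi P (discrete_X P \<T>) U" and vu: "solves_vi P (space_X P) u"
    obtain w p \<alpha> where U: "U = (w, p, \<alpha>)" by (cases U)
    obtain v q \<beta> where u: "u = (v, q, \<beta>)" by (cases u)
    let ?M = "lebesgue_on (dom P)" and ?\<epsilon> = "strain (dom P)"
    have uX: "u \<in> space_X P" and UX: "U \<in> space_X P"
      using vu vU discrete_X_subset unfolding solves_vi_def by blast+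
    note D = space_XD[OF uX[unfolded u]] and D' = space_XD[OF UX[unfolded U]]
    have z0: "(\<lambda>x. 0, \<lambda>x. 0, \<lambda>x. 0) \<in> space_X P" using zero_discrete_X discrete_X_subset by blast
    have adm: "admissible P u" by (rule solves_vi_admissible[OF vu order_refl z0])
    note be = linear_conv_bounded_linear[THEN iffD1, OF elast_linear]
      and bh = linear_conv_bounded_linear[THEN iffD1, OF harden_linear]
    let ?s = "gstrain P U" and ?t = "gstrain P u"
    let ?A = "\<lambda>x. law P (?s x) \<bullet> ?s x" and ?B = "\<lambda>x. law P (?t x) \<bullet> ?t x"
    let ?E = "\<lambda>x. elast P (?\<epsilon> v x - q x) \<bullet> (?\<epsilon> w x - ?\<epsilon> v x)"
    let ?F = "\<lambda>x. (harden P (p x) - elast P (?\<epsilon> w x - p x)) \<bullet> (q x - p x) + hmod P * \<alpha> x * (\<beta> x - \<alpha> x)"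
    let ?N = "\<lambda>x. K * (norm (elast P (fst (?s x - ?t x))))\<^sup>2"
    have iAB: "integrable ?M ?A" "integrable ?M ?B"
      by (intro L2_inner_integrable law_gstrain_L2 gstrain_L2 uX UX)+
    have iE: "integrable ?M ?E"
      by (intro L2_inner_integrable L2_diff strain_L2 D D' L2_bounded_linear_image[OF be])
    have A: "(\<lambda>x. hmod P * \<alpha> x) \<in> L2 ?M"
      by (rule L2_bounded_linear_image[OF bounded_linear_mult_right D'(4)])
    have iF: "integrable ?M ?F"
      using L2_inner_integrable[OF A L2_diff[OF D(4) D'(4)]]
      by (intro Bochner_Integration.integrable_add L2_inner_integrable L2_diff strain_L2 D D'
          L2_bounded_linear_image[OF be] L2_bounded_linear_image[OF bh]) simp
    have d: "(\<lambda>x. ?s x - ?t x) \<in> L2 ?M"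
      by (intro L2_diff gstrain_L2 uX UX)
    have iN: "integrable ?M ?N"
      using L2_square_integrable[OF L2_bounded_linear_image[OF bounded_linear_compose[OF be bounded_linear_fst] d]] by simp
    have "energy P U - energy P u = ((LINT x|?M. ?A x) - (LINT x|?M. ?B x)) / 2 + (psi_real P p - psi_real P q)
        - (form_b P U - form_b P u)"
      by (simp add: energy_def U u diff_divide_distrib)
    also have "\<dots> \<le> ((LINT x|?M. ?A x) - (LINT x|?M. ?B x)) / 2 + (LINT x|?M. ?F x) - (LINT x|?M. ?E x)"
      using discrete_flow_rule[OF mesh vU[unfolded U] uX[unfolded u] adm[unfolded u]]
        equilibrium[OF vu[unfolded u] D'(1), of p \<alpha>] unfolding U u by linarith
    also have "\<dots> = (LINT x|?M. (?A x - ?B x) / 2 - ?E x + ?F x)"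
      using iAB iE iF by simp
    also have "\<dots> \<le> (LINT x|?M. ?N x)"
    proof (rule integral_mono_AE)
      show "integrable ?M (\<lambda>x. (?A x - ?B x) / 2 - ?E x + ?F x)"
        using iAB iE by (intro Bochner_Integration.integrable_add[OF _ iF]) simp
      show "integrable ?M ?N" by (rule iN)
      show "AE x in ?M. (?A x - ?B x) / 2 - ?E x + ?F x \<le> ?N x"
        using gstrain_sym_AE[OF UX] gstrain_sym_AE[OF uX]
      proof eventually_elim
        case (elim x)
        have g: "fst (?s x) = ?\<epsilon> w x - p x" "fst (snd (?s x)) = p x" "snd (snd (?s x)) = \<alpha> x"
          "fst (?t x) = ?\<epsilon> v x - q x" "fst (snd (?t x)) = q x" "snd (snd (?t x)) = \<beta> x"
          by (simp_all add: U u gstrain_def)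
        have "?\<epsilon> w x - p x + p x - (?\<epsilon> v x - q x) - q x = ?\<epsilon> w x - ?\<epsilon> v x" by simp
        with K(2)[OF elim] show ?case unfolding g by simp
      qed
    qed
    also have "\<dots> = K * (err P u U)\<^sup>2"
      unfolding err_commute[of P u U] err_square by simp
    finally show "energy P U - energy P u \<le> K * (err P u U)\<^sup>2" .
  qed
qed

end

end

section \<open>Quasi-orthogonality\<close>

text \<open>With \<open>r = 1 - (1 - \<rho>2) \<theta>\<close>, any \<open>\<delta>\<close> with \<open>(1 + \<delta>) r < 1\<close> has a positive quotient; \<open>(1 - r) / 2\<close>
  is one. The quotients are bounded by \<open>1 / (Crel\<^sup>2 C2)\<close>, so that the supremum in \<open>eps3_star\<close> is a
  genuine one.\<close>

lemma eps3_star_pos: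
  assumes "0 < \<theta>" "0 < C1" "0 < \<rho>2" "\<rho>2 < 1" "0 < C2" "0 < Crel" "\<theta> \<le> 1"
  shows "0 < eps3_star C1 \<rho>2 C2 Crel \<theta>"
proof -
  define r where "r = 1 - (1 - \<rho>2) * \<theta>"
  let ?f = "\<lambda>\<delta>. (1 - (1 + \<delta>) * r) / (Crel\<^sup>2 * (C2 + (1 + inverse \<delta>) * C1\<^sup>2))"
  have "(1 - \<rho>2) * \<theta> \<le> 1 * 1" using assms by (intro mult_mono) auto
  then have r: "0 \<le> r" "r < 1" using assms by (auto simp: r_def)
  have den: "Crel\<^sup>2 * C2 \<le> Crel\<^sup>2 * (C2 + (1 + inverse \<delta>) * C1\<^sup>2)" if "0 < \<delta>" for \<delta>
    using that by (intro mult_left_mono) simp_all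
  have pos: "0 < Crel\<^sup>2 * C2" using assms by simp
  have den_pos: "0 < Crel\<^sup>2 * (C2 + (1 + inverse \<delta>) * C1\<^sup>2)" if "0 < \<delta>" for \<delta>
    using den[OF that] pos by (rule less_le_trans[rotated])
  have "bdd_above (?f ` {0<..})"
  proof (rule bdd_aboveI2)
    fix \<delta> :: real assume "\<delta> \<in> {0<..}"
    then have \<delta>: "0 < \<delta>" by simp
    then have "1 - (1 + \<delta>) * r \<le> 1" using r(1) by simp
    then have "?f \<delta> \<le> 1 / (Crel\<^sup>2 * (C2 + (1 + inverse \<delta>) * C1\<^sup>2))"
      by (rule divide_right_mono[OF _ less_imp_le[OF den_pos[OF \<delta>]]])
    also have "\<dots> \<le> 1 / (Crel\<^sup>2 * C2)"
      by (rule divide_left_mono[OF den[OF \<delta>] zero_le_one mult_pos_pos[OF den_pos[OF \<delta>] pos]])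
    finally show "?f \<delta> \<le> 1 / (Crel\<^sup>2 * C2)" .
  qed
  moreover have "0 < ?f ((1 - r) / 2)"
  proof (rule divide_pos_pos)
    have "(1 + (1 - r) / 2) * r = 1 - (1 - r) * (2 - r) / 2" by (simp add: field_simps)
    moreover have "0 < (1 - r) * (2 - r)" using r by (intro mult_pos_pos) simp_all
    ultimately show "0 < 1 - (1 + (1 - r) / 2) * r" by simp
    show "0 < Crel\<^sup>2 * (C2 + (1 + inverse ((1 - r) / 2)) * C1\<^sup>2)"
      using r by (intro den_pos) simp
  qed
  moreover have "(1 - r) / 2 \<in> {0<..}" using r by simp
  ultimately show ?thesis
    unfolding eps3_star_def r_def[symmetric] by (meson cSUP_upper less_le_trans)
qed

theorem lemma3:
  fixes P :: "'n::finite problem"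
    and u :: "'n state"
    and U :: "'n element set \<Rightarrow> 'n state"
    and \<T>0 :: "'n element set"
    and \<T> :: "nat \<Rightarrow> 'n element set"
    and \<theta> C1 \<rho>2 C2 Crel :: real
  assumes problem: "valid_problem P"
    and initial_mesh: "is_mesh (dom P) \<T>0"
    and shape_regular: "uniformly_shape_regular (refinements (dom P) \<T>0)"
    and solution: "solves_vi P (space_X P) u"
    and discrete_solution:
      "\<And>\<S>. \<S> \<in> refinements (dom P) \<T>0 \<Longrightarrow> solves_vi P (discrete_X P \<S>) (U \<S>)"
    and theta: "0 < \<theta>" "\<theta> \<le> 1"
    and meshes: "adaptive_meshes P \<theta> U \<T>0 \<T>"
    and constants: "0 < C1" "0 < \<rho>2" "\<rho>2 < 1" "0 < C2" "0 < Crel"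
    and A1: "\<And>\<S> \<S>' \<K> z z'.
      \<lbrakk>\<S> \<in> refinements (dom P) \<T>0; \<S>' \<in> refinements (dom P) \<S>; \<K> \<subseteq> \<S> \<inter> \<S>';
       z \<in> discrete_X P \<S>; z' \<in> discrete_X P \<S>'\<rbrakk> \<Longrightarrow>
      \<bar>sqrt (\<Sum>T \<in> \<K>. eta_sq P \<S>' z' T) - sqrt (\<Sum>T \<in> \<K>. eta_sq P \<S> z T)\<bar> \<le> C1 * err P z' z"
    and A2: "\<And>\<S> \<S>'.
      \<lbrakk>\<S> \<in> refinements (dom P) \<T>0; \<S>' \<in> refinements (dom P) \<S>\<rbrakk> \<Longrightarrow>
      (\<Sum>T \<in> \<S>' - \<S>. eta_sq P \<S>' (U \<S>') T)
        \<le> \<rho>2 * (\<Sum>T \<in> \<S> - \<S>'. eta_sq P \<S> (U \<S>) T) + C2 * (err P (U \<S>') (U \<S>))\<^sup>2"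
    and reliability: "\<And>\<S>. \<S> \<in> refinements (dom P) \<T>0 \<Longrightarrow> err P u (U \<S>) \<le> Crel * eta P \<S> (U \<S>)"
  shows "\<exists>\<epsilon>3 C3. 0 \<le> \<epsilon>3 \<and> \<epsilon>3 < eps3_star C1 \<rho>2 C2 Crel \<theta> \<and> 1 \<le> C3 \<and>
    (\<forall>l N. l \<le> N \<longrightarrow>
      (\<Sum>k = l..N. (err P (U (\<T> (Suc k))) (U (\<T> k)))\<^sup>2 - \<epsilon>3 * (err P u (U (\<T> k)))\<^sup>2)
        \<le> C3 * (eta P (\<T> l) (U (\<T> l)))\<^sup>2)"
proof -
  have op: "open (dom P)" using problem by (simp add: valid_problem_def)
  have \<Omega>: "dom P \<in> lmeasurable" by (rule mesh_domain_lmeasurable[OF initial_mesh op])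
  note mesh = adaptive_mesh[OF initial_mesh meshes]
  let ?U = "\<lambda>k. U (\<T> k)" and ?E = "\<lambda>k. energy P (U (\<T> k))"
  have vi: "solves_vi P (discrete_X P (\<T> k)) (?U k)" for k by (rule discrete_solution[OF mesh(2)])
  have Uk: "?U k \<in> discrete_X P (\<T> k)" for k using vi by (simp add: solves_vi_def)
  have adm: "admissible P (?U k)" for k
    by (rule solves_vi_admissible[OF problem \<Omega> vi discrete_X_subset zero_discrete_X])
  have z0: "(\<lambda>x. 0, \<lambda>x. 0, \<lambda>x. 0) \<in> space_X P" using zero_discrete_X discrete_X_subset by blast
  obtain c where c: "0 < c"
    "\<And>Y y z. solves_vi P Y y \<Longrightarrow> Y \<subseteq> space_X P \<Longrightarrow> (\<lambda>x. 0, \<lambda>x. 0, \<lambda>x. 0) \<in> Y \<Longrightarrow> z \<in> Y \<Longrightarrow> admissible P z \<Longrightarrow>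
      c * (err P z y)\<^sup>2 \<le> energy P z - energy P y"
    using err_le_energy_gap[OF problem \<Omega>] by metis
  obtain K where K: "0 < K"
    "\<And>\<T> U u. is_mesh (dom P) \<T> \<Longrightarrow> solves_vi P (discrete_X P \<T>) U \<Longrightarrow> solves_vi P (space_X P) u \<Longrightarrow>
      energy P U - energy P u \<le> K * (err P u U)\<^sup>2"
    using energy_gap_le_err[OF problem \<Omega>] by metis
  have step: "c * (err P (?U (Suc k)) (?U k))\<^sup>2 \<le> ?E k - ?E (Suc k)" for k
  proof -
    have "?U k \<in> discrete_X P (\<T> (Suc k))"
      using Uk discrete_X_mono[OF mesh(3) fmeasurableD[OF \<Omega>]] by blast
    from c(2)[OF vi discrete_X_subset zero_discrete_X this adm]
    show ?thesis by (simp only: err_commute[of P "?U (Suc k)"])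
  qed
  have above: "energy P u \<le> ?E k" for k
  proof -
    have "?U k \<in> space_X P" using Uk discrete_X_subset by blast
    from c(2)[OF solution order_refl z0 this adm] c(1) show ?thesis
      by (smt (verit) mult_nonneg_nonneg zero_le_power2)
  qed
  have sum: "(\<Sum>k = l..N. (err P (?U (Suc k)) (?U k))\<^sup>2) \<le> K / c * Crel\<^sup>2 * (eta P (\<T> l) (?U l))\<^sup>2"
    if "l \<le> N" for l N
  proof -
    have "c * (\<Sum>k = l..N. (err P (?U (Suc k)) (?U k))\<^sup>2) \<le> (\<Sum>k = l..N. ?E k - ?E (Suc k))"
      unfolding sum_distrib_left by (rule sum_mono) (rule step)
    also have "\<dots> = ?E l - ?E (Suc N)"
      using that by (induction N rule: dec_induct) simp_all
    also have "\<dots> \<le> ?E l - energy P u" using above[of "Suc N"] by simp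
    also have "\<dots> \<le> K * (err P u (?U l))\<^sup>2" by (rule K(2)[OF mesh(1) vi solution])
    also have "\<dots> \<le> K * (Crel * eta P (\<T> l) (?U l))\<^sup>2"
    proof (intro mult_left_mono power_mono)
      show "err P u (?U l) \<le> Crel * eta P (\<T> l) (?U l)" by (rule reliability[OF mesh(2)])
      show "0 \<le> err P u (?U l)" by (simp add: err_def l2_norm_def split_def)
    qed (use K(1) in simp)
    finally show ?thesis using c(1) by (simp add: field_simps power_mult_distrib)
  qed
  show ?thesis
  proof (rule exI[of _ 0], rule exI[of _ "max 1 (K / c * Crel\<^sup>2)"], intro conjI allI impI)
    show "0 < eps3_star C1 \<rho>2 C2 Crel \<theta>" using theta constants by (intro eps3_star_pos)
    fix l N :: nat assume "l \<le> N"
    then have "(\<Sum>k = l..N. (err P (?U (Suc k)) (?U k))\<^sup>2) \<le> K / c * Crel\<^sup>2 * (eta P (\<T> l) (?U l))\<^sup>2" by (rule sum)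
    also have "\<dots> \<le> max 1 (K / c * Crel\<^sup>2) * (eta P (\<T> l) (?U l))\<^sup>2" by (intro mult_right_mono) simp_all
    finally show "(\<Sum>k = l..N. (err P (?U (Suc k)) (?U k))\<^sup>2 - 0 * (err P u (?U k))\<^sup>2)
        \<le> max 1 (K / c * Crel\<^sup>2) * (eta P (\<T> l) (?U l))\<^sup>2" by simp
  qed simp_all
qed

end
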